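(* Let $T$ be a triangulation of a marked surface $(S,\mathcal M)$ and let $J(Q,W)$ be the associated Jacobian algebra. Let $M_1$ and $M_2$ be string modules in $\operatorname{mod} J(Q,W)$. (1) If $M_1$ crosses $M_2$ in a module, with strings $$w_1=\operatorname{Pred}(\alpha)\xrightarrow{\alpha} w\xleftarrow{\beta}\operatorname{Succ}(\beta),\qquad w_2=\operatorname{Pred}(\gamma)\xleftarrow{\gamma} w\xrightarrow{\delta}\operatorname{Succ}(\delta),$$ then the modules $M_3=M(w_3)$ and $M_4=M(w_4)$ defined by $$w_3=\operatorname{Pred}(\alpha)\xrightarrow{\alpha} w\xrightarrow{\delta}\operatorname{Succ}(\delta),\qquad w_4=\operatorname{Pred}(\gamma)\xleftarrow{\gamma} w\xleftarrow{\beta}\operatorname{Succ}(\beta)$$ give a non-split short exact sequence in $\operatorname{mod} J(Q,W)$ of the form $$0\longrightarrow M_2\longrightarrow M_3\oplus M_4\longrightarrow M_1\longrightarrow 0 .$$ (2) If $M_1$ crosses $M_2$ in an arrow $\alpha$, where without loss of generality $s(\alpha)=t(w_1)$ and $t(\alpha)=s(w_2)$, then the module $M_3=M(w_3)$ defined by $w_3=w_1\xrightarrow{\alpha}w_2$ gives a non-split short exact sequence in $\operatorname{mod} J(Q,W)$ of the form $$0\longrightarrow M_2\longrightarrow M_3\longrightarrow M_1\longrightarrow 0 .$$ (3) If $M_1$ crosses $M_2$ in a 3-cycle $s(w_2)\xrightarrow{\gamma}s(\alpha)\xrightarrow{\alpha}t(\alpha)\xrightarrow{\beta}s(w_2)$,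 where (up to inverting $w_1$) $w_1=\operatorname{Pred}(\alpha)\xrightarrow{\alpha}\operatorname{Succ}(\alpha)$, then the modules $M_3=M(w_3)$ and $M_4=M(w_4)$ defined by $$w_3=\operatorname{Pred}(\alpha)\xleftarrow{\gamma}w_2,\qquad w_4={}_c\big(s(\alpha)\xrightarrow{\alpha}\operatorname{Succ}(\alpha)\big)$$ do not give rise to an element in $\operatorname{Ext}^1_{J(Q,W)}(M_1,M_2)$.
   Context: $k$ is an algebraically closed field. A marked surface $(S,\mathcal M)$ is a connected oriented 2-dimensional Riemann surface $S$ with non-empty boundary and a finite set $\mathcal M\subset\partial S$ of marked points meeting every boundary component; if $S$ is a disc, $|\mathcal M|\ge 4$. A triangulation $T$ is a maximal collection of pairwise non-crossing (simple) arcs with endpoints in $\mathcal M$ (boundary segments are not arcs). The quiver $Q$ of $T$ has the arcs of $T$ as vertices; for every triangle of $T$ and every pair of sides of it that are arcs of $T$, there is an arrow from one to the other if the second follows the first in the fixed cyclic order (induced by the orientation of $S$) of the sides of the triangle. The potential $W$ is the sum of the 3-cycles coming from triangles all of whose sides are arcs of $T$, and $J(Q,W)=kQ/I$, where $I$ is generated by all length-two subpaths of these 3-cycles. This is a finite dimensional gentle algebra. Paths are composed from left to right and $\operatorname{mod}$ denotes finitely generated right modules. Strings: for $\alpha\in Q_1$ let $s(\alpha),t(\alpha)$ be its start and end, and $\alpha^{-1}$ its formal inverse. A string is a word $w=\varepsilon_1\cdots\varepsilon_n$ with each $\varepsilon_i$ an arrow or formal inverse of an arrow, $t(\varepsilon_i)=s(\varepsilon_{i+1})$,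 $\varepsilon_{i+1}\ne\varepsilon_i^{-1}$, and no subword of $w$ or of its inverse lying in $I$; single vertices are also strings (corresponding to simple modules). $s(w)=s(\varepsilon_1)$, $t(w)=t(\varepsilon_n)$. $\mathcal S$ is the set of strings. $M(w)\simeq M(w^{-1})$ is the string module of $w$; a zero string gives the zero module. Direct arrows are drawn $\to$, inverse ones $\leftarrow$. A string is direct (inverse) if all its letters are arrows (formal inverses of arrows). $\operatorname{Pred}(\alpha)$ and $\operatorname{Succ}(\alpha)$ denote the substrings preceding and succeeding an occurrence of the arrow or inverse arrow $\alpha$ in a string. Deleting a cohook at the start: ${}_cw=0$ if $w$ is a direct string; otherwise ${}_cw$ is obtained from $w$ by deleting the first inverse arrow in $w$ and the direct string preceding it. Crossing of modules: a string module $M$ crosses a string module $N$ if there are strings $w_M,w_N$ with $M\simeq M(w_M)$, $N\simeq M(w_N)$ such that one of the following holds. (i) ($M$ crosses $N$ in a module) There is a string $w\in\mathcal S$, possibly consisting of a single vertex only, such that $w_M$ and $w_N$ do not both start at $s(w)$ and do not both end at $t(w)$ (that is, $\alpha$ and $\varepsilon$ below are not both absent, and $\beta$ and $\delta$ below are not both absent), and $$w_M=\operatorname{Pred}(\alpha)\xrightarrow{\alpha}w\xleftarrow{\beta}\operatorname{Succ}(\beta),\qquad w_N=\operatorname{Pred}(\varepsilon)\xleftarrow{\varepsilon}w\xrightarrow{\delta}\operatorname{Succ}(\delta)$$ where $\alpha,\beta,\varepsilon,\delta$ are arrows in $Q_1$; if $\alpha$ (resp. $\varepsilon$) does not exist then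 $w_M$ (resp. $w_N$) starts with $w$, and if $\beta$ (resp. $\delta$) does not exist then $w_M$ (resp. $w_N$) ends with $w$. (ii) ($M$ crosses $N$ in an arrow) There is an arrow $\alpha\in Q_1$ such that $w_M\xrightarrow{\alpha}w_N$ is a string. (iii) ($M$ crosses $N$ in a 3-cycle) There is a 3-cycle $a\xrightarrow{\alpha}b\xrightarrow{\delta}c\xrightarrow{\beta}a$ in $Q$ with $\alpha\delta,\delta\beta,\beta\alpha\in I$ such that $\alpha$ is in $w_M$, $s(w_N)=c$, and $w_N$ does not start or end with $\delta$ or $\beta$ nor their inverses. In the claim these definitions are applied to $M=M_1$, $N=M_2$, $w_M=w_1$, $w_N=w_2$.
   Formalization: In (1), when w is a single vertex, it is additionally assumed that αδ and βγ (when these arrows exist) do not lie in I; otherwise w_3 or w_4 is not a string and the claim fails. *)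

theory Defs
  imports
    "HOL-Complex_Analysis.Complex_Analysis"
    "HOL-Algebra.QuotRing"
    "HOL-Algebra.Module"
    "Graph_Theory.Arc_Walk"
begin

section \<open>Marked surfaces\<close>

text \<open>
  A Riemann surface with boundary is a space with an atlas of charts onto relatively open subsets
  of the closed upper half plane, with holomorphic transition maps. For a relatively open \<open>W\<close> the set
  \<open>interior W\<close> (taken in the plane) is the part of \<open>W\<close> with positive imaginary part. Holomorphy is
  only asked there: the transition maps are homeomorphisms, so by Schwarz reflection they are
  then conformal up to the boundary as well. The orientation is the one of the complex structure.
\<close>

definition upper_half_plane :: "complex set" where
  "upper_half_plane = {z. 0 \<le> Im z}"

type_synonym 'a atlas = "('a set \<times> ('a \<Rightarrow> complex)) set"

definition is_chart :: "'a topology \<Rightarrow> 'a set \<Rightarrow> ('a \<Rightarrow> complex) \<Rightarrow> bool" where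
  "is_chart X U \<phi> \<longleftrightarrow>
     openin X U \<and> openin (top_of_set upper_half_plane) (\<phi> ` U) \<and>
     homeomorphic_map (subtopology X U) (top_of_set (\<phi> ` U)) \<phi>"

definition riemann_surface :: "'a topology \<Rightarrow> 'a atlas \<Rightarrow> bool" where
  "riemann_surface X A \<longleftrightarrow>
     Hausdorff_space X \<and> second_countable X \<and>
     (\<forall>(U, \<phi>) \<in> A. is_chart X U \<phi>) \<and> (\<Union>(fst ` A) = topspace X) \<and>
     (\<forall>(U, \<phi>) \<in> A. \<forall>(V, \<psi>) \<in> A.
        (\<lambda>z. \<psi> (inv_into U \<phi> z)) holomorphic_on interior (\<phi> ` (U \<inter> V)))"

definition surface_boundary :: "'a atlas \<Rightarrow> 'a set" where
  "surface_boundary A = {x. \<exists>(U, \<phi>) \<in> A. x \<in> U \<and> Im (\<phi> x) = 0}"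

definition marked_surface :: "'a topology \<Rightarrow> 'a atlas \<Rightarrow> 'a set \<Rightarrow> bool" where
  "marked_surface X A P \<longleftrightarrow>
     riemann_surface X A \<and> compact_space X \<and> connected_space X \<and>
     surface_boundary A \<noteq> {} \<and> finite P \<and> P \<subseteq> surface_boundary A \<and>
     (\<forall>C \<in> connected_components_of (subtopology X (surface_boundary A)). C \<inter> P \<noteq> {}) \<and>
     (X homeomorphic_space top_of_set (cball (0::complex) 1) \<longrightarrow> card P \<ge> 4)"


section \<open>Arcs and triangulations\<close>

definition boundary_segment_path ::
    "'a topology \<Rightarrow> 'a atlas \<Rightarrow> 'a set \<Rightarrow> (real \<Rightarrow> 'a) \<Rightarrow> bool" where
  "boundary_segment_path X A P g \<longleftrightarrow>
     pathin X g \<and> g 0 \<in> P \<and> g 1 \<in> P \<and> inj_on g {0<..<1} \<and>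
     (\<forall>t \<in> {0<..<1}. g t \<in> surface_boundary A - P)"

definition boundary_segments :: "'a topology \<Rightarrow> 'a atlas \<Rightarrow> 'a set \<Rightarrow> 'a set set" where
  "boundary_segments X A P = {g ` {0..1} | g. boundary_segment_path X A P g}"

definition homotopic_rel_ends :: "'a topology \<Rightarrow> (real \<Rightarrow> 'a) \<Rightarrow> (real \<Rightarrow> 'a) \<Rightarrow> bool" where
  "homotopic_rel_ends X g h \<longleftrightarrow>
     homotopic_with (\<lambda>f. f 0 = g 0 \<and> f 1 = g 1) (top_of_set {0..1}) X g h"

text \<open>
  An arc is a simple curve in the interior of the surface connecting marked points (the two end
  points may coincide) that is neither contractible nor homotopic to a boundary segment. Arcs are
  recorded as subsets of the surface; they are considered up to homotopy relative to end points,
  so a triangulation is given by pairwise non-crossing, pairwise non-homotopic representatives.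
\<close>

definition arc_path :: "'a topology \<Rightarrow> 'a atlas \<Rightarrow> 'a set \<Rightarrow> (real \<Rightarrow> 'a) \<Rightarrow> bool" where
  "arc_path X A P g \<longleftrightarrow>
     pathin X g \<and> g 0 \<in> P \<and> g 1 \<in> P \<and> inj_on g {0<..<1} \<and>
     (\<forall>t \<in> {0<..<1}. g t \<notin> surface_boundary A) \<and>
     \<not> homotopic_rel_ends X g (\<lambda>_. g 0) \<and>
     (\<forall>h. boundary_segment_path X A P h \<longrightarrow> \<not> homotopic_rel_ends X g h)"

definition surface_arcs :: "'a topology \<Rightarrow> 'a atlas \<Rightarrow> 'a set \<Rightarrow> 'a set set" where
  "surface_arcs X A P = {g ` {0..1} | g. arc_path X A P g}"

definition homotopic_arcs :: "'a topology \<Rightarrow> 'a atlas \<Rightarrow> 'a set \<Rightarrow> 'a set \<Rightarrow> 'a set \<Rightarrow> bool" where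
  "homotopic_arcs X A P c d \<longleftrightarrow>
     (\<exists>g h. arc_path X A P g \<and> arc_path X A P h \<and>
        c = g ` {0..1} \<and> d = h ` {0..1} \<and> homotopic_rel_ends X g h)"

definition noncrossing_arcs :: "'a topology \<Rightarrow> 'a atlas \<Rightarrow> 'a set \<Rightarrow> 'a set set \<Rightarrow> bool" where
  "noncrossing_arcs X A P T \<longleftrightarrow>
     T \<subseteq> surface_arcs X A P \<and>
     (\<forall>c \<in> T. \<forall>d \<in> T. c \<noteq> d \<longrightarrow> c \<inter> d \<subseteq> P \<and> \<not> homotopic_arcs X A P c d)"

text \<open>
  Finiteness is automatic for a compact surface (the number of arcs of a triangulation is
  determined by the genus, the boundary components and the marked points).
\<close>

definition surface_triangulation :: "'a topology \<Rightarrow> 'a atlas \<Rightarrow> 'a set \<Rightarrow> 'a set set \<Rightarrow> bool" where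
  "surface_triangulation X A P T \<longleftrightarrow>
     noncrossing_arcs X A P T \<and> finite T \<and>
     (\<forall>T'. noncrossing_arcs X A P T' \<and> T \<subseteq> T' \<longrightarrow> T' = T)"

text \<open>
  Triangles are parametrised by the closed triangle whose corners are the third roots of unity, in
  counterclockwise order; corners and sides are indexed by \<open>nat\<close> with period 3.
\<close>

definition corner :: "nat \<Rightarrow> complex" where
  "corner k = cis (2 * pi * real k / 3)"

definition std_side :: "nat \<Rightarrow> complex set" where
  "std_side k = closed_segment (corner k) (corner (Suc k))"

definition std_triangle :: "complex set" where
  "std_triangle = convex hull (range corner)"

definition triangle_regions :: "'a topology \<Rightarrow> 'a atlas \<Rightarrow> 'a set set \<Rightarrow> 'a set set" where
  "triangle_regions X A T =
     connected_components_of (subtopology X (topspace X - (\<Union>T \<union> surface_boundary A)))"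

text \<open>
  An orientation preserving parametrisation of a closed triangle of \<open>T\<close>. Since all marked points lie
  on the boundary, there are no self-folded triangles: only corners can be identified. Orientation
  is tested by small counterclockwise circles, which must wind once around their centre when
  viewed in a chart.
\<close>

definition triangle_param ::
    "'a topology \<Rightarrow> 'a atlas \<Rightarrow> 'a set \<Rightarrow> 'a set set \<Rightarrow> (complex \<Rightarrow> 'a) \<Rightarrow> bool" where
  "triangle_param X A P T \<tau> \<longleftrightarrow>
     continuous_map (top_of_set std_triangle) X \<tau> \<and>
     inj_on \<tau> (std_triangle - range corner) \<and>
     \<tau> ` range corner \<subseteq> P \<and>
     \<tau> ` interior std_triangle \<in> triangle_regions X A T \<and>
     (\<forall>k. \<tau> ` std_side k \<in> T \<union> boundary_segments X A P) \<and>
     (\<forall>z \<in> interior std_triangle. \<forall>(U, \<phi>) \<in> A. \<tau> z \<in> U \<longrightarrow>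
        (\<forall>\<^sub>F r in at_right 0. winding_number (\<phi> \<circ> \<tau> \<circ> circlepath z r) (\<phi> (\<tau> z)) = 1))"

text \<open>\<open>D\<close> is (the interior of) a triangle with sides \<open>a\<close>, \<open>b\<close>, \<open>c\<close> in this cyclic order.\<close>

definition triangle_with_sides ::
    "'a topology \<Rightarrow> 'a atlas \<Rightarrow> 'a set \<Rightarrow> 'a set set \<Rightarrow> 'a set \<Rightarrow> 'a set \<Rightarrow> 'a set \<Rightarrow> 'a set \<Rightarrow> bool"
  where
  "triangle_with_sides X A P T D a b c \<longleftrightarrow>
     (\<exists>\<tau> k. triangle_param X A P T \<tau> \<and> D = \<tau> ` interior std_triangle \<and>
        a = \<tau> ` std_side k \<and> b = \<tau> ` std_side (k + 1) \<and> c = \<tau> ` std_side (k + 2))"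


section \<open>Path algebras and the Jacobian algebra\<close>

text \<open>
  A quiver is a directed multigraph. A path is a pair of its start vertex and its list of arrows,
  so \<open>(v, [])\<close> is the path of length zero at \<open>v\<close>; paths are composed from left to right.
\<close>

type_synonym ('v, 'e) quiver = "('v, 'e) pre_digraph"
type_synonym ('v, 'e) qpath = "'v \<times> 'e list"

definition qpaths :: "('v, 'e) quiver \<Rightarrow> ('v, 'e) qpath set" where
  "qpaths Q = {(u, p). \<exists>v. pre_digraph.awalk Q u p v}"

definition path_elem :: "('v, 'e) qpath \<Rightarrow> ('v, 'e) qpath \<Rightarrow> 'k::field" where
  "path_elem p = (\<lambda>q. if q = p then 1 else 0)"

definition path_algebra :: "('v, 'e) quiver \<Rightarrow> (('v, 'e) qpath \<Rightarrow> 'k::field) ring" where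
  "path_algebra Q =
    \<lparr>carrier = {f. finite {q. f q \<noteq> 0} \<and> {q. f q \<noteq> 0} \<subseteq> qpaths Q},
     mult = (\<lambda>f g (u, p). \<Sum>i\<le>length p.
        f (u, take i p) * g (pre_digraph.awlast Q u (take i p), drop i p)),
     one = (\<lambda>(u, p). if u \<in> verts Q \<and> p = [] then 1 else 0),
     zero = (\<lambda>_. 0),
     add = (\<lambda>f g q. f q + g q)\<rparr>"

text \<open>
  The arrow \<open>(D, a, b)\<close> goes from \<open>a\<close> to \<open>b\<close> and comes from the triangle \<open>D\<close>; two arcs that are sides
  of two triangles may be joined by two arrows.
\<close>

type_synonym 'a tri_arrow = "'a set \<times> 'a set \<times> 'a set"

definition triangulation_quiver ::
    "'a topology \<Rightarrow> 'a atlas \<Rightarrow> 'a set \<Rightarrow> 'a set set \<Rightarrow> ('a set, 'a tri_arrow) quiver" where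
  "triangulation_quiver X A P T =
    \<lparr>verts = T,
     arcs = {(D, a, b). a \<in> T \<and> b \<in> T \<and> (\<exists>c. triangle_with_sides X A P T D a b c)},
     tail = (\<lambda>(D, a, b). a),
     head = (\<lambda>(D, a, b). b)\<rparr>"

text \<open>The 3-cycles occurring in the potential, with all their cyclic rotations.\<close>

definition potential_cycles ::
    "'a topology \<Rightarrow> 'a atlas \<Rightarrow> 'a set \<Rightarrow> 'a set set \<Rightarrow> 'a tri_arrow list set" where
  "potential_cycles X A P T =
     {[(D, a, b), (D, b, c), (D, c, a)] | D a b c.
        a \<in> T \<and> b \<in> T \<and> c \<in> T \<and> triangle_with_sides X A P T D a b c}"

definition jacobian_ideal ::
    "'a topology \<Rightarrow> 'a atlas \<Rightarrow> 'a set \<Rightarrow> 'a set set \<Rightarrow> (('a set, 'a tri_arrow) qpath \<Rightarrow> 'k::field) set"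
  where
  "jacobian_ideal X A P T =
    (let Q = triangulation_quiver X A P T in
     Idl\<^bsub>path_algebra Q\<^esub>
       {path_elem (tail Q x, [x, y]) | x y z. [x, y, z] \<in> potential_cycles X A P T})"


section \<open>Right modules\<close>

text \<open>
  Right modules are represented with the record of left modules: \<open>a \<odot> x\<close> stands for \<open>x\<cdot>a\<close>, whence
  the reversed order of the factors in \<open>smult_mult\<close>. The ring is not commutative.
\<close>

locale right_module = R?: ring R + M?: abelian_group M for R (structure) and M (structure) +
  assumes smult_closed: "\<lbrakk>a \<in> carrier R; x \<in> carrier M\<rbrakk> \<Longrightarrow> a \<odot>\<^bsub>M\<^esub> x \<in> carrier M"
    and smult_l_distr: "\<lbrakk>a \<in> carrier R; b \<in> carrier R; x \<in> carrier M\<rbrakk> \<Longrightarrow>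
      (a \<oplus>\<^bsub>R\<^esub> b) \<odot>\<^bsub>M\<^esub> x = a \<odot>\<^bsub>M\<^esub> x \<oplus>\<^bsub>M\<^esub> b \<odot>\<^bsub>M\<^esub> x"
    and smult_r_distr: "\<lbrakk>a \<in> carrier R; x \<in> carrier M; y \<in> carrier M\<rbrakk> \<Longrightarrow>
      a \<odot>\<^bsub>M\<^esub> (x \<oplus>\<^bsub>M\<^esub> y) = a \<odot>\<^bsub>M\<^esub> x \<oplus>\<^bsub>M\<^esub> a \<odot>\<^bsub>M\<^esub> y"
    and smult_mult: "\<lbrakk>a \<in> carrier R; b \<in> carrier R; x \<in> carrier M\<rbrakk> \<Longrightarrow>
      (a \<otimes>\<^bsub>R\<^esub> b) \<odot>\<^bsub>M\<^esub> x = b \<odot>\<^bsub>M\<^esub> (a \<odot>\<^bsub>M\<^esub> x)"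
    and smult_one: "x \<in> carrier M \<Longrightarrow> \<one>\<^bsub>R\<^esub> \<odot>\<^bsub>M\<^esub> x = x"

definition fg_right_module :: "'r ring \<Rightarrow> ('r, 'm) module \<Rightarrow> bool" where
  "fg_right_module R M \<longleftrightarrow> right_module R M \<and>
     (\<exists>F. finite F \<and> F \<subseteq> carrier M \<and>
        (\<forall>x \<in> carrier M. \<exists>c \<in> F \<rightarrow> carrier R. x = (\<Oplus>\<^bsub>M\<^esub>y\<in>F. c y \<odot>\<^bsub>M\<^esub> y)))"

definition rmodule_hom :: "'r ring \<Rightarrow> ('r, 'm) module \<Rightarrow> ('r, 'n) module \<Rightarrow> ('m \<Rightarrow> 'n) set" where
  "rmodule_hom R M N = {f \<in> carrier M \<rightarrow> carrier N.
     (\<forall>x \<in> carrier M. \<forall>y \<in> carrier M. f (x \<oplus>\<^bsub>M\<^esub> y) = f x \<oplus>\<^bsub>N\<^esub> f y) \<and>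
     (\<forall>a \<in> carrier R. \<forall>x \<in> carrier M. f (a \<odot>\<^bsub>M\<^esub> x) = a \<odot>\<^bsub>N\<^esub> f x)}"

definition rmodule_iso :: "'r ring \<Rightarrow> ('r, 'm) module \<Rightarrow> ('r, 'n) module \<Rightarrow> bool" where
  "rmodule_iso R M N \<longleftrightarrow> (\<exists>f \<in> rmodule_hom R M N. bij_betw f (carrier M) (carrier N))"

definition rmodule_sum :: "('r, 'm) module \<Rightarrow> ('r, 'n) module \<Rightarrow> ('r, 'm \<times> 'n) module" where
  "rmodule_sum M N =
    \<lparr>carrier = carrier M \<times> carrier N, mult = undefined, one = undefined,
     zero = (\<zero>\<^bsub>M\<^esub>, \<zero>\<^bsub>N\<^esub>),
     add = (\<lambda>(x, y) (x', y'). (x \<oplus>\<^bsub>M\<^esub> x', y \<oplus>\<^bsub>N\<^esub> y')),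
     smult = (\<lambda>a (x, y). (a \<odot>\<^bsub>M\<^esub> x, a \<odot>\<^bsub>N\<^esub> y))\<rparr>"

text \<open>\<open>0 \<longlongrightarrow> L \<longlongrightarrow> E \<longlongrightarrow> N \<longlongrightarrow> 0\<close> with maps \<open>f\<close> and \<open>g\<close> is exact in the category of finitely generated
  right modules.\<close>

definition short_exact ::
    "'r ring \<Rightarrow> ('r, 'l) module \<Rightarrow> ('l \<Rightarrow> 'e) \<Rightarrow> ('r, 'e) module \<Rightarrow> ('e \<Rightarrow> 'n) \<Rightarrow> ('r, 'n) module \<Rightarrow> bool"
  where
  "short_exact R L f E g N \<longleftrightarrow>
     fg_right_module R L \<and> fg_right_module R E \<and> fg_right_module R N \<and>
     f \<in> rmodule_hom R L E \<and> g \<in> rmodule_hom R E N \<and>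
     inj_on f (carrier L) \<and> f ` carrier L = {x \<in> carrier E. g x = \<zero>\<^bsub>N\<^esub>} \<and>
     g ` carrier E = carrier N"

definition gives_nonsplit_extension ::
    "'r ring \<Rightarrow> ('r, 'l) module \<Rightarrow> ('r, 'e) module \<Rightarrow> ('r, 'n) module \<Rightarrow> bool" where
  "gives_nonsplit_extension R L E N \<longleftrightarrow>
     (\<exists>f g. short_exact R L f E g N \<and>
        \<not> (\<exists>s \<in> rmodule_hom R N E. \<forall>x \<in> carrier N. g (s x) = x))"

text \<open>\<open>E\<close> is the middle term of a representative of some element of the Yoneda group
  \<open>Ext\<^sup>1(N, L)\<close>.\<close>

definition gives_ext_element ::
    "'r ring \<Rightarrow> ('r, 'l) module \<Rightarrow> ('r, 'e) module \<Rightarrow> ('r, 'n) module \<Rightarrow> bool" where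
  "gives_ext_element R L E N \<longleftrightarrow> (\<exists>f g. short_exact R L f E g N)"


section \<open>Strings and string modules\<close>

datatype 'e letter = Dir 'e | Inv 'e

fun inv_letter :: "'e letter \<Rightarrow> 'e letter" where
  "inv_letter (Dir a) = Inv a"
| "inv_letter (Inv a) = Dir a"

fun letter_arrow :: "'e letter \<Rightarrow> 'e" where
  "letter_arrow (Dir a) = a"
| "letter_arrow (Inv a) = a"

fun letter_src :: "('v, 'e) quiver \<Rightarrow> 'e letter \<Rightarrow> 'v" where
  "letter_src Q (Dir a) = tail Q a"
| "letter_src Q (Inv a) = head Q a"

fun letter_tgt :: "('v, 'e) quiver \<Rightarrow> 'e letter \<Rightarrow> 'v" where
  "letter_tgt Q (Dir a) = head Q a"
| "letter_tgt Q (Inv a) = tail Q a"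

text \<open>A word carries its start vertex, so that single vertices are words.\<close>

type_synonym ('v, 'e) word = "'v \<times> 'e letter list"

definition word_start :: "('v, 'e) word \<Rightarrow> 'v" where
  "word_start w = fst w"

definition word_end :: "('v, 'e) quiver \<Rightarrow> ('v, 'e) word \<Rightarrow> 'v" where
  "word_end Q w = (if snd w = [] then fst w else letter_tgt Q (last (snd w)))"

definition inv_letters :: "'e letter list \<Rightarrow> 'e letter list" where
  "inv_letters ls = rev (map inv_letter ls)"

fun is_walk :: "('v, 'e) quiver \<Rightarrow> 'v \<Rightarrow> 'e letter list \<Rightarrow> bool" where
  "is_walk Q u [] \<longleftrightarrow> u \<in> verts Q"
| "is_walk Q u (l # ls) \<longleftrightarrow>
     letter_arrow l \<in> arcs Q \<and> letter_src Q l = u \<and> is_walk Q (letter_tgt Q l) ls"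

definition is_string ::
    "('v, 'e) quiver \<Rightarrow> (('v, 'e) qpath \<Rightarrow> 'k::field) set \<Rightarrow> ('v, 'e) word \<Rightarrow> bool" where
  "is_string Q I w \<longleftrightarrow>
     is_walk Q (fst w) (snd w) \<and>
     (\<forall>i. Suc i < length (snd w) \<longrightarrow> snd w ! Suc i \<noteq> inv_letter (snd w ! i)) \<and>
     (\<forall>xs p ys. p \<noteq> [] \<and>
        (snd w = xs @ map Dir p @ ys \<or> inv_letters (snd w) = xs @ map Dir p @ ys) \<longrightarrow>
        path_elem (tail Q (hd p), p) \<notin> I)"

text \<open>
  The string module of a word with \<open>n\<close> letters has basis \<open>z\<^sub>0, \<dots>, z\<^sub>n\<close>; a direct letter
  \<open>\<epsilon>\<^sub>j = \<alpha>\<close> means \<open>z\<^sub>j\<^sub>-\<^sub>1\<cdot>\<alpha> = z\<^sub>j\<close>, an inverse letter \<open>\<epsilon>\<^sub>j = \<alpha>\<^sup>-\<^sup>1\<close> means \<open>z\<^sub>j\<cdot>\<alpha> = z\<^sub>j\<^sub>-\<^sub>1\<close>. Elements are coefficient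
  functions supported on \<open>{0..n}\<close>. The letter \<open>\<epsilon>\<^sub>j\<close> is \<open>snd w ! (j - 1)\<close>.
\<close>

definition arrow_action :: "('v, 'e) word \<Rightarrow> 'e \<Rightarrow> (nat \<Rightarrow> 'k::field) \<Rightarrow> nat \<Rightarrow> 'k" where
  "arrow_action w a x = (\<lambda>j.
     (if 1 \<le> j \<and> j \<le> length (snd w) \<and> snd w ! (j - 1) = Dir a then x (j - 1) else 0) +
     (if j < length (snd w) \<and> snd w ! j = Inv a then x (j + 1) else 0))"

definition vertex_action ::
    "('v, 'e) quiver \<Rightarrow> ('v, 'e) word \<Rightarrow> 'v \<Rightarrow> (nat \<Rightarrow> 'k::field) \<Rightarrow> nat \<Rightarrow> 'k" where
  "vertex_action Q w v x =
     (\<lambda>j. if j \<le> length (snd w) \<and> word_end Q (fst w, take j (snd w)) = v then x j else 0)"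

definition path_action ::
    "('v, 'e) quiver \<Rightarrow> ('v, 'e) word \<Rightarrow> ('v, 'e) qpath \<Rightarrow> (nat \<Rightarrow> 'k::field) \<Rightarrow> nat \<Rightarrow> 'k" where
  "path_action Q w q x = foldl (\<lambda>y a. arrow_action w a y) (vertex_action Q w (fst q) x) (snd q)"

definition path_algebra_action ::
    "('v, 'e) quiver \<Rightarrow> ('v, 'e) word \<Rightarrow> (('v, 'e) qpath \<Rightarrow> 'k::field) \<Rightarrow> (nat \<Rightarrow> 'k) \<Rightarrow> nat \<Rightarrow> 'k"
  where
  "path_algebra_action Q w f x = (\<lambda>j. \<Sum>q | f q \<noteq> 0. f q * path_action Q w q x j)"

text \<open>
  A residue class modulo \<open>I\<close> acts through any of its representatives; for a string the choice does
  not matter, as \<open>I\<close> acts by zero.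
\<close>

definition string_module ::
    "('v, 'e) quiver \<Rightarrow> ('v, 'e) word \<Rightarrow> ((('v, 'e) qpath \<Rightarrow> 'k::field) set, nat \<Rightarrow> 'k) module" where
  "string_module Q w =
    \<lparr>carrier = {x. \<forall>j>length (snd w). x j = 0}, mult = undefined, one = undefined,
     zero = (\<lambda>_. 0), add = (\<lambda>x y j. x j + y j),
     smult = (\<lambda>F. path_algebra_action Q w (SOME f. f \<in> F))\<rparr>"

definition zero_module :: "('r, nat \<Rightarrow> 'k::field) module" where
  "zero_module =
    \<lparr>carrier = {\<lambda>_. 0}, mult = undefined, one = undefined,
     zero = (\<lambda>_. 0), add = (\<lambda>x y j. x j + y j), smult = (\<lambda>_ x. x)\<rparr>"

text \<open>\<open>None\<close> is the zero string.\<close>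

definition string_module_opt ::
    "('v, 'e) quiver \<Rightarrow> ('v, 'e) word option \<Rightarrow>
     ((('v, 'e) qpath \<Rightarrow> 'k::field) set, nat \<Rightarrow> 'k) module" where
  "string_module_opt Q w = (case w of None \<Rightarrow> zero_module | Some v \<Rightarrow> string_module Q v)"

definition is_string_module ::
    "('v, 'e) quiver \<Rightarrow> (('v, 'e) qpath \<Rightarrow> 'k::field) set \<Rightarrow>
     ((('v, 'e) qpath \<Rightarrow> 'k) set, 'm) module \<Rightarrow> bool" where
  "is_string_module Q I M \<longleftrightarrow>
     fg_right_module (path_algebra Q Quot I) M \<and>
     (\<exists>w. is_string Q I w \<and> rmodule_iso (path_algebra Q Quot I) M (string_module Q w))"

definition delete_cohook_start ::
    "('v, 'e) quiver \<Rightarrow> ('v, 'e) word \<Rightarrow> ('v, 'e) word option" where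
  "delete_cohook_start Q w =
     (case dropWhile (\<lambda>l. \<exists>a. l = Dir a) (snd w) of
        [] \<Rightarrow> None
      | l # ls \<Rightarrow> Some (letter_tgt Q l, ls))"


section \<open>Crossings\<close>

text \<open>
  In a crossing in a module, \<open>p\<^sub>1\<close> is the word consisting of the predecessors of \<open>\<alpha>\<close> followed by \<open>\<alpha>\<close>,
  and \<open>p\<^sub>2\<close> consists of the predecessors of \<open>\<gamma>\<close> followed by \<open>\<gamma>\<^sup>-\<^sup>1\<close>; the lists \<open>q\<^sub>1\<close>, \<open>q\<^sub>2\<close> are \<open>\<beta>\<^sup>-\<^sup>1\<close> resp. \<open>\<delta>\<close>
  followed by the successors. They are empty if the arrow in question does not exist.

  As usual for string algebras there are two strings of length zero at a vertex, that
  is, a string \<open>w = (v, [])\<close> has a left and a right side, and letters meeting \<open>v\<close> from opposite sides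
  must be composable. Within \<open>w\<^sub>1\<close> and within \<open>w\<^sub>2\<close> this holds since they are strings; for the remaining
  combinations it says that \<open>\<alpha>\<delta>\<close> and \<open>\<beta>\<gamma>\<close> do not lie in \<open>I\<close>. Geometrically, \<open>\<alpha>\<close>, \<open>\<gamma>\<close> lie in the triangle on
  one side of the arc \<open>v\<close> and \<open>\<beta>\<close>, \<open>\<delta>\<close> in the one on the other side. Nothing is required if \<open>w\<close> has positive
  length.
\<close>

definition crosses_in_module ::
    "('v, 'e) quiver \<Rightarrow> (('v, 'e) qpath \<Rightarrow> 'k::field) set \<Rightarrow>
     ((('v, 'e) qpath \<Rightarrow> 'k) set, 'm) module \<Rightarrow> ((('v, 'e) qpath \<Rightarrow> 'k) set, 'n) module \<Rightarrow>
     ('v, 'e) word \<Rightarrow> ('v, 'e) word \<Rightarrow> ('v, 'e) word \<Rightarrow> 'e letter list \<Rightarrow> 'e letter list \<Rightarrow> bool"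
  where
  "crosses_in_module Q I M1 M2 p1 p2 w q1 q2 \<longleftrightarrow>
     (let w1 = (fst p1, snd p1 @ snd w @ q1); w2 = (fst p2, snd p2 @ snd w @ q2) in
      rmodule_iso (path_algebra Q Quot I) M1 (string_module Q w1) \<and>
      rmodule_iso (path_algebra Q Quot I) M2 (string_module Q w2) \<and>
      is_string Q I w \<and> is_string Q I w1 \<and> is_string Q I w2 \<and>
      word_end Q p1 = word_start w \<and> word_end Q p2 = word_start w \<and>
      (snd p1 = [] \<or> (\<exists>\<alpha>. last (snd p1) = Dir \<alpha>)) \<and>
      (q1 = [] \<or> (\<exists>\<beta>. hd q1 = Inv \<beta>)) \<and>
      (snd p2 = [] \<or> (\<exists>\<gamma>. last (snd p2) = Inv \<gamma>)) \<and>
      (q2 = [] \<or> (\<exists>\<delta>. hd q2 = Dir \<delta>)) \<and>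
      \<not> (snd p1 = [] \<and> snd p2 = []) \<and> \<not> (q1 = [] \<and> q2 = []) \<and>
      (snd w = [] \<longrightarrow>
        (\<forall>\<alpha> \<delta>. snd p1 \<noteq> [] \<and> last (snd p1) = Dir \<alpha> \<and> q2 \<noteq> [] \<and> hd q2 = Dir \<delta> \<longrightarrow>
           path_elem (tail Q \<alpha>, [\<alpha>, \<delta>]) \<notin> I) \<and>
        (\<forall>\<beta> \<gamma>. snd p2 \<noteq> [] \<and> last (snd p2) = Inv \<gamma> \<and> q1 \<noteq> [] \<and> hd q1 = Inv \<beta> \<longrightarrow>
           path_elem (tail Q \<beta>, [\<beta>, \<gamma>]) \<notin> I)))"

definition crosses_in_arrow ::
    "('v, 'e) quiver \<Rightarrow> (('v, 'e) qpath \<Rightarrow> 'k::field) set \<Rightarrow>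
     ((('v, 'e) qpath \<Rightarrow> 'k) set, 'm) module \<Rightarrow> ((('v, 'e) qpath \<Rightarrow> 'k) set, 'n) module \<Rightarrow>
     ('v, 'e) word \<Rightarrow> 'e \<Rightarrow> ('v, 'e) word \<Rightarrow> bool" where
  "crosses_in_arrow Q I M1 M2 w1 \<alpha> w2 \<longleftrightarrow>
     rmodule_iso (path_algebra Q Quot I) M1 (string_module Q w1) \<and>
     rmodule_iso (path_algebra Q Quot I) M2 (string_module Q w2) \<and>
     is_string Q I w1 \<and> is_string Q I w2 \<and> \<alpha> \<in> arcs Q \<and>
     tail Q \<alpha> = word_end Q w1 \<and> head Q \<alpha> = word_start w2 \<and>
     is_string Q I (fst w1, snd w1 @ Dir \<alpha> # snd w2)"

text \<open>
  Here \<open>w\<^sub>1\<close> is the predecessor word \<open>p\<close> of \<open>\<alpha>\<close>, then \<open>\<alpha>\<close>, then the letters \<open>q\<close>. The 3-cycle is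
  \<open>s(w\<^sub>2) \<rightarrow> s(\<alpha>) \<rightarrow> t(\<alpha>) \<rightarrow> s(w\<^sub>2)\<close> with arrows \<open>\<gamma>\<close>, \<open>\<alpha>\<close>, \<open>\<beta>\<close>.
\<close>

definition crosses_in_3cycle ::
    "('v, 'e) quiver \<Rightarrow> (('v, 'e) qpath \<Rightarrow> 'k::field) set \<Rightarrow>
     ((('v, 'e) qpath \<Rightarrow> 'k) set, 'm) module \<Rightarrow> ((('v, 'e) qpath \<Rightarrow> 'k) set, 'n) module \<Rightarrow>
     'e \<Rightarrow> 'e \<Rightarrow> 'e \<Rightarrow> ('v, 'e) word \<Rightarrow> 'e letter list \<Rightarrow> ('v, 'e) word \<Rightarrow> bool" where
  "crosses_in_3cycle Q I M1 M2 \<gamma> \<alpha> \<beta> p q w2 \<longleftrightarrow>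
     (let w1 = (fst p, snd p @ Dir \<alpha> # q) in
      rmodule_iso (path_algebra Q Quot I) M1 (string_module Q w1) \<and>
      rmodule_iso (path_algebra Q Quot I) M2 (string_module Q w2) \<and>
      is_string Q I w1 \<and> is_string Q I w2 \<and>
      {\<alpha>, \<beta>, \<gamma>} \<subseteq> arcs Q \<and>
      tail Q \<gamma> = word_start w2 \<and> head Q \<gamma> = tail Q \<alpha> \<and>
      head Q \<alpha> = tail Q \<beta> \<and> head Q \<beta> = word_start w2 \<and>
      path_elem (tail Q \<gamma>, [\<gamma>, \<alpha>]) \<in> I \<and> path_elem (tail Q \<alpha>, [\<alpha>, \<beta>]) \<in> I \<and>
      path_elem (tail Q \<beta>, [\<beta>, \<gamma>]) \<in> I \<and>
      (snd w2 \<noteq> [] \<longrightarrow>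
        hd (snd w2) \<notin> {Dir \<beta>, Inv \<beta>, Dir \<gamma>, Inv \<gamma>} \<and>
        last (snd w2) \<notin> {Dir \<beta>, Inv \<beta>, Dir \<gamma>, Inv \<gamma>}))"

end

theory Submission
  imports Defs
begin

text \<open>
  The argument takes place over a quiver with monomial relations of length two. There a string is a
  walk in which every two consecutive letters may follow each other (\<open>is_string_iff\<close>), the ideal
  acts by zero on string modules, and homomorphisms of string modules are the linear maps commuting
  with all vertices and arrows. The maps of the exact sequences are graph maps: if a word \<open>u\<close> occurs
  in two strings, such that all adjacent arrows leave \<open>u\<close> in the first string and enter it in the
  second, then \<open>u\<close> spans a quotient of the first module and a submodule of the second, and the
  composite is a homomorphism (\<open>segment_map_hom\<close>).

  For a crossing in a module, write \<open>w\<^sub>1 = p\<^sub>1 u q\<^sub>1\<close> and \<open>w\<^sub>2 = p\<^sub>2 u q\<^sub>2\<close>. Then \<open>M(w\<^sub>2)\<close> maps to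
  \<open>M(w\<^sub>3) \<oplus> M(w\<^sub>4)\<close> through its quotients \<open>u q\<^sub>2\<close> and \<open>p\<^sub>2 u\<close>, and the middle term maps to \<open>M(w\<^sub>1)\<close> by
  the difference of the maps through \<open>p\<^sub>1 u\<close> and \<open>u q\<^sub>1\<close>; exactness says that two coefficient functions
  agreeing on \<open>u\<close> can be glued. For a crossing in an arrow, \<open>w\<^sub>2\<close> spans a submodule of \<open>M(w\<^sub>3)\<close> with
  quotient \<open>M(w\<^sub>1)\<close>.

  These sequences do not split for a reason visible on diagonal coefficients. An endomorphism of a
  string module has the same diagonal coefficient at all positions, because a string is connected
  by arrows with which the endomorphism commutes (\<open>endomorphism_diagonal_constant\<close>). A section would
  write the identity of \<open>M(w\<^sub>1)\<close> as a difference of two endomorphisms, one factoring through \<open>M(w\<^sub>3)\<close>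
  and one through \<open>M(w\<^sub>4)\<close>, and each of them has a vanishing diagonal coefficient: either its image
  avoids an end of \<open>w\<^sub>1\<close>, or the arrow by which \<open>w\<^sub>3\<close> or \<open>w\<^sub>4\<close> extends beyond the end of \<open>w\<^sub>1\<close>
  forces the coefficient there to vanish (\<open>hom_diagonal_zero_right\<close>, \<open>hom_diagonal_zero_left\<close>). For a
  crossing in an arrow the latter applies to the section itself.

  For a crossing in a 3-cycle there is no exact sequence at all, since the dimension of the middle term
  is too small: with \<open>w\<^sub>1 = p \<alpha> q\<close>, the string \<open>w\<^sub>3\<close> consists of \<open>p\<close>, \<open>\<gamma>\<^sup>-\<^sup>1\<close> and \<open>w\<^sub>2\<close>, but
  deleting the cohook from \<open>\<alpha> q\<close> leaves the zero string or removes at least \<open>\<alpha>\<close> and an inverse letter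
  (\<open>no_short_exact_by_dimension\<close>). That \<open>w\<^sub>3\<close> is a string requires that
  every arrow is the first factor, and the second factor, of at most one relation. This is where the
  surface enters: two sides of a triangle determine the third, as the sides together form the
  closure of the triangle minus the triangle, and distinct arcs share only marked points
  (\<open>triangle_third_side\<close>).
\<close>


section \<open>The path algebra of a finite quiver\<close>

locale finite_quiver = wf_digraph Q for Q :: "('v, 'e) quiver" +
  assumes finite_verts: "finite (verts Q)"
begin

lemma qpaths_iff: "(u, p) \<in> qpaths Q \<longleftrightarrow> awalk u p (awlast u p)"
  unfolding qpaths_def by (auto elim: awalkE)

lemma qpaths_append_iff:
  "(u, p @ q) \<in> qpaths Q \<longleftrightarrow> (u, p) \<in> qpaths Q \<and> (awlast u p, q) \<in> qpaths Q"
  by (metis awalk_append_iff qpaths_iff awlast_append)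

lemma awlast_awlast_drop_take:
  "awlast (awlast u (take j p)) (take k (drop j p)) = awlast u (take (j + k) p)"
  by (simp add: take_add awlast_append)

definition path_concat :: "('v, 'e) qpath \<Rightarrow> ('v, 'e) qpath \<Rightarrow> ('v, 'e) qpath" where
  "path_concat q r = (fst q, snd q @ snd r)"

definition path_end :: "('v, 'e) qpath \<Rightarrow> 'v" where
  "path_end q = awlast (fst q) (snd q)"

lemma path_algebra_mult:
  "(f \<otimes>\<^bsub>path_algebra Q\<^esub> g) (u, p) =
     (\<Sum>i\<le>length p. f (u, take i p) * g (awlast u (take i p), drop i p))"
  by (simp add: path_algebra_def)

lemma path_algebra_mult_nonzeroE:
  assumes "(f \<otimes>\<^bsub>path_algebra Q\<^esub> g) (u, p) \<noteq> 0"
  obtains i where "i \<le> length p" "f (u, take i p) \<noteq> 0" "g (awlast u (take i p), drop i p) \<noteq> 0"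
proof -
  have "\<exists>i\<in>{..length p}. f (u, take i p) * g (awlast u (take i p), drop i p) \<noteq> 0"
    using assms unfolding path_algebra_mult by (rule contrapos_np) (auto intro: sum.neutral)
  then show ?thesis
    using that by auto
qed

lemma path_algebra_mult_support:
  "{s. (f \<otimes>\<^bsub>path_algebra Q\<^esub> g) s \<noteq> 0} \<subseteq>
     (\<lambda>(q, r). path_concat q r) ` ({q. f q \<noteq> 0 } \<times> {r. g r \<noteq> 0})"
proof
  fix s assume "s \<in> {s. (f \<otimes>\<^bsub>path_algebra Q\<^esub> g) s \<noteq> 0}"
  moreover obtain u p where s: "s = (u, p)" by (cases s)
  ultimately obtain i where "i \<le> length p" "f (u, take i p) \<noteq> 0"
    "g (awlast u (take i p), drop i p) \<noteq> 0"
    by (auto elim: path_algebra_mult_nonzeroE)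
  then show "s \<in> (\<lambda>(q, r). path_concat q r) ` ({q. f q \<noteq> 0 } \<times> {r. g r \<noteq> 0})"
    unfolding s path_concat_def
    by (intro image_eqI[where x = "((u, take i p), (awlast u (take i p), drop i p))"]) auto
qed

lemma path_algebra_mult_closed:
  assumes "f \<in> carrier (path_algebra Q)" "g \<in> carrier (path_algebra Q)"
  shows "f \<otimes>\<^bsub>path_algebra Q\<^esub> g \<in> carrier (path_algebra Q)"
proof -
  have "finite {s. (f \<otimes>\<^bsub>path_algebra Q\<^esub> g) s \<noteq> 0}"
    by (rule finite_subset[OF path_algebra_mult_support]) (use assms in \<open>auto simp: path_algebra_def\<close>)
  moreover have "s \<in> qpaths Q" if "(f \<otimes>\<^bsub>path_algebra Q\<^esub> g) s \<noteq> 0" for s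
  proof -
    obtain u p where s: "s = (u, p)" by (cases s)
    from that obtain i where "f (u, take i p) \<noteq> 0" "g (awlast u (take i p), drop i p) \<noteq> 0"
      unfolding s by (rule path_algebra_mult_nonzeroE)
    then have "(u, take i p) \<in> qpaths Q" "(awlast u (take i p), drop i p) \<in> qpaths Q"
      using assms by (auto simp: path_algebra_def)
    then show ?thesis
      unfolding s by (metis append_take_drop_id qpaths_append_iff)
  qed
  ultimately show ?thesis
    by (auto simp: path_algebra_def)
qed

lemma path_algebra_mult_assoc:
  "f \<otimes>\<^bsub>path_algebra Q\<^esub> g \<otimes>\<^bsub>path_algebra Q\<^esub> h = f \<otimes>\<^bsub>path_algebra Q\<^esub> (g \<otimes>\<^bsub>path_algebra Q\<^esub> h)"
proof
  fix s :: "('v, 'e) qpath"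
  obtain u p where s: "s = (u, p)" by (cases s)
  \<comment> \<open>the path \<open>p\<close> cut into three pieces, the first two of length \<open>i\<close> and \<open>j\<close>\<close>
  define t where "t i j = f (u, take i p) * g (awlast u (take i p), take j (drop i p)) *
    h (awlast u (take (i + j) p), drop (i + j) p)" for i j
  have "(f \<otimes>\<^bsub>path_algebra Q\<^esub> g \<otimes>\<^bsub>path_algebra Q\<^esub> h) s = (\<Sum>k\<le>length p. \<Sum>i\<le>k. t i (k - i))"
    unfolding s path_algebra_mult sum_distrib_right t_def
    by (intro sum.cong refl) (auto simp: min_def drop_take)
  also have "\<dots> = (\<Sum>i\<le>length p. \<Sum>j\<le>length p - i. t i j)"
    unfolding sum.triangle_reindex_eq[symmetric]
    by (subst sum.Sigma) (auto intro!: sum.cong)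
  also have "\<dots> = (f \<otimes>\<^bsub>path_algebra Q\<^esub> (g \<otimes>\<^bsub>path_algebra Q\<^esub> h)) s"
    unfolding s path_algebra_mult sum_distrib_left t_def
    by (intro sum.cong refl) (simp_all add: awlast_awlast_drop_take mult.assoc add.commute)
  finally show "(f \<otimes>\<^bsub>path_algebra Q\<^esub> g \<otimes>\<^bsub>path_algebra Q\<^esub> h) s =
    (f \<otimes>\<^bsub>path_algebra Q\<^esub> (g \<otimes>\<^bsub>path_algebra Q\<^esub> h)) s" .
qed

lemma one_closed:
  "(\<one>\<^bsub>path_algebra Q\<^esub> :: _ \<Rightarrow> 'k::field) \<in> carrier (path_algebra Q)"
proof -
  have one: "\<one>\<^bsub>path_algebra Q\<^esub> = (\<lambda>(u, p). if u \<in> verts Q \<and> p = [] then 1 else (0::'k))"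
    by (simp add: path_algebra_def)
  then have supp: "{q. \<one>\<^bsub>path_algebra Q\<^esub> q \<noteq> (0::'k::field)} = verts Q \<times> {[]}"
    by (auto split: if_splits)
  have "verts Q \<times> {[]} \<subseteq> qpaths Q"
    by (auto simp: qpaths_iff awalk_def)
  then have "\<one>\<^bsub>path_algebra Q\<^esub> \<in> {f :: _ \<Rightarrow> 'k. finite {q. f q \<noteq> 0} \<and> {q. f q \<noteq> 0} \<subseteq> qpaths Q}"
    unfolding mem_Collect_eq supp using finite_verts by simp
  then show ?thesis
    by (simp add: path_algebra_def)
qed

lemma path_algebra_l_one:
  assumes "f \<in> carrier (path_algebra Q)"
  shows "\<one>\<^bsub>path_algebra Q\<^esub> \<otimes>\<^bsub>path_algebra Q\<^esub> f = f"
proof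
  fix s :: "('v, 'e) qpath"
  obtain u p where s: "s = (u, p)" by (cases s)
  have "(\<one>\<^bsub>path_algebra Q\<^esub> \<otimes>\<^bsub>path_algebra Q\<^esub> f) s = (\<Sum>i\<le>length p. if i = 0 then (if u \<in> verts Q then f (u, p) else 0) else 0)"
    unfolding s path_algebra_mult by (intro sum.cong refl) (auto simp: path_algebra_def)
  also have "\<dots> = f s"
    using assms by (auto simp: path_algebra_def qpaths_iff awalk_def s)
  finally show "(\<one>\<^bsub>path_algebra Q\<^esub> \<otimes>\<^bsub>path_algebra Q\<^esub> f) s = f s" .
qed

lemma path_algebra_r_one:
  assumes "f \<in> carrier (path_algebra Q)"
  shows "f \<otimes>\<^bsub>path_algebra Q\<^esub> \<one>\<^bsub>path_algebra Q\<^esub> = f"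
proof
  fix s :: "('v, 'e) qpath"
  obtain u p where s: "s = (u, p)" by (cases s)
  have "(f \<otimes>\<^bsub>path_algebra Q\<^esub> \<one>\<^bsub>path_algebra Q\<^esub>) s = (\<Sum>i\<le>length p. if i = length p then (if awlast u p \<in> verts Q then f (u, p) else 0) else 0)"
    unfolding s path_algebra_mult by (intro sum.cong refl) (auto simp: path_algebra_def)
  also have "\<dots> = f s"
    using assms awalk_last_in_verts by (fastforce simp: path_algebra_def qpaths_iff s)
  finally show "(f \<otimes>\<^bsub>path_algebra Q\<^esub> \<one>\<^bsub>path_algebra Q\<^esub>) s = f s" .
qed

lemma path_algebra_add: "f \<oplus>\<^bsub>path_algebra Q\<^esub> g = (\<lambda>q. f q + g q)"
  by (simp add: path_algebra_def)

lemma path_algebra_add_closed: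
  assumes "f \<in> carrier (path_algebra Q)" "g \<in> carrier (path_algebra Q)"
  shows "f \<oplus>\<^bsub>path_algebra Q\<^esub> g \<in> carrier (path_algebra Q)"
proof -
  have *: "{q. f q + g q \<noteq> 0} \<subseteq> {q. f q \<noteq> 0} \<union> {q. g q \<noteq> 0}"
    by auto
  with assms show ?thesis
    by (auto simp: path_algebra_def intro: finite_subset[OF *])
qed

lemma path_algebra_uminus_closed:
  "f \<in> carrier (path_algebra Q) \<Longrightarrow> (\<lambda>q. - f q) \<in> carrier (path_algebra Q)"
  by (simp add: path_algebra_def)

lemma ring_path_algebra: "ring (path_algebra Q)"
proof (rule ringI)
  show "abelian_group (path_algebra Q)"
  proof (rule abelian_groupI)
    fix f assume "f \<in> carrier (path_algebra Q)"
    then show "\<exists>g\<in>carrier (path_algebra Q). g \<oplus>\<^bsub>path_algebra Q\<^esub> f = \<zero>\<^bsub>path_algebra Q\<^esub>"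
      by (intro bexI[where x = "\<lambda>q. - f q"] path_algebra_uminus_closed) (simp_all add: path_algebra_def)
  qed (auto intro: path_algebra_add_closed, auto simp: path_algebra_def ac_simps)
  show "Group.monoid (path_algebra Q)"
    by (rule monoidI)
      (auto intro: path_algebra_mult_closed one_closed
        simp: path_algebra_mult_assoc path_algebra_l_one path_algebra_r_one)
qed (auto simp: path_algebra_def algebra_simps sum.distrib)

text \<open>
  Splitting a path at each of its vertices enumerates the composable pairs of paths with that
  concatenation. With \<open>F\<close> the action of a path on a coefficient of an element, this reduces the action
  of a product of algebra elements to that of a product of paths.
\<close>

lemma path_algebra_mult_weighted_sum:
  assumes "f \<in> carrier (path_algebra Q)" "g \<in> carrier (path_algebra Q)"
  shows "(\<Sum>s | (f \<otimes>\<^bsub>path_algebra Q\<^esub> g) s \<noteq> 0. (f \<otimes>\<^bsub>path_algebra Q\<^esub> g) s * F s) =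
    (\<Sum>r | g r \<noteq> 0. \<Sum>q | f q \<noteq> 0.
       if fst r = path_end q then f q * g r * F (path_concat q r) else 0)"
proof -
  have fin: "finite {q. f q \<noteq> 0}" "finite {r. g r \<noteq> 0}"
    using assms by (auto simp: path_algebra_def)
  define C where "C = (\<lambda>(q, r). path_concat q r) ` ({q. f q \<noteq> 0 } \<times> {r. g r \<noteq> 0})"
  have finC: "finite C"
    using fin by (simp add: C_def)
  have C: "path_concat q r \<in> C" if "f q \<noteq> 0" "g r \<noteq> 0" for q r
    using that by (auto simp: C_def)
  define t where "t = (\<lambda>(s, i). f (fst s, take i (snd s)) *
    g (awlast (fst s) (take i (snd s)), drop i (snd s)) * F s)"
  have "(\<Sum>s | (f \<otimes>\<^bsub>path_algebra Q\<^esub> g) s \<noteq> 0. (f \<otimes>\<^bsub>path_algebra Q\<^esub> g) s * F s) =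
     (\<Sum>s\<in>C. (f \<otimes>\<^bsub>path_algebra Q\<^esub> g) s * F s)"
    by (intro sum.mono_neutral_left finC) (use path_algebra_mult_support in \<open>auto simp: C_def\<close>)
  also have "\<dots> = (\<Sum>s\<in>C. \<Sum>i\<le>length (snd s). t (s, i))"
  proof (rule sum.cong[OF refl])
    fix s assume "s \<in> C"
    show "(f \<otimes>\<^bsub>path_algebra Q\<^esub> g) s * F s = (\<Sum>i\<le>length (snd s). t (s, i))"
      by (cases s) (simp add: path_algebra_mult t_def sum_distrib_right)
  qed
  also have "\<dots> = (\<Sum>(s, i)\<in>Sigma C (\<lambda>s. {..length (snd s)}). t (s, i))"
    by (subst sum.Sigma) (auto simp: finC)
  also have "\<dots> = (\<Sum>(r, q)\<in>{r. g r \<noteq> 0} \<times> {q. f q \<noteq> 0}.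
       if fst r = path_end q then f q * g r * F (path_concat q r) else 0)"
  proof (rule sum.reindex_bij_witness_not_neutral[
      where i = "\<lambda>(r, q). (path_concat q r, length (snd q))"
        and j = "\<lambda>(s, i). ((awlast (fst s) (take i (snd s)), drop i (snd s)), (fst s, take i (snd s)))"
        and S' = "{(s, i) \<in> Sigma C (\<lambda>s. {..length (snd s)}). f (fst s, take i (snd s)) = 0 \<or>
                g (awlast (fst s) (take i (snd s)), drop i (snd s)) = 0}"
        and T' = "{(r, q) \<in> {r. g r \<noteq> 0} \<times> {q. f q \<noteq> 0}. fst r \<noteq> path_end q}"], goal_cases)
    case 1 show ?case
      by (rule finite_subset[of _ "Sigma C (\<lambda>s. {..length (snd s)})"]) (auto simp: finC)
  next
    case 2 show ?case
      by (rule finite_subset[of _ "{r. g r \<noteq> 0} \<times> {q. f q \<noteq> 0}"]) (auto simp: fin)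
  qed (auto simp: t_def path_end_def path_concat_def split: if_splits
      dest: C simp del: take_append drop_append, auto simp: C[unfolded path_concat_def])
  also have "\<dots> = (\<Sum>r | g r \<noteq> 0. \<Sum>q | f q \<noteq> 0.
       if fst r = path_end q then f q * g r * F (path_concat q r) else 0)"
    by (simp add: sum.Sigma fin)
  finally show ?thesis .
qed

end


section \<open>Quadratic monomial relations and strings\<close>

text \<open>
  The Jacobian algebra of a triangulation is of this form, the relations being the pairs of consecutive
  arrows of the 3-cycles that come from triangles.
\<close>

locale quadratic_monomial_quiver = finite_quiver Q for Q :: "('v, 'e) quiver" +
  fixes Rel :: "('e \<times> 'e) set" and I :: "(('v, 'e) qpath \<Rightarrow> 'k::field) set"
  assumes Rel_composable:
      "(x, y) \<in> Rel \<Longrightarrow> x \<in> arcs Q \<and> y \<in> arcs Q \<and> head Q x = tail Q y"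
    and I_eq: "I = Idl\<^bsub>path_algebra Q\<^esub> {path_elem (tail Q x, [x, y]) | x y. (x, y) \<in> Rel}"
begin

abbreviation kQ :: "(('v, 'e) qpath \<Rightarrow> 'k) ring" where
  "kQ \<equiv> path_algebra Q"

abbreviation J :: "(('v, 'e) qpath \<Rightarrow> 'k) set ring" where
  "J \<equiv> kQ Quot I"

sublocale kQ: ring kQ
  by (rule ring_path_algebra)

lemma path_elem_closed: "q \<in> qpaths Q \<Longrightarrow> path_elem q \<in> carrier kQ"
  by (auto simp: path_algebra_def path_elem_def)

lemma arrow_in_qpaths: "a \<in> arcs Q \<Longrightarrow> (tail Q a, [a]) \<in> qpaths Q"
  by (simp add: qpaths_iff awalk_def)

definition contains_relation :: "'e list \<Rightarrow> bool" where
  "contains_relation p \<longleftrightarrow> (\<exists>xs x y ys. p = xs @ [x, y] @ ys \<and> (x, y) \<in> Rel)"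

lemma contains_relation_append:
  "contains_relation p \<or> contains_relation q \<Longrightarrow> contains_relation (p @ q)"
  unfolding contains_relation_def by (metis append.assoc)

lemma contains_relation_pair: "contains_relation [x, y] \<longleftrightarrow> (x, y) \<in> Rel"
proof
  assume "contains_relation [x, y]"
  then obtain xs x' y' ys where *: "[x, y] = xs @ [x', y'] @ ys" "(x', y') \<in> Rel"
    unfolding contains_relation_def by blast
  have "length [x, y] = length (xs @ [x', y'] @ ys)"
    using *(1) by (rule arg_cong)
  then have "xs = []" "ys = []"
    by auto
  with * show "(x, y) \<in> Rel"
    by simp
next
  assume "(x, y) \<in> Rel"
  then show "contains_relation [x, y]"
    unfolding contains_relation_def by (metis append_Nil append_Nil2)
qed

text \<open>
  An ideal containing the generators, for which membership of a path can be read off the path.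
\<close>

definition relation_span :: "(('v, 'e) qpath \<Rightarrow> 'k) set" where
  "relation_span = {f \<in> carrier kQ. \<forall>q. f q \<noteq> 0 \<longrightarrow> contains_relation (snd q)}"

lemma ideal_relation_span: "ideal relation_span kQ"
proof (rule idealI)
  show "ring kQ"
    by (rule ring_path_algebra)
  show "subgroup relation_span (add_monoid kQ)"
  proof (rule kQ.add.subgroupI)
    fix f assume f: "f \<in> relation_span"
    then have "(\<lambda>q. - f q) \<in> carrier kQ"
      by (intro path_algebra_uminus_closed) (simp add: relation_span_def)
    moreover have "(\<lambda>q. - f q) \<oplus>\<^bsub>kQ\<^esub> f = \<zero>\<^bsub>kQ\<^esub>"
      by (simp add: path_algebra_def)
    ultimately have "\<ominus>\<^bsub>kQ\<^esub> f = (\<lambda>q. - f q)"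
      using f by (intro kQ.minus_equality) (auto simp: relation_span_def)
    then show "\<ominus>\<^bsub>kQ\<^esub> f \<in> relation_span"
      using f path_algebra_uminus_closed by (auto simp: relation_span_def)
  next
    fix f g assume "f \<in> relation_span" "g \<in> relation_span"
    then show "f \<oplus>\<^bsub>kQ\<^esub> g \<in> relation_span"
      using path_algebra_add_closed[of f g]
      by (auto simp: relation_span_def path_algebra_add) (metis add.right_neutral snd_conv)
  next
    have "\<zero>\<^bsub>kQ\<^esub> \<in> relation_span"
      by (simp add: relation_span_def path_algebra_def)
    then show "relation_span \<noteq> {}"
      by blast
  qed (auto simp: relation_span_def)
next
  fix f g assume fg: "f \<in> relation_span" "g \<in> carrier kQ"
  have "contains_relation p" if "(g \<otimes>\<^bsub>kQ\<^esub> f) (u, p) \<noteq> 0" for u p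
    using that
  proof (rule path_algebra_mult_nonzeroE)
    fix i assume "f (awlast u (take i p), drop i p) \<noteq> 0"
    then have "contains_relation (drop i p)"
      using fg by (auto simp: relation_span_def)
    then show ?thesis
      by (metis append_take_drop_id contains_relation_append)
  qed
  then show "g \<otimes>\<^bsub>kQ\<^esub> f \<in> relation_span"
    using fg path_algebra_mult_closed[of g f] by (auto simp: relation_span_def)
  have "contains_relation p" if "(f \<otimes>\<^bsub>kQ\<^esub> g) (u, p) \<noteq> 0" for u p
    using that
  proof (rule path_algebra_mult_nonzeroE)
    fix i assume "f (u, take i p) \<noteq> 0"
    then have "contains_relation (take i p)"
      using fg by (auto simp: relation_span_def)
    then show ?thesis
      by (metis append_take_drop_id contains_relation_append)
  qed
  then show "f \<otimes>\<^bsub>kQ\<^esub> g \<in> relation_span"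
    using fg path_algebra_mult_closed[of f g] by (auto simp: relation_span_def)
qed

lemma relation_in_qpaths: "(x, y) \<in> Rel \<Longrightarrow> (tail Q x, [x, y]) \<in> qpaths Q"
  using Rel_composable[of x y] by (simp add: qpaths_iff awalk_def)

lemma generators_closed: "{path_elem (tail Q x, [x, y]) | x y. (x, y) \<in> Rel} \<subseteq> carrier kQ"
  using path_elem_closed relation_in_qpaths by auto

lemma I_subset_relation_span: "I \<subseteq> relation_span"
  unfolding I_eq
proof (rule kQ.genideal_minimal[OF ideal_relation_span], safe)
  fix x y assume xy: "(x, y) \<in> Rel"
  then have "path_elem (tail Q x, [x, y]) \<in> carrier kQ"
    by (intro path_elem_closed relation_in_qpaths)
  then show "path_elem (tail Q x, [x, y]) \<in> relation_span"
    using xy unfolding relation_span_def by (auto simp: path_elem_def contains_relation_pair)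
qed

lemma ideal_I: "ideal I kQ"
  unfolding I_eq by (rule kQ.genideal_ideal[OF generators_closed])

lemma path_elem_in_I: "path_elem q \<in> I \<Longrightarrow> contains_relation (snd q)"
proof -
  assume "path_elem q \<in> I"
  then have "(path_elem q :: _ \<Rightarrow> 'k) \<in> relation_span"
    using I_subset_relation_span by blast
  moreover have "path_elem q q \<noteq> (0::'k)"
    by (simp add: path_elem_def)
  ultimately show ?thesis
    unfolding relation_span_def by blast
qed

lemma pair_in_I_iff: "path_elem (tail Q x, [x, y]) \<in> I \<longleftrightarrow> (x, y) \<in> Rel"
proof
  assume "(x, y) \<in> Rel"
  then show "path_elem (tail Q x, [x, y]) \<in> I"
    unfolding I_eq using kQ.genideal_self[OF generators_closed] by blast
qed (use path_elem_in_I contains_relation_pair in fastforce)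

text \<open>
  Two inverse letters form a path when read backwards, hence the exchanged roles of \<open>x\<close> and \<open>y\<close>.
\<close>

definition composable_letters :: "'e letter \<Rightarrow> 'e letter \<Rightarrow> bool" where
  "composable_letters l l' \<longleftrightarrow> l' \<noteq> inv_letter l \<and>
     (\<forall>x y. l = Dir x \<and> l' = Dir y \<longrightarrow> (x, y) \<notin> Rel) \<and>
     (\<forall>x y. l = Inv y \<and> l' = Inv x \<longrightarrow> (x, y) \<notin> Rel)"

lemma composable_letters_simps [simp]:
  "composable_letters (Dir x) (Dir y) \<longleftrightarrow> (x, y) \<notin> Rel"
  "composable_letters (Inv y) (Inv x) \<longleftrightarrow> (x, y) \<notin> Rel"
  "composable_letters (Dir x) (Inv y) \<longleftrightarrow> x \<noteq> y"
  "composable_letters (Inv x) (Dir y) \<longleftrightarrow> x \<noteq> y"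
  by (auto simp: composable_letters_def)

lemma inv_letter_inv_letter [simp]: "inv_letter (inv_letter l) = l"
  by (cases l) auto

lemma inv_letters_eq_iff:
  fixes ls ms :: "'e letter list"
  shows "inv_letters ls = ms \<longleftrightarrow> ls = inv_letters ms"
proof -
  have "inv_letters (inv_letters ks) = ks" for ks :: "'e letter list"
    by (simp add: inv_letters_def rev_map comp_def)
  then show ?thesis by metis
qed

lemma inv_letters_simps:
  "inv_letters (xs @ ys) = inv_letters ys @ inv_letters xs"
  "inv_letters (l # xs) = inv_letters xs @ [inv_letter l]"
  "inv_letters [] = []"
  by (simp_all add: inv_letters_def)

text \<open>
  The elements of the ideal are combinations of paths containing a relation, and a relation consists
  of two arrows; so a forbidden path in a word shows up in two consecutive letters.
\<close>

lemma is_string_iff: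
  "is_string Q I w \<longleftrightarrow> is_walk Q (fst w) (snd w) \<and> successively composable_letters (snd w)"
proof
  assume w: "is_string Q I w"
  have split: "snd w = take i (snd w) @ [snd w ! i, snd w ! Suc i] @ drop (Suc (Suc i)) (snd w)"
    if "Suc i < length (snd w)" for i
    using that by (metis Cons_nth_drop_Suc Suc_lessD append_Cons append_Nil id_take_nth_drop)
  have "composable_letters (snd w ! i) (snd w ! Suc i)" if i: "Suc i < length (snd w)" for i
    unfolding composable_letters_def
  proof (intro conjI allI impI)
    show "snd w ! Suc i \<noteq> inv_letter (snd w ! i)"
      using w i by (simp add: is_string_def)
  next
    fix x y assume "snd w ! i = Dir x \<and> snd w ! Suc i = Dir y"
    then have "snd w = take i (snd w) @ map Dir [x, y] @ drop (Suc (Suc i)) (snd w)"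
      using split[OF i] by simp
    then have "path_elem (tail Q x, [x, y]) \<notin> I"
      using w unfolding is_string_def by (metis list.distinct(1) list.sel(1))
    then show "(x, y) \<notin> Rel"
      by (simp add: pair_in_I_iff)
  next
    fix x y assume "snd w ! i = Inv y \<and> snd w ! Suc i = Inv x"
    then have "inv_letters (snd w) = inv_letters (drop (Suc (Suc i)) (snd w)) @ map Dir [x, y] @
        inv_letters (take i (snd w))"
      by (subst split[OF i]) (simp add: inv_letters_simps)
    then have "path_elem (tail Q x, [x, y]) \<notin> I"
      using w unfolding is_string_def by (metis list.distinct(1) list.sel(1))
    then show "(x, y) \<notin> Rel"
      by (simp add: pair_in_I_iff)
  qed
  with w show "is_walk Q (fst w) (snd w) \<and> successively composable_letters (snd w)"
    by (simp add: is_string_def successively_conv_nth)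
next
  assume w: "is_walk Q (fst w) (snd w) \<and> successively composable_letters (snd w)"
  have "path_elem (tail Q (hd p), p) \<notin> I"
    if p: "snd w = xs @ map Dir p @ ys \<or> inv_letters (snd w) = xs @ map Dir p @ ys" for xs p ys
  proof
    assume "path_elem (tail Q (hd p), p) \<in> I"
    then have "contains_relation p"
      using path_elem_in_I by fastforce
    then obtain as x y bs where as: "p = as @ [x, y] @ bs" "(x, y) \<in> Rel"
      unfolding contains_relation_def by blast
    from p show False
    proof
      assume "snd w = xs @ map Dir p @ ys"
      with w as show False
        by (auto simp: successively_append_iff)
    next
      assume "inv_letters (snd w) = xs @ map Dir p @ ys"
      then have "snd w = inv_letters (xs @ map Dir p @ ys)"
        by (rule inv_letters_eq_iff[THEN iffD1])
      with w as show False
        by (auto simp: successively_append_iff inv_letters_simps)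
    qed
  qed
  moreover have "snd w ! Suc i \<noteq> inv_letter (snd w ! i)" if "Suc i < length (snd w)" for i
    using w that by (auto simp: successively_conv_nth composable_letters_def)
  ultimately show "is_string Q I w"
    using w unfolding is_string_def by blast
qed

end

section \<open>String modules\<close>

subsection \<open>Linear operators on coefficient functions\<close>

text \<open>
  Linearity on all functions, including those not supported on the positions of a word. The actions
  and the graph maps below have this property, which involves no closure conditions.
\<close>

definition linear_op :: "((nat \<Rightarrow> 'k::field) \<Rightarrow> nat \<Rightarrow> 'k) \<Rightarrow> bool" where
  "linear_op h \<longleftrightarrow> (\<forall>x y. h (\<lambda>j. x j + y j) = (\<lambda>j. h x j + h y j)) \<and>
     (\<forall>c x. h (\<lambda>j. c * x j) = (\<lambda>j. c * h x j))"

lemma linear_op_zero: "linear_op h \<Longrightarrow> h (\<lambda>_. 0) = (\<lambda>_. 0)"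
  unfolding linear_op_def by (drule conjunct2, drule spec[of _ 0]) simp

lemma linear_op_sum:
  assumes "linear_op h"
  shows "h (\<lambda>j. \<Sum>q\<in>A. c q * x q j) = (\<lambda>j. \<Sum>q\<in>A. c q * h (x q) j)"
proof (induction A rule: infinite_finite_induct)
  case (insert q A)
  have "h (\<lambda>j. \<Sum>r\<in>insert q A. c r * x r j) =
      h (\<lambda>j. c q * x q j + (\<Sum>r\<in>A. c r * x r j))"
    using insert by simp
  also have "\<dots> = (\<lambda>j. h (\<lambda>j. c q * x q j) j + h (\<lambda>j. \<Sum>r\<in>A. c r * x r j) j)"
    using assms[unfolded linear_op_def, THEN conjunct1, rule_format,
      of "\<lambda>j. c q * x q j" "\<lambda>j. \<Sum>r\<in>A. c r * x r j"] .
  also have "h (\<lambda>j. c q * x q j) = (\<lambda>j. c q * h (x q) j)"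
    using assms unfolding linear_op_def by blast
  finally show ?case
    using insert by simp
qed (simp_all add: linear_op_zero[OF assms])

lemma linear_op_foldl:
  assumes "\<And>a. linear_op (h a)" "linear_op g"
  shows "linear_op (\<lambda>x. foldl (\<lambda>y a. h a y) (g x) as)"
proof (induction as rule: rev_induct)
  case (snoc a as)
  then show ?case
    using assms(1)[of a] unfolding linear_op_def by simp
qed (simp add: assms)

lemma linear_op_arrow_action: "linear_op (arrow_action w a)"
  by (auto simp: linear_op_def arrow_action_def algebra_simps fun_eq_iff)

lemma linear_op_vertex_action: "linear_op (vertex_action Q w v)"
  by (auto simp: linear_op_def vertex_action_def)

lemma linear_op_path_action: "linear_op (path_action Q w q)"
  unfolding path_action_def
  by (intro linear_op_foldl linear_op_arrow_action linear_op_vertex_action)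

lemma linear_op_path_algebra_action:
  fixes f :: "('v, 'e) qpath \<Rightarrow> 'k::field"
  shows "linear_op (path_algebra_action Q w f)"
proof -
  have "path_action Q w q (\<lambda>j. x j + y j) = (\<lambda>j. path_action Q w q x j + path_action Q w q y j)"
    "path_action Q w q (\<lambda>j. c * x j) = (\<lambda>j. c * path_action Q w q x j)" for q c and x y :: "nat \<Rightarrow> 'k"
    using linear_op_path_action[of Q w q] unfolding linear_op_def by blast+
  then show ?thesis
    by (simp add: linear_op_def path_algebra_action_def sum.distrib sum_distrib_left algebra_simps)
qed

subsection \<open>The action of the path algebra\<close>

lemma arrow_action_0:
  "arrow_action w a x 0 = (if snd w \<noteq> [] \<and> snd w ! 0 = Inv a then x 1 else 0)"
  by (simp add: arrow_action_def)

lemma arrow_action_Suc: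
  "arrow_action w a x (Suc i) = (if i < length (snd w) \<and> snd w ! i = Dir a then x i else 0) +
     (if Suc i < length (snd w) \<and> snd w ! Suc i = Inv a then x (Suc (Suc i)) else 0)"
  by (simp add: arrow_action_def)

lemma path_action_Nil: "path_action Q w (v, []) = vertex_action Q w v"
  by (simp add: path_action_def fun_eq_iff)

lemma path_action_append:
  "path_action Q w (u, p @ q) x = foldl (\<lambda>y a. arrow_action w a y) (path_action Q w (u, p) x) q"
  by (simp add: path_action_def)

lemma path_action_snoc:
  "path_action Q w (u, p @ [a]) x = arrow_action w a (path_action Q w (u, p) x)"
  by (simp add: path_action_append)

lemma vertex_action_supported: "j > length (snd w) \<Longrightarrow> vertex_action Q w v x j = 0"
  by (simp add: vertex_action_def)

lemma arrow_action_supported: "j > length (snd w) \<Longrightarrow> arrow_action w a x j = 0"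
  by (simp add: arrow_action_def)

lemma path_action_supported: "j > length (snd w) \<Longrightarrow> path_action Q w q x j = 0"
  by (cases q, cases "snd q" rule: rev_cases)
    (auto simp: path_action_Nil path_action_snoc vertex_action_supported arrow_action_supported)

lemma path_algebra_action_supported:
  "j > length (snd w) \<Longrightarrow> path_algebra_action Q w f x j = 0"
  by (simp add: path_algebra_action_def path_action_supported)

lemma path_algebra_action_eq:
  assumes "finite A" "{q. f q \<noteq> 0} \<subseteq> A"
  shows "path_algebra_action Q w f x j = (\<Sum>q\<in>A. f q * path_action Q w q x j)"
  unfolding path_algebra_action_def
  by (rule sum.mono_neutral_left) (use assms in auto)

lemma path_algebra_action_scale:
  "path_algebra_action Q w (\<lambda>q. c * f q) x = (\<lambda>j. c * path_algebra_action Q w f x j)"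
  by (cases "c = 0") (simp_all add: path_algebra_action_def sum_distrib_left mult.assoc)

lemma path_algebra_action_path_elem:
  "path_algebra_action Q w (path_elem q) x = path_action Q w q x"
  by (simp add: path_algebra_action_def path_elem_def)

context finite_quiver
begin

lemma path_algebra_action_add:
  assumes "f \<in> carrier (path_algebra Q)" "g \<in> carrier (path_algebra Q)"
  shows "path_algebra_action Q w (f \<oplus>\<^bsub>path_algebra Q\<^esub> g) x =
    (\<lambda>j. path_algebra_action Q w f x j + path_algebra_action Q w g x j)"
proof
  fix j
  have fin: "finite ({q. f q \<noteq> 0} \<union> {q. g q \<noteq> 0})" (is "finite ?A")
    using assms by (simp add: path_algebra_def)
  have "path_algebra_action Q w (f \<oplus>\<^bsub>path_algebra Q\<^esub> g) x j =
      (\<Sum>q\<in>?A. (f q + g q) * path_action Q w q x j)"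
    unfolding path_algebra_add by (rule path_algebra_action_eq[OF fin]) auto
  also have "\<dots> = path_algebra_action Q w f x j + path_algebra_action Q w g x j"
    by (subst (1 2) path_algebra_action_eq[OF fin]) (auto simp: distrib_right sum.distrib)
  finally show "path_algebra_action Q w (f \<oplus>\<^bsub>path_algebra Q\<^esub> g) x j =
    path_algebra_action Q w f x j + path_algebra_action Q w g x j" .
qed

lemma word_end_simps [simp]:
  "word_end Q (u, []) = u"
  "word_end Q (u, xs @ [l]) = letter_tgt Q l"
  by (simp_all add: word_end_def)

lemma word_end_Cons: "word_end Q (u, l # ls) = word_end Q (letter_tgt Q l, ls)"
  by (auto simp: word_end_def)

lemma word_end_append: "word_end Q (u, xs @ ys) = word_end Q (word_end Q (u, xs), ys)"
  by (auto simp: word_end_def)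

lemma letter_src_in_verts: "letter_arrow l \<in> arcs Q \<Longrightarrow> letter_src Q l \<in> verts Q"
  by (cases l) auto

lemma is_walk_append:
  "is_walk Q u (xs @ ys) \<longleftrightarrow> is_walk Q u xs \<and> is_walk Q (word_end Q (u, xs)) ys"
proof (induction xs arbitrary: u)
  case Nil
  then show ?case
    by (cases ys) (auto simp: letter_src_in_verts)
next
  case (Cons l xs)
  then show ?case by (auto simp: word_end_Cons)
qed

lemma is_walk_end_in_verts: "is_walk Q u ls \<Longrightarrow> word_end Q (u, ls) \<in> verts Q"
  by (induction ls arbitrary: u) (auto simp: word_end_Cons)

lemma is_walk_nth:
  assumes "is_walk Q u ls" "j < length ls"
  shows "letter_arrow (ls ! j) \<in> arcs Q"
    and "word_end Q (u, take j ls) = letter_src Q (ls ! j)"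
    and "word_end Q (u, take (Suc j) ls) = letter_tgt Q (ls ! j)"
proof -
  have ls: "ls = take j ls @ ls ! j # drop (Suc j) ls"
    using assms by (simp add: id_take_nth_drop)
  have "is_walk Q (word_end Q (u, take j ls)) (ls ! j # drop (Suc j) ls)"
    using assms(1) by (subst (asm) ls) (simp only: is_walk_append)
  then show "letter_arrow (ls ! j) \<in> arcs Q" "word_end Q (u, take j ls) = letter_src Q (ls ! j)"
    by auto
  show "word_end Q (u, take (Suc j) ls) = letter_tgt Q (ls ! j)"
    using assms(2) by (simp add: take_Suc_conv_app_nth)
qed

text \<open>
  The last arrow of the path decides the vertex. Hence the idempotent opening a second path acts on the
  result as the identity or as zero, which makes the action of paths compatible with concatenation.
\<close>

lemma path_action_at_end:
  assumes w: "is_walk Q (fst w) (snd w)" and nz: "path_action Q w q x j \<noteq> 0"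
  shows "j \<le> length (snd w) \<and> word_end Q (fst w, take j (snd w)) = path_end q"
proof (cases q)
  case (Pair u p)
  show ?thesis
  proof (cases p rule: rev_cases)
    case Nil
    then show ?thesis
      using nz by (auto simp: Pair path_action_Nil vertex_action_def path_end_def split: if_splits)
  next
    case (snoc p' a)
    have "path_end q = head Q a"
      by (simp add: path_end_def Pair snoc awlast_append)
    moreover have "j \<le> length (snd w) \<and> word_end Q (fst w, take j (snd w)) = head Q a"
    proof (cases "1 \<le> j \<and> j \<le> length (snd w) \<and> snd w ! (j - 1) = Dir a")
      case True
      then show ?thesis
        using is_walk_nth(3)[OF w, of "j - 1"] by (cases j) auto
    next
      case False
      then have "j < length (snd w)" "snd w ! j = Inv a"
        using nz by (auto simp: Pair snoc path_action_snoc arrow_action_def split: if_splits)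
      then show ?thesis
        using is_walk_nth(2)[OF w, of j] by simp
    qed
    ultimately show ?thesis by simp
  qed
qed

lemma path_action_concat:
  assumes w: "is_walk Q (fst w) (snd w)"
  shows "path_action Q w r (path_action Q w q x) =
    (if fst r = path_end q then path_action Q w (path_concat q r) x else (\<lambda>_. 0))"
proof -
  have *: "vertex_action Q w v (path_action Q w q x) =
      (if v = path_end q then path_action Q w q x else (\<lambda>_. 0))" for v
    using path_action_at_end[OF w, of q x] by (fastforce simp: vertex_action_def)
  have 0: "foldl (\<lambda>y a. arrow_action w a y) (\<lambda>_. 0) as = (\<lambda>_. 0)" for as
    by (induction as) (simp_all add: arrow_action_def)
  show ?thesis
    by (simp add: path_action_def[of Q w r] * 0) (simp add: path_concat_def path_action_def)
qed

lemma path_algebra_action_mult: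
  assumes w: "is_walk Q (fst w) (snd w)"
    and fg: "f \<in> carrier (path_algebra Q)" "g \<in> carrier (path_algebra Q)"
  shows "path_algebra_action Q w (f \<otimes>\<^bsub>path_algebra Q\<^esub> g) x =
    path_algebra_action Q w g (path_algebra_action Q w f x)"
proof
  fix j
  have "path_algebra_action Q w (f \<otimes>\<^bsub>path_algebra Q\<^esub> g) x j =
      (\<Sum>r | g r \<noteq> 0. \<Sum>q | f q \<noteq> 0.
       if fst r = path_end q then f q * g r * path_action Q w (path_concat q r) x j else 0)"
    unfolding path_algebra_action_def by (rule path_algebra_mult_weighted_sum[OF fg])
  also have "\<dots> = (\<Sum>r | g r \<noteq> 0. g r * (\<Sum>q | f q \<noteq> 0. f q * path_action Q w r (path_action Q w q x) j))"
    unfolding sum_distrib_left by (intro sum.cong refl) (auto simp: path_action_concat[OF w])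
  also have "\<dots> = path_algebra_action Q w g (path_algebra_action Q w f x) j"
    unfolding path_algebra_action_def linear_op_sum[OF linear_op_path_action] ..
  finally show "path_algebra_action Q w (f \<otimes>\<^bsub>path_algebra Q\<^esub> g) x j =
    path_algebra_action Q w g (path_algebra_action Q w f x) j" .
qed

lemma path_algebra_action_one:
  assumes w: "is_walk Q (fst w) (snd w)" and x: "\<forall>j>length (snd w). x j = 0"
  shows "path_algebra_action Q w \<one>\<^bsub>path_algebra Q\<^esub> x = x"
proof
  fix j
  have "path_algebra_action Q w \<one>\<^bsub>path_algebra Q\<^esub> x j =
      (\<Sum>q\<in>verts Q \<times> {[]}. \<one>\<^bsub>path_algebra Q\<^esub> q * path_action Q w q x j)"
    by (rule path_algebra_action_eq) (auto simp: finite_verts path_algebra_def split: if_splits)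
  also have "\<dots> = (\<Sum>v\<in>verts Q. vertex_action Q w v x j)"
    by (rule sum.reindex_bij_witness[where i = "\<lambda>v. (v, [])" and j = fst])
      (auto simp: path_action_Nil path_algebra_def)
  also have "\<dots> = (\<Sum>v\<in>verts Q. if v = word_end Q (fst w, take j (snd w)) then x j else 0)"
    using x by (intro sum.cong refl) (auto simp: vertex_action_def)
  also have "\<dots> = x j"
    using is_walk_end_in_verts[of "fst w" "take j (snd w)"] w finite_verts
      is_walk_append[of "fst w" "take j (snd w)" "drop j (snd w)"] by simp
  finally show "path_algebra_action Q w \<one>\<^bsub>path_algebra Q\<^esub> x j = x j" .
qed

lemma path_action_arrow:
  assumes w: "is_walk Q (fst w) (snd w)"
  shows "path_action Q w (tail Q a, [a]) x = arrow_action w a x"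
proof
  fix j
  have 1: "word_end Q (fst w, take i (snd w)) = tail Q a"
    if "i < length (snd w)" "snd w ! i = Dir a" for i
    using is_walk_nth(2)[OF w, of i] that by simp
  have 2: "word_end Q (fst w, take (Suc i) (snd w)) = tail Q a"
    if "i < length (snd w)" "snd w ! i = Inv a" for i
    using is_walk_nth(3)[OF w, of i] that by simp
  show "path_action Q w (tail Q a, [a]) x j = arrow_action w a x j"
    by (cases j) (auto simp: path_action_def arrow_action_0 arrow_action_Suc vertex_action_def
        Suc_le_eq 1 2 2[of 0, simplified])
qed

end

context quadratic_monomial_quiver
begin

text \<open>
  A relation could move a basis element only along two consecutive letters, both direct or both inverse;
  neither pair occurs in a string. Moving back along the same letter is impossible, since a letter
  is not both direct and inverse.
\<close>

lemma arrow_action_relation: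
  assumes w: "is_string Q I w" and xy: "(x, y) \<in> Rel"
  shows "arrow_action w y (arrow_action w x z) = (\<lambda>_. 0)"
proof
  fix j
  have adj: "composable_letters (snd w ! i) (snd w ! Suc i)" if "Suc i < length (snd w)" for i
    using w that by (simp add: is_string_iff successively_conv_nth)
  have 1: "snd w ! Suc i \<noteq> Dir y" if "Suc i < length (snd w)" "snd w ! i = Dir x" for i
    using adj[of i] that xy by auto
  have 2: "snd w ! Suc i \<noteq> Inv x" if "Suc i < length (snd w)" "snd w ! i = Inv y" for i
    using adj[of i] that xy by auto
  show "arrow_action w y (arrow_action w x z) j = 0"
  proof (cases j)
    case 0
    then show ?thesis
      using 2[of 0] by (auto simp: arrow_action_0 arrow_action_Suc)
  next
    case (Suc i)
    then show ?thesis
      using 1[of "i - 1"] 2[of "Suc i"]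
      by (cases i) (auto simp: arrow_action_0 arrow_action_Suc)
  qed
qed

lemma path_action_relation:
  assumes w: "is_string Q I w" and p: "contains_relation p"
  shows "path_action Q w (u, p) x = (\<lambda>_. 0)"
proof -
  obtain as a b bs where p: "p = as @ [a, b] @ bs" "(a, b) \<in> Rel"
    using p unfolding contains_relation_def by blast
  have 0: "foldl (\<lambda>y a. arrow_action w a y) (\<lambda>_. 0) cs = (\<lambda>_. 0)" for cs
    by (induction cs) (simp_all add: arrow_action_def)
  show ?thesis
    unfolding p(1) path_action_append by (simp add: arrow_action_relation[OF w p(2)] 0)
qed

lemma path_algebra_action_ideal:
  assumes w: "is_string Q I w" and f: "f \<in> I"
  shows "path_algebra_action Q w f x = (\<lambda>_. 0)"
proof -
  have "path_action Q w q x = (\<lambda>_. 0)" if "f q \<noteq> 0" for q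
  proof -
    have "contains_relation (snd q)"
      using f that I_subset_relation_span unfolding relation_span_def by blast
    then show ?thesis
      using path_action_relation[OF w, of "snd q" "fst q"] by simp
  qed
  then show ?thesis
    by (auto simp: path_algebra_action_def fun_eq_iff)
qed

subsection \<open>String modules as modules over the quotient algebra\<close>

sublocale I: ideal I kQ
  by (rule ideal_I)

lemma carrier_J_E:
  assumes "F \<in> carrier J"
  obtains f where "f \<in> carrier kQ" "F = I +>\<^bsub>kQ\<^esub> f" "f \<in> F"
  using assms I.a_rcos_self unfolding FactRing_def A_RCOSETS_def' by auto

lemma coset_in_carrier_J: "f \<in> carrier kQ \<Longrightarrow> I +>\<^bsub>kQ\<^esub> f \<in> carrier J"
  by (auto simp: FactRing_def A_RCOSETS_def')

lemma mem_coset_iff: "g \<in> I +>\<^bsub>kQ\<^esub> f \<longleftrightarrow> (\<exists>h\<in>I. g = h \<oplus>\<^bsub>kQ\<^esub> f)"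
  by (auto simp: a_r_coset_def')

text \<open>
  The action of a coset is defined by a chosen representative; representatives differ by an element
  of the ideal, which acts by zero.
\<close>

lemma string_module_smult:
  assumes w: "is_string Q I w" and F: "F \<in> carrier J" and f: "f \<in> F"
  shows "F \<odot>\<^bsub>string_module Q w\<^esub> x = path_algebra_action Q w f x"
proof -
  obtain g where g: "g \<in> carrier kQ" "F = I +>\<^bsub>kQ\<^esub> g"
    using carrier_J_E[OF F] by blast
  have *: "path_algebra_action Q w h x = path_algebra_action Q w g x" if "h \<in> F" for h
  proof -
    have "\<exists>i\<in>I. h = i \<oplus>\<^bsub>kQ\<^esub> g"
      using that unfolding g(2) mem_coset_iff .
    then obtain i where i: "i \<in> I" "h = i \<oplus>\<^bsub>kQ\<^esub> g"
      by blast
    show ?thesis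
      unfolding i(2)
      by (simp add: path_algebra_action_add I.a_Hcarr i(1) g(1) path_algebra_action_ideal[OF w i(1)])
  qed
  have "(SOME f. f \<in> F) \<in> F"
    using f by (rule someI[of "\<lambda>f. f \<in> F"])
  then show ?thesis
    using *[of f] *[of "SOME f. f \<in> F"] f by (simp add: string_module_def)
qed

end
section \<open>Finitely generated right modules\<close>

context right_module
begin

lemma smult_zero_right: "a \<in> carrier R \<Longrightarrow> a \<odot>\<^bsub>M\<^esub> \<zero>\<^bsub>M\<^esub> = \<zero>\<^bsub>M\<^esub>"
  using smult_r_distr[of a "\<zero>\<^bsub>M\<^esub>" "\<zero>\<^bsub>M\<^esub>"] smult_closed[of a "\<zero>\<^bsub>M\<^esub>"] by simp

lemma smult_zero_left: "x \<in> carrier M \<Longrightarrow> \<zero>\<^bsub>R\<^esub> \<odot>\<^bsub>M\<^esub> x = \<zero>\<^bsub>M\<^esub>"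
  using smult_l_distr[of "\<zero>\<^bsub>R\<^esub>" "\<zero>\<^bsub>R\<^esub>" x] smult_closed[of "\<zero>\<^bsub>R\<^esub>" x] by simp

lemma smult_finsum:
  assumes "finite F" "a \<in> carrier R" "g \<in> F \<rightarrow> carrier M"
  shows "a \<odot>\<^bsub>M\<^esub> (\<Oplus>\<^bsub>M\<^esub>y\<in>F. g y) = (\<Oplus>\<^bsub>M\<^esub>y\<in>F. a \<odot>\<^bsub>M\<^esub> g y)"
  using assms(1,3)
proof (induction F rule: finite_induct)
  case empty
  then show ?case
    by (simp add: smult_zero_right assms(2))
next
  case (insert y F)
  then have "g y \<in> carrier M" "g \<in> F \<rightarrow> carrier M"
    "(\<lambda>y. a \<odot>\<^bsub>M\<^esub> g y) \<in> F \<rightarrow> carrier M"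
    using assms(2) smult_closed by auto
  with insert assms(2) show ?case
    by (simp add: smult_r_distr smult_closed)
qed

lemma mem_of_generators:
  assumes F: "finite F" "F \<subseteq> N" "N \<subseteq> carrier M" "c \<in> F \<rightarrow> carrier R"
    and N: "\<zero>\<^bsub>M\<^esub> \<in> N" "\<And>x y. x \<in> N \<Longrightarrow> y \<in> N \<Longrightarrow> x \<oplus>\<^bsub>M\<^esub> y \<in> N"
      "\<And>a x. a \<in> carrier R \<Longrightarrow> x \<in> N \<Longrightarrow> a \<odot>\<^bsub>M\<^esub> x \<in> N"
  shows "(\<Oplus>\<^bsub>M\<^esub>y\<in>F. c y \<odot>\<^bsub>M\<^esub> y) \<in> N"
  using F
proof (induction F rule: finite_induct)
  case (insert y F)
  then have "(\<lambda>y. c y \<odot>\<^bsub>M\<^esub> y) \<in> F \<rightarrow> carrier M" "c y \<odot>\<^bsub>M\<^esub> y \<in> N"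
    using N(3) by (auto intro!: smult_closed)
  with insert N show ?case
    by (subst M.finsum_insert) auto
qed (simp add: N)

end

text \<open>
  The linear combinations of the generators form a submodule \<open>N\<close> as in the hypothesis. Finite
  generation is thus reduced to the absence of proper submodules containing the generators, where no
  coefficients have to be carried along.
\<close>

lemma fg_right_moduleI:
  fixes R :: "'r ring" and M :: "('r, 'm) module"
  assumes M: "right_module R M"
    and F: "finite F" "F \<subseteq> carrier M"
    and gen: "\<And>N. \<lbrakk>N \<subseteq> carrier M; F \<subseteq> N; \<zero>\<^bsub>M\<^esub> \<in> N;
      \<And>x y. x \<in> N \<Longrightarrow> y \<in> N \<Longrightarrow> x \<oplus>\<^bsub>M\<^esub> y \<in> N;
      \<And>a x. a \<in> carrier R \<Longrightarrow> x \<in> N \<Longrightarrow> a \<odot>\<^bsub>M\<^esub> x \<in> N\<rbrakk> \<Longrightarrow> carrier M \<subseteq> N"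
  shows "fg_right_module R M"
proof -
  interpret right_module R M by fact
  define N where "N = {(\<Oplus>\<^bsub>M\<^esub>y\<in>F. c y \<odot>\<^bsub>M\<^esub> y) | c. c \<in> F \<rightarrow> carrier R}"
  have summand_closed: "(\<lambda>y. c y \<odot>\<^bsub>M\<^esub> y) \<in> F \<rightarrow> carrier M" if "c \<in> F \<rightarrow> carrier R" for c
    using that F by (auto intro!: smult_closed)
  have "carrier M \<subseteq> N"
  proof (rule gen)
    show "N \<subseteq> carrier M"
      using summand_closed by (auto simp: N_def)
    show "F \<subseteq> N"
    proof
      fix z assume z: "z \<in> F"
      define c where "c y = (if y = z then \<one>\<^bsub>R\<^esub> else \<zero>\<^bsub>R\<^esub>)" for y
      have "(\<Oplus>\<^bsub>M\<^esub>y\<in>F. c y \<odot>\<^bsub>M\<^esub> y) = (\<Oplus>\<^bsub>M\<^esub>y\<in>F. if z = y then y else \<zero>\<^bsub>M\<^esub>)"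
        using F by (intro M.finsum_cong') (auto simp: c_def smult_one smult_zero_left)
      also have "\<dots> = z"
        using M.finsum_singleton[OF z F(1), of "\<lambda>y. y"] F by auto
      finally show "z \<in> N"
        unfolding N_def by (auto simp: c_def intro!: exI[of _ c])
    qed
    have "(\<Oplus>\<^bsub>M\<^esub>y\<in>F. \<zero>\<^bsub>R\<^esub> \<odot>\<^bsub>M\<^esub> y) = (\<Oplus>\<^bsub>M\<^esub>y\<in>F. \<zero>\<^bsub>M\<^esub>)"
      using F by (intro M.finsum_cong') (auto simp: smult_zero_left)
    then have "(\<Oplus>\<^bsub>M\<^esub>y\<in>F. \<zero>\<^bsub>R\<^esub> \<odot>\<^bsub>M\<^esub> y) = \<zero>\<^bsub>M\<^esub>"
      by simp
    then show "\<zero>\<^bsub>M\<^esub> \<in> N"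
      unfolding N_def by (intro CollectI exI[of _ "\<lambda>_. \<zero>\<^bsub>R\<^esub>"]) auto
  next
    fix x y assume "x \<in> N" "y \<in> N"
    then obtain c d where c: "c \<in> F \<rightarrow> carrier R" "x = (\<Oplus>\<^bsub>M\<^esub>y\<in>F. c y \<odot>\<^bsub>M\<^esub> y)"
      and d: "d \<in> F \<rightarrow> carrier R" "y = (\<Oplus>\<^bsub>M\<^esub>y\<in>F. d y \<odot>\<^bsub>M\<^esub> y)"
      by (auto simp: N_def)
    have "x \<oplus>\<^bsub>M\<^esub> y = (\<Oplus>\<^bsub>M\<^esub>y\<in>F. c y \<odot>\<^bsub>M\<^esub> y \<oplus>\<^bsub>M\<^esub> d y \<odot>\<^bsub>M\<^esub> y)"
      unfolding c d using summand_closed c d by (intro M.finsum_addf[symmetric]) auto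
    also have "\<dots> = (\<Oplus>\<^bsub>M\<^esub>y\<in>F. (c y \<oplus>\<^bsub>R\<^esub> d y) \<odot>\<^bsub>M\<^esub> y)"
      using F c d by (intro M.finsum_cong') (auto simp: Pi_iff subset_iff smult_l_distr smult_closed)
    finally show "x \<oplus>\<^bsub>M\<^esub> y \<in> N"
      unfolding N_def using c d by (intro CollectI exI[of _ "\<lambda>y. c y \<oplus>\<^bsub>R\<^esub> d y"]) auto
  next
    fix a x assume a: "a \<in> carrier R" and "x \<in> N"
    then obtain c where c: "c \<in> F \<rightarrow> carrier R" "x = (\<Oplus>\<^bsub>M\<^esub>y\<in>F. c y \<odot>\<^bsub>M\<^esub> y)"
      by (auto simp: N_def)
    have "a \<odot>\<^bsub>M\<^esub> x = (\<Oplus>\<^bsub>M\<^esub>y\<in>F. a \<odot>\<^bsub>M\<^esub> (c y \<odot>\<^bsub>M\<^esub> y))"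
      unfolding c using summand_closed c by (intro smult_finsum F a) auto
    also have "\<dots> = (\<Oplus>\<^bsub>M\<^esub>y\<in>F. (c y \<otimes>\<^bsub>R\<^esub> a) \<odot>\<^bsub>M\<^esub> y)"
      using F c a by (intro M.finsum_cong') (auto simp: Pi_iff subset_iff smult_mult smult_closed)
    finally show "a \<odot>\<^bsub>M\<^esub> x \<in> N"
      unfolding N_def using c a by (intro CollectI exI[of _ "\<lambda>y. c y \<otimes>\<^bsub>R\<^esub> a"]) auto
  qed
  then show ?thesis
    unfolding fg_right_module_def using F right_module_axioms by (auto simp: N_def subset_iff)
qed

lemma right_module_sum:
  assumes M: "right_module R M" and N: "right_module R N"
  shows "right_module R (rmodule_sum M N)"
proof -
  interpret M: right_module R M by fact
  interpret N: right_module R N by fact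
  show ?thesis
  proof (intro right_module.intro right_module_axioms.intro)
    show "ring R" ..
    show "abelian_group (rmodule_sum M N)"
    proof (rule abelian_groupI)
      fix x assume "x \<in> carrier (rmodule_sum M N)"
      then show "\<exists>y\<in>carrier (rmodule_sum M N).
          y \<oplus>\<^bsub>rmodule_sum M N\<^esub> x = \<zero>\<^bsub>rmodule_sum M N\<^esub>"
        by (intro bexI[of _ "(\<ominus>\<^bsub>M\<^esub> fst x, \<ominus>\<^bsub>N\<^esub> snd x)"])
          (auto simp: rmodule_sum_def M.M.l_neg N.M.l_neg)
    qed (auto simp: rmodule_sum_def M.M.a_ac N.M.a_ac)
  qed (auto simp: rmodule_sum_def M.smult_closed N.smult_closed M.smult_l_distr N.smult_l_distr
      M.smult_r_distr N.smult_r_distr M.smult_mult N.smult_mult M.smult_one N.smult_one)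
qed

text \<open>
  If a submodule \<open>K\<close> contains \<open>(x, 0)\<close> for the generators \<open>x\<close> of the first factor, it does so for all
  \<open>x\<close>, as these \<open>x\<close> form a submodule; the same holds for the second factor, and the two factors span
  the sum.
\<close>

lemma fg_right_module_sum:
  assumes M: "fg_right_module R M" and N: "fg_right_module R N"
  shows "fg_right_module R (rmodule_sum M N)"
proof -
  interpret M: right_module R M using M by (simp add: fg_right_module_def)
  interpret N: right_module R N using N by (simp add: fg_right_module_def)
  interpret S: right_module R "rmodule_sum M N"
    by (rule right_module_sum) unfold_locales
  obtain F where F: "finite F" "F \<subseteq> carrier M"
    "\<And>x. x \<in> carrier M \<Longrightarrow> \<exists>c \<in> F \<rightarrow> carrier R. x = (\<Oplus>\<^bsub>M\<^esub>y\<in>F. c y \<odot>\<^bsub>M\<^esub> y)"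
    using M by (auto simp: fg_right_module_def)
  obtain G where G: "finite G" "G \<subseteq> carrier N"
    "\<And>x. x \<in> carrier N \<Longrightarrow> \<exists>c \<in> G \<rightarrow> carrier R. x = (\<Oplus>\<^bsub>N\<^esub>y\<in>G. c y \<odot>\<^bsub>N\<^esub> y)"
    using N by (auto simp: fg_right_module_def)
  show ?thesis
  proof (rule fg_right_moduleI[OF S.right_module_axioms, of "(\<lambda>x. (x, \<zero>\<^bsub>N\<^esub>)) ` F \<union> (\<lambda>y. (\<zero>\<^bsub>M\<^esub>, y)) ` G"])
    fix K assume K: "K \<subseteq> carrier (rmodule_sum M N)"
      "(\<lambda>x. (x, \<zero>\<^bsub>N\<^esub>)) ` F \<union> (\<lambda>y. (\<zero>\<^bsub>M\<^esub>, y)) ` G \<subseteq> K" "\<zero>\<^bsub>rmodule_sum M N\<^esub> \<in> K"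
      "\<And>x y. x \<in> K \<Longrightarrow> y \<in> K \<Longrightarrow> x \<oplus>\<^bsub>rmodule_sum M N\<^esub> y \<in> K"
      "\<And>a x. a \<in> carrier R \<Longrightarrow> x \<in> K \<Longrightarrow> a \<odot>\<^bsub>rmodule_sum M N\<^esub> x \<in> K"
    show "carrier (rmodule_sum M N) \<subseteq> K"
    proof
      fix z assume z: "z \<in> carrier (rmodule_sum M N)"
      then obtain x y where xy: "z = (x, y)" "x \<in> carrier M" "y \<in> carrier N"
        by (auto simp: rmodule_sum_def)
      obtain c where c: "c \<in> F \<rightarrow> carrier R" "x = (\<Oplus>\<^bsub>M\<^esub>y\<in>F. c y \<odot>\<^bsub>M\<^esub> y)"
        using F(3)[OF xy(2)] by blast
      obtain d where d: "d \<in> G \<rightarrow> carrier R" "y = (\<Oplus>\<^bsub>N\<^esub>y\<in>G. d y \<odot>\<^bsub>N\<^esub> y)"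
        using G(3)[OF xy(3)] by blast
      have "x \<in> {x. (x, \<zero>\<^bsub>N\<^esub>) \<in> K}" unfolding c(2)
      proof (rule M.mem_of_generators[OF F(1) _ _ c(1)])
        fix x x' assume "x \<in> {x. (x, \<zero>\<^bsub>N\<^esub>) \<in> K}" "x' \<in> {x. (x, \<zero>\<^bsub>N\<^esub>) \<in> K}"
        then show "x \<oplus>\<^bsub>M\<^esub> x' \<in> {x. (x, \<zero>\<^bsub>N\<^esub>) \<in> K}"
          using K(4)[of "(x, \<zero>\<^bsub>N\<^esub>)" "(x', \<zero>\<^bsub>N\<^esub>)"] by (simp add: rmodule_sum_def)
      next
        fix a x assume "a \<in> carrier R" "x \<in> {x. (x, \<zero>\<^bsub>N\<^esub>) \<in> K}"
        then show "a \<odot>\<^bsub>M\<^esub> x \<in> {x. (x, \<zero>\<^bsub>N\<^esub>) \<in> K}"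
          using K(5)[of a "(x, \<zero>\<^bsub>N\<^esub>)"] by (simp add: rmodule_sum_def N.smult_zero_right)
      qed (use K(1-3) in \<open>auto simp: rmodule_sum_def\<close>)
      moreover have "y \<in> {y. (\<zero>\<^bsub>M\<^esub>, y) \<in> K}" unfolding d(2)
      proof (rule N.mem_of_generators[OF G(1) _ _ d(1)])
        fix x x' assume "x \<in> {y. (\<zero>\<^bsub>M\<^esub>, y) \<in> K}" "x' \<in> {y. (\<zero>\<^bsub>M\<^esub>, y) \<in> K}"
        then show "x \<oplus>\<^bsub>N\<^esub> x' \<in> {y. (\<zero>\<^bsub>M\<^esub>, y) \<in> K}"
          using K(4)[of "(\<zero>\<^bsub>M\<^esub>, x)" "(\<zero>\<^bsub>M\<^esub>, x')"] by (simp add: rmodule_sum_def)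
      next
        fix a x assume "a \<in> carrier R" "x \<in> {y. (\<zero>\<^bsub>M\<^esub>, y) \<in> K}"
        then show "a \<odot>\<^bsub>N\<^esub> x \<in> {y. (\<zero>\<^bsub>M\<^esub>, y) \<in> K}"
          using K(5)[of a "(\<zero>\<^bsub>M\<^esub>, x)"] by (simp add: rmodule_sum_def M.smult_zero_right)
      qed (use K(1-3) in \<open>auto simp: rmodule_sum_def\<close>)
      ultimately show "z \<in> K"
        using K(4)[of "(x, \<zero>\<^bsub>N\<^esub>)" "(\<zero>\<^bsub>M\<^esub>, y)"] xy by (simp add: rmodule_sum_def)
    qed
  qed (use F G in \<open>auto simp: rmodule_sum_def\<close>)
qed

section \<open>String modules are finitely generated\<close>

definition unit_coeff :: "nat \<Rightarrow> nat \<Rightarrow> 'k::field" where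
  "unit_coeff i = (\<lambda>j. if j = i then 1 else 0)"

lemma carrier_string_module:
  "carrier (string_module Q w) = {x. \<forall>j>length (snd w). x j = 0}"
  by (simp add: string_module_def)

lemma add_string_module: "x \<oplus>\<^bsub>string_module Q w\<^esub> y = (\<lambda>j. x j + y j)"
  by (simp add: string_module_def)

lemma zero_string_module: "\<zero>\<^bsub>string_module Q w\<^esub> = (\<lambda>_. 0)"
  by (simp add: string_module_def)

lemma unit_coeff_in_carrier: "i \<le> length (snd w) \<Longrightarrow> unit_coeff i \<in> carrier (string_module Q w)"
  by (auto simp: carrier_string_module unit_coeff_def)

context quadratic_monomial_quiver
begin

lemma mult_mem_J:
  assumes "F \<in> carrier J" "G \<in> carrier J" "f \<in> F" "g \<in> G"
  shows "f \<in> carrier kQ" "g \<in> carrier kQ" "f \<otimes>\<^bsub>kQ\<^esub> g \<in> F \<otimes>\<^bsub>J\<^esub> G" "f \<oplus>\<^bsub>kQ\<^esub> g \<in> F \<oplus>\<^bsub>J\<^esub> G"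
proof -
  obtain f' g' where fg': "f' \<in> carrier kQ" "F = I +>\<^bsub>kQ\<^esub> f'" "g' \<in> carrier kQ" "G = I +>\<^bsub>kQ\<^esub> g'"
    using assms(1,2) by (metis carrier_J_E)
  have "F \<subseteq> carrier kQ" "G \<subseteq> carrier kQ"
    unfolding fg' using fg' by (auto simp: mem_coset_iff I.a_Hcarr)
  then show f: "f \<in> carrier kQ" and g: "g \<in> carrier kQ"
    using assms by auto
  have "f \<otimes>\<^bsub>kQ\<^esub> g \<in> I +>\<^bsub>kQ\<^esub> (f \<otimes>\<^bsub>kQ\<^esub> g)"
    using f g by (intro I.a_rcos_self) auto
  then show "f \<otimes>\<^bsub>kQ\<^esub> g \<in> F \<otimes>\<^bsub>J\<^esub> G"
    using assms by (auto simp: FactRing_def rcoset_mult_def)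
  show "f \<oplus>\<^bsub>kQ\<^esub> g \<in> F \<oplus>\<^bsub>J\<^esub> G"
    using assms by (auto simp: FactRing_def set_add_def set_mult_def)
qed

text \<open>
  The base field inside the quotient algebra.
\<close>

definition scalar :: "'k \<Rightarrow> (('v, 'e) qpath \<Rightarrow> 'k) set" where
  "scalar c = I +>\<^bsub>kQ\<^esub> (\<lambda>q. c * \<one>\<^bsub>kQ\<^esub> q)"

lemma scalar_mem: "(\<lambda>q. c * \<one>\<^bsub>kQ\<^esub> q) \<in> scalar c" "scalar c \<in> carrier J"
proof -
  have "{q. c * \<one>\<^bsub>kQ\<^esub> q \<noteq> 0} \<subseteq> {q. \<one>\<^bsub>kQ\<^esub> q \<noteq> (0::'k)}"
    by auto
  with kQ.one_closed have "(\<lambda>q. c * \<one>\<^bsub>kQ\<^esub> q) \<in> carrier kQ"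
    unfolding path_algebra_def by (auto elim: finite_subset)
  then show "(\<lambda>q. c * \<one>\<^bsub>kQ\<^esub> q) \<in> scalar c" "scalar c \<in> carrier J"
    by (simp_all add: scalar_def I.a_rcos_self coset_in_carrier_J)
qed

context
  fixes w :: "('v, 'e) word"
  assumes w: "is_string Q I w"
begin

lemma string_walk: "is_walk Q (fst w) (snd w)"
  using w by (simp add: is_string_iff)

lemma scalar_smult:
  assumes "x \<in> carrier (string_module Q w)"
  shows "scalar c \<odot>\<^bsub>string_module Q w\<^esub> x = (\<lambda>j. c * x j)"
proof -
  have "scalar c \<odot>\<^bsub>string_module Q w\<^esub> x = path_algebra_action Q w (\<lambda>q. c * \<one>\<^bsub>kQ\<^esub> q) x"
    by (rule string_module_smult[OF w scalar_mem(2,1)])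
  also have "\<dots> = (\<lambda>j. c * x j)"
    using assms by (simp add: path_algebra_action_scale path_algebra_action_one string_walk
        carrier_string_module)
  finally show ?thesis .
qed

lemma right_module_string_module: "right_module J (string_module Q w)"
proof (intro right_module.intro right_module_axioms.intro)
  show "ring J"
    by (rule I.quotient_is_ring)
  show "abelian_group (string_module Q w)"
  proof (rule abelian_groupI)
    fix x assume "x \<in> carrier (string_module Q w)"
    then show "\<exists>y\<in>carrier (string_module Q w). y \<oplus>\<^bsub>string_module Q w\<^esub> x = \<zero>\<^bsub>string_module Q w\<^esub>"
      by (intro bexI[of _ "\<lambda>j. - x j"]) (auto simp: string_module_def)
  qed (auto simp: string_module_def ac_simps)
next
  fix F x assume F: "F \<in> carrier J"
  then obtain f where "f \<in> F"
    using carrier_J_E by blast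
  with F show "F \<odot>\<^bsub>string_module Q w\<^esub> x \<in> carrier (string_module Q w)"
    by (simp add: string_module_smult[OF w] carrier_string_module path_algebra_action_supported)
next
  fix F G x assume FG: "F \<in> carrier J" "G \<in> carrier J"
  obtain f g where fg: "f \<in> F" "g \<in> G"
    using FG by (metis carrier_J_E)
  note fg' = mult_mem_J[OF FG fg]
  have "F \<oplus>\<^bsub>J\<^esub> G \<in> carrier J" "F \<otimes>\<^bsub>J\<^esub> G \<in> carrier J"
    using FG I.quotient_is_ring by (simp_all add: ring.ring_simprules)
  with FG fg fg' show
    "(F \<oplus>\<^bsub>J\<^esub> G) \<odot>\<^bsub>string_module Q w\<^esub> x =
      F \<odot>\<^bsub>string_module Q w\<^esub> x \<oplus>\<^bsub>string_module Q w\<^esub> G \<odot>\<^bsub>string_module Q w\<^esub> x"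
    "(F \<otimes>\<^bsub>J\<^esub> G) \<odot>\<^bsub>string_module Q w\<^esub> x =
      G \<odot>\<^bsub>string_module Q w\<^esub> (F \<odot>\<^bsub>string_module Q w\<^esub> x)"
    by (simp_all add: string_module_smult[OF w] add_string_module path_algebra_action_add
        path_algebra_action_mult string_walk)
next
  fix F x y assume F: "F \<in> carrier J"
  then obtain f where f: "f \<in> F"
    using carrier_J_E by blast
  show "F \<odot>\<^bsub>string_module Q w\<^esub> (x \<oplus>\<^bsub>string_module Q w\<^esub> y) =
      F \<odot>\<^bsub>string_module Q w\<^esub> x \<oplus>\<^bsub>string_module Q w\<^esub> F \<odot>\<^bsub>string_module Q w\<^esub> y"
    using linear_op_path_algebra_action[of Q w f]
    unfolding string_module_smult[OF w F f] add_string_module linear_op_def by blast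
next
  fix x :: "nat \<Rightarrow> 'k"
  assume "x \<in> carrier (string_module Q w)"
  moreover have "\<one>\<^bsub>J\<^esub> = I +>\<^bsub>kQ\<^esub> \<one>\<^bsub>kQ\<^esub>"
    by (simp add: FactRing_def)
  then have "\<one>\<^bsub>kQ\<^esub> \<in> \<one>\<^bsub>J\<^esub>" "\<one>\<^bsub>J\<^esub> \<in> carrier J"
    using I.a_rcos_self[OF kQ.one_closed] coset_in_carrier_J[OF kQ.one_closed] by simp_all
  ultimately show "\<one>\<^bsub>J\<^esub> \<odot>\<^bsub>string_module Q w\<^esub> x = x"
    by (simp add: string_module_smult[OF w] path_algebra_action_one string_walk carrier_string_module)
qed

lemma fg_string_module: "fg_right_module J (string_module Q w)"
proof -
  interpret S: right_module J "string_module Q w"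
    by (rule right_module_string_module)
  show ?thesis
  proof (rule fg_right_moduleI[OF S.right_module_axioms, of "unit_coeff ` {..length (snd w)}"])
    fix N :: "(nat \<Rightarrow> 'k) set"
    assume N: "N \<subseteq> carrier (string_module Q w)" "unit_coeff ` {..length (snd w)} \<subseteq> N"
      "\<zero>\<^bsub>string_module Q w\<^esub> \<in> N"
      "\<And>x y. x \<in> N \<Longrightarrow> y \<in> N \<Longrightarrow> x \<oplus>\<^bsub>string_module Q w\<^esub> y \<in> N"
      "\<And>F x. F \<in> carrier J \<Longrightarrow> x \<in> N \<Longrightarrow> F \<odot>\<^bsub>string_module Q w\<^esub> x \<in> N"
    show "carrier (string_module Q w) \<subseteq> N"
    proof
      fix x :: "nat \<Rightarrow> 'k"
      assume x: "x \<in> carrier (string_module Q w)"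
      \<comment> \<open>building up \<open>x\<close> from its first coefficients, one multiple of a basis element at a time\<close>
      have "(\<lambda>j. if j < m then x j else 0) \<in> N" if "m \<le> Suc (length (snd w))" for m
        using that
      proof (induction m)
        case 0
        then show ?case
          using N(3) by (simp add: zero_string_module)
      next
        case (Suc m)
        have e: "unit_coeff m \<in> N"
          using N(2) Suc.prems by auto
        then have "(\<lambda>j. x m * unit_coeff m j) \<in> N"
          using N(5)[OF scalar_mem(2) e, of "x m"] N(1) by (auto simp: scalar_smult)
        then have "(\<lambda>j. (if j < m then x j else 0) + x m * unit_coeff m j) \<in> N"
          using N(4) Suc by (simp add: add_string_module)
        moreover have "(\<lambda>j. (if j < m then x j else 0) + x m * unit_coeff m j) =
            (\<lambda>j. if j < Suc m then x j else 0)"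
          by (auto simp: unit_coeff_def fun_eq_iff less_Suc_eq)
        ultimately show ?case
          by simp
      qed
      moreover have "(\<lambda>j. if j < Suc (length (snd w)) then x j else 0) = x"
        using x by (auto simp: carrier_string_module fun_eq_iff)
      ultimately show "x \<in> N"
        by (metis order_refl)
    qed
  qed (auto simp: unit_coeff_in_carrier)
qed

end

end
section \<open>Homomorphisms and exact sequences\<close>

lemma rmodule_hom_comp:
  assumes "f \<in> rmodule_hom R L M" "g \<in> rmodule_hom R M N"
  shows "g \<circ> f \<in> rmodule_hom R L N"
  using assms unfolding rmodule_hom_def by (simp add: Pi_iff)

lemma rmodule_hom_zero:
  assumes "right_module R M" "right_module R N" "f \<in> rmodule_hom R M N"
  shows "f \<zero>\<^bsub>M\<^esub> = \<zero>\<^bsub>N\<^esub>"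
proof -
  interpret M: right_module R M by fact
  interpret N: right_module R N by fact
  have "f \<zero>\<^bsub>M\<^esub> \<in> carrier N" "f (\<zero>\<^bsub>M\<^esub> \<oplus>\<^bsub>M\<^esub> \<zero>\<^bsub>M\<^esub>) = f \<zero>\<^bsub>M\<^esub> \<oplus>\<^bsub>N\<^esub> f \<zero>\<^bsub>M\<^esub>"
    using assms(3) M.M.zero_closed unfolding rmodule_hom_def by blast+
  then show ?thesis
    by simp
qed

lemma rmodule_iso_inverse:
  assumes M: "right_module R M" and f: "f \<in> rmodule_hom R M N" "bij_betw f (carrier M) (carrier N)"
  shows "inv_into (carrier M) f \<in> rmodule_hom R N M"
    and "bij_betw (inv_into (carrier M) f) (carrier N) (carrier M)"
proof -
  interpret M: right_module R M by fact
  let ?g = "inv_into (carrier M) f"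
  show bij: "bij_betw ?g (carrier N) (carrier M)"
    by (rule bij_betw_inv_into[OF f(2)])
  have fg: "f (?g y) = y" if "y \<in> carrier N" for y
    using f(2) that by (simp add: bij_betw_inv_into_right)
  have gf: "?g (f x) = x" if "x \<in> carrier M" for x
    using f(2) that by (simp add: bij_betw_inv_into_left)
  have gc: "?g y \<in> carrier M" if "y \<in> carrier N" for y
    using bij that by (auto simp: bij_betw_def)
  have "?g (x \<oplus>\<^bsub>N\<^esub> y) = ?g x \<oplus>\<^bsub>M\<^esub> ?g y" if "x \<in> carrier N" "y \<in> carrier N" for x y
  proof -
    have "f (?g x \<oplus>\<^bsub>M\<^esub> ?g y) = x \<oplus>\<^bsub>N\<^esub> y"
      using f(1) that gc fg by (simp add: rmodule_hom_def)
    then show ?thesis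
      using gf[of "?g x \<oplus>\<^bsub>M\<^esub> ?g y"] gc that by simp
  qed
  moreover have "?g (a \<odot>\<^bsub>N\<^esub> x) = a \<odot>\<^bsub>M\<^esub> ?g x" if "a \<in> carrier R" "x \<in> carrier N" for a x
  proof -
    have "f (a \<odot>\<^bsub>M\<^esub> ?g x) = a \<odot>\<^bsub>N\<^esub> x"
      using f(1) that gc fg by (simp add: rmodule_hom_def)
    then show ?thesis
      using gf[of "a \<odot>\<^bsub>M\<^esub> ?g x"] gc that M.smult_closed by simp
  qed
  ultimately show "?g \<in> rmodule_hom R N M"
    using gc by (auto simp: rmodule_hom_def)
qed

text \<open>
  A string module is only given up to isomorphism. Composing the outer maps with isomorphisms
  carries exact sequences, and the absence of sections, from the concrete modules of coefficient functions
  to the given ones and back.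
\<close>

lemma short_exact_iso:
  assumes ex: "short_exact R L f E g N"
    and L: "fg_right_module R L'" "\<phi> \<in> rmodule_hom R L' L" "bij_betw \<phi> (carrier L') (carrier L)"
    and N: "fg_right_module R N'" "\<psi> \<in> rmodule_hom R N N'" "bij_betw \<psi> (carrier N) (carrier N')"
  shows "short_exact R L' (f \<circ> \<phi>) E (\<psi> \<circ> g) N'"
proof -
  have rm: "right_module R N" "right_module R N'"
    using ex N by (auto simp: short_exact_def fg_right_module_def)
  interpret N: right_module R N by (rule rm)
  have "\<psi> \<zero>\<^bsub>N\<^esub> = \<zero>\<^bsub>N'\<^esub>"
    by (rule rmodule_hom_zero[OF rm N(2)])
  then have 0: "\<psi> y = \<zero>\<^bsub>N'\<^esub> \<longleftrightarrow> y = \<zero>\<^bsub>N\<^esub>" if "y \<in> carrier N" for y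
    using N(3) that by (metis N.M.zero_closed bij_betw_inv_into_left)
  have "\<phi> ` carrier L' = carrier L" "\<psi> ` carrier N = carrier N'" "inj_on \<phi> (carrier L')"
    using L(3) N(3) by (auto simp: bij_betw_def)
  then have "inj_on (f \<circ> \<phi>) (carrier L')" "(f \<circ> \<phi>) ` carrier L' = f ` carrier L"
    "(\<psi> \<circ> g) ` carrier E = carrier N'"
    using ex by (simp_all add: short_exact_def comp_inj_on image_comp[symmetric] del: comp_apply)
  moreover have "{x \<in> carrier E. (\<psi> \<circ> g) x = \<zero>\<^bsub>N'\<^esub>} = {x \<in> carrier E. g x = \<zero>\<^bsub>N\<^esub>}"
    using ex 0 by (auto simp: short_exact_def rmodule_hom_def Pi_iff)
  ultimately show ?thesis
    using ex L N unfolding short_exact_def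
    by (auto intro: rmodule_hom_comp)
qed

lemma nonsplit_extension_iso:
  assumes ext: "gives_nonsplit_extension R L E N"
    and L: "fg_right_module R L'" "rmodule_iso R L' L"
    and N: "fg_right_module R N'" "rmodule_iso R N' N"
  shows "gives_nonsplit_extension R L' E N'"
proof -
  obtain f g where ex: "short_exact R L f E g N"
    and nonsplit: "\<not> (\<exists>s \<in> rmodule_hom R N E. \<forall>x \<in> carrier N. g (s x) = x)"
    using ext by (auto simp: gives_nonsplit_extension_def)
  obtain \<phi> where \<phi>: "\<phi> \<in> rmodule_hom R L' L" "bij_betw \<phi> (carrier L') (carrier L)"
    using L by (auto simp: rmodule_iso_def)
  obtain \<theta> where \<theta>: "\<theta> \<in> rmodule_hom R N' N" "bij_betw \<theta> (carrier N') (carrier N)"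
    using N by (auto simp: rmodule_iso_def)
  define \<psi> where "\<psi> = inv_into (carrier N') \<theta>"
  have \<psi>: "\<psi> \<in> rmodule_hom R N N'" "bij_betw \<psi> (carrier N) (carrier N')"
    using rmodule_iso_inverse[OF _ \<theta>] N(1) by (auto simp: \<psi>_def fg_right_module_def)
  have "\<not> (\<forall>x \<in> carrier N'. (\<psi> \<circ> g) (s x) = x)" if s: "s \<in> rmodule_hom R N' E" for s
  proof
    assume split: "\<forall>x \<in> carrier N'. (\<psi> \<circ> g) (s x) = x"
    have "g ((s \<circ> \<psi>) y) = y" if y: "y \<in> carrier N" for y
    proof -
      have "\<psi> y \<in> carrier N'"
        using \<psi>(2) y by (auto simp: bij_betw_def)
      then have "\<psi> (g (s (\<psi> y))) = \<psi> y" "g (s (\<psi> y)) \<in> carrier N"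
        using split s ex by (auto simp: short_exact_def rmodule_hom_def Pi_iff)
      then show ?thesis
        using \<psi>(2) y unfolding bij_betw_def comp_apply by (blast dest: inj_onD)
    qed
    then show False
      using nonsplit rmodule_hom_comp[OF \<psi>(1) s] by blast
  qed
  then show ?thesis
    unfolding gives_nonsplit_extension_def
    using short_exact_iso[OF ex L(1) \<phi> N(1) \<psi>] by blast
qed

section \<open>Graph maps between string modules\<close>

context quadratic_monomial_quiver
begin

text \<open>
  Vertices and arrows generate the path algebra.
\<close>

lemma string_homI:
  assumes w: "is_string Q I w" "is_string Q I w'" and h: "linear_op h"
    and closed: "\<And>x. x \<in> carrier (string_module Q w) \<Longrightarrow> h x \<in> carrier (string_module Q w')"
    and vertex: "\<And>v x. x \<in> carrier (string_module Q w) \<Longrightarrow>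
      h (vertex_action Q w v x) = vertex_action Q w' v (h x)"
    and arrow: "\<And>a x. x \<in> carrier (string_module Q w) \<Longrightarrow>
      h (arrow_action w a x) = arrow_action w' a (h x)"
  shows "h \<in> rmodule_hom J (string_module Q w) (string_module Q w')"
proof -
  have path: "h (path_action Q w q x) = path_action Q w' q (h x)"
    if x: "x \<in> carrier (string_module Q w)" for q x
  proof -
    have "h (path_action Q w (u, p) x) = path_action Q w' (u, p) (h x)" for u p
    proof (induction p rule: rev_induct)
      case Nil
      then show ?case by (simp add: path_action_Nil vertex x)
    next
      case (snoc a p)
      have "path_action Q w (u, p) x \<in> carrier (string_module Q w)"
        by (simp add: carrier_string_module path_action_supported)
      with snoc show ?case by (simp add: path_action_snoc arrow)
    qed
    then show ?thesis by (cases q) simp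
  qed
  have act: "h (path_algebra_action Q w f x) = path_algebra_action Q w' f (h x)"
    if "x \<in> carrier (string_module Q w)" for f x
    unfolding path_algebra_action_def linear_op_sum[OF h] by (simp add: path[OF that])
  have "h (F \<odot>\<^bsub>string_module Q w\<^esub> x) = F \<odot>\<^bsub>string_module Q w'\<^esub> h x"
    if "F \<in> carrier J" "x \<in> carrier (string_module Q w)" for F x
    using carrier_J_E[OF that(1)] act[OF that(2)] string_module_smult[OF w(1) that(1)]
      string_module_smult[OF w(2) that(1)] by metis
  then show ?thesis
    using closed h by (auto simp: rmodule_hom_def add_string_module linear_op_def)
qed

lemma string_hom_arrow:
  assumes w: "is_string Q I w" "is_string Q I w'"
    and h: "h \<in> rmodule_hom J (string_module Q w) (string_module Q w')"
    and x: "x \<in> carrier (string_module Q w)" and a: "a \<in> arcs Q"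
  shows "h (arrow_action w a x) = arrow_action w' a (h x)"
proof -
  define f where "f = (path_elem (tail Q a, [a]) :: _ \<Rightarrow> 'k)"
  have f: "f \<in> carrier kQ"
    unfolding f_def by (intro path_elem_closed arrow_in_qpaths a)
  have "F \<odot>\<^bsub>string_module Q v\<^esub> y = arrow_action v a y"
    if "F = I +>\<^bsub>kQ\<^esub> f" "is_string Q I v" for v F y
    using string_module_smult[OF that(2) coset_in_carrier_J[OF f] I.a_rcos_self[OF f], of y] that
    by (simp add: f_def path_algebra_action_path_elem path_action_arrow string_walk)
  moreover have "h ((I +>\<^bsub>kQ\<^esub> f) \<odot>\<^bsub>string_module Q w\<^esub> x) = (I +>\<^bsub>kQ\<^esub> f) \<odot>\<^bsub>string_module Q w'\<^esub> h x"
    using h x coset_in_carrier_J[OF f] by (simp add: rmodule_hom_def)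
  ultimately show ?thesis
    using w by simp
qed

end

text \<open>
  Projection to the positions \<open>s, \<dots>, s + m\<close> followed by inclusion at the positions \<open>t, \<dots>, t + m\<close>. A
  subword of \<open>m\<close> letters occupies \<open>m + 1\<close> positions, so both bounds are included.
\<close>

definition segment_map :: "nat \<Rightarrow> nat \<Rightarrow> nat \<Rightarrow> (nat \<Rightarrow> 'k::field) \<Rightarrow> nat \<Rightarrow> 'k" where
  "segment_map m s t x = (\<lambda>j. if t \<le> j \<and> j \<le> t + m then x (j - t + s) else 0)"

lemma linear_op_segment_map: "linear_op (segment_map m s t)"
  by (auto simp: linear_op_def segment_map_def)

context quadratic_monomial_quiver
begin

text \<open>
  The arrows adjacent to \<open>u\<close> leave it in the first word, so that the positions outside \<open>u\<close> span a
  submodule; they enter it in the second word, so that \<open>u\<close> spans a submodule there. Inside \<open>u\<close> an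
  arrow acts by the same letters on both sides.
\<close>

lemma segment_map_hom:
  assumes w: "is_string Q I (v, a @ u @ b)" and w': "is_string Q I (v', c @ u @ d)"
    and start: "word_end Q (v, a) = word_end Q (v', c)"
    and a: "a = [] \<or> (\<exists>e. last a = Inv e)" and b: "b = [] \<or> (\<exists>e. hd b = Dir e)"
    and c: "c = [] \<or> (\<exists>e. last c = Dir e)" and d: "d = [] \<or> (\<exists>e. hd d = Inv e)"
    and s: "s = length a" and t: "t = length c" and m: "m = length u"
  shows "segment_map m s t \<in>
    rmodule_hom J (string_module Q (v, a @ u @ b)) (string_module Q (v', c @ u @ d))"
proof -
  define ls where "ls = a @ u @ b"
  define ls' where "ls' = c @ u @ d"
  have len: "s + m \<le> length ls" "t + m \<le> length ls'"
    by (simp_all add: ls_def ls'_def s t m)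
  have mid: "ls ! (s + k) = ls' ! (t + k)" if "k < m" for k
    using that by (simp add: ls_def ls'_def s t m nth_append)
  have left: "ls ! i \<noteq> Dir e" if "s = Suc i" for i e
  proof -
    have "a \<noteq> []" "i = length a - 1"
      using that s by auto
    then have "ls ! i = last a"
      by (simp add: ls_def nth_append last_conv_nth)
    then show ?thesis
      using a \<open>a \<noteq> []\<close> by auto
  qed
  have left': "ls' ! i \<noteq> Inv e" if "t = Suc i" for i e
  proof -
    have "c \<noteq> []" "i = length c - 1"
      using that t by auto
    then have "ls' ! i = last c"
      by (simp add: ls'_def nth_append last_conv_nth)
    then show ?thesis
      using c \<open>c \<noteq> []\<close> by auto
  qed
  have right: "ls ! (s + m) \<noteq> Inv e" if "s + m < length ls" for e
  proof -
    have "b \<noteq> []"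
      using that by (auto simp: ls_def s m)
    moreover from this have "ls ! (s + m) = hd b"
      by (simp add: ls_def nth_append s m hd_conv_nth)
    ultimately show ?thesis
      using b by auto
  qed
  have right': "ls' ! (t + m) \<noteq> Dir e" if "t + m < length ls'" for e
  proof -
    have "d \<noteq> []"
      using that by (auto simp: ls'_def t m)
    moreover from this have "ls' ! (t + m) = hd d"
      by (simp add: ls'_def nth_append t m hd_conv_nth)
    ultimately show ?thesis
      using d by auto
  qed
  have vtx: "word_end Q (v, take (s + k) ls) = word_end Q (v', take (t + k) ls')" if "k \<le> m" for k
    using that start by (simp add: ls_def ls'_def s t m word_end_append)
  have "segment_map m s t \<in> rmodule_hom J (string_module Q (v, ls)) (string_module Q (v', ls'))"
  proof (rule string_homI)
    show "is_string Q I (v, ls)" "is_string Q I (v', ls')"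
      using w w' by (simp_all add: ls_def ls'_def)
    show "linear_op (segment_map m s t)"
      by (rule linear_op_segment_map)
    show "segment_map m s t x \<in> carrier (string_module Q (v', ls'))" for x :: "nat \<Rightarrow> 'k"
      using len by (auto simp: carrier_string_module segment_map_def)
    show "segment_map m s t (vertex_action Q (v, ls) z x) =
        vertex_action Q (v', ls') z (segment_map m s t x)" for z and x :: "nat \<Rightarrow> 'k"
    proof
      fix j
      show "segment_map m s t (vertex_action Q (v, ls) z x) j =
        vertex_action Q (v', ls') z (segment_map m s t x) j"
      proof (cases "t \<le> j \<and> j \<le> t + m")
        case True
        then obtain k where "j = t + k" "k \<le> m"
          by (metis le_Suc_ex nat_add_left_cancel_le)
        then show ?thesis
          using vtx[of k] len by (simp add: segment_map_def vertex_action_def add.commute)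
      qed (auto simp: segment_map_def vertex_action_def)
    qed
    show "segment_map m s t (arrow_action (v, ls) e x) =
        arrow_action (v', ls') e (segment_map m s t x)" for e and x :: "nat \<Rightarrow> 'k"
    proof
      fix j
      consider k where "j = t + k" "k \<le> m" | "j < t" | "t + m < j"
        by (metis le_Suc_ex nat_add_left_cancel_le not_le)
      then show "segment_map m s t (arrow_action (v, ls) e x) j =
        arrow_action (v', ls') e (segment_map m s t x) j"
      proof cases
        case 1
        \<comment> \<open>the contribution of the letter before the position; at the start of \<open>u\<close> it vanishes on both sides\<close>
        have D: "(if 1 \<le> s + k \<and> s + k \<le> length ls \<and> ls ! (s + k - 1) = Dir e then x (s + k - 1) else 0) =
          (if 1 \<le> t + k \<and> t + k \<le> length ls' \<and> ls' ! (t + k - 1) = Dir e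
           then segment_map m s t x (t + k - 1) else 0)"
        proof (cases k)
          case 0
          have "ls ! (s - 1) \<noteq> Dir e" if "1 \<le> s"
            using left[of "s - 1" e] that by simp
          with 0 show ?thesis
            by (auto simp: segment_map_def)
        next
          case (Suc i)
          then show ?thesis
            using mid[of i] 1 len by (auto simp: segment_map_def add.commute)
        qed
        \<comment> \<open>the contribution of the letter after the position; at the end of \<open>u\<close> it vanishes on both sides\<close>
        have E: "(if s + k < length ls \<and> ls ! (s + k) = Inv e then x (s + k + 1) else 0) =
          (if t + k < length ls' \<and> ls' ! (t + k) = Inv e
           then segment_map m s t x (t + k + 1) else 0)"
        proof (cases "k = m")
          case True
          then show ?thesis
            using right by (auto simp: segment_map_def)
        next
          case False
          then show ?thesis
            using mid[of k] 1 len by (auto simp: segment_map_def add.commute)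
        qed
        have "segment_map m s t (arrow_action (v, ls) e x) j = arrow_action (v, ls) e x (s + k)"
          using 1 by (simp add: segment_map_def add.commute)
        also have "\<dots> = arrow_action (v', ls') e (segment_map m s t x) (t + k)"
          unfolding arrow_action_def snd_conv D E ..
        finally show ?thesis
          using 1 by simp
      next
        case 2
        then show ?thesis
          using left'[of j] by (auto simp: segment_map_def arrow_action_def)
      next
        case 3
        then have "j - 1 = t + m \<or> t + m < j - 1"
          by auto
        then show ?thesis
          using 3 right' by (auto simp: segment_map_def arrow_action_def)
      qed
    qed
  qed
  then show ?thesis
    by (simp add: ls_def ls'_def)
qed

section \<open>Diagonal coefficients of homomorphisms\<close>

lemma string_adjacent:
  assumes "is_string Q I w" "Suc i < length (snd w)"
  shows "composable_letters (snd w ! i) (snd w ! Suc i)"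
  using assms by (simp add: is_string_iff successively_conv_nth)

lemma string_letter_arrow:
  assumes "is_string Q I w" "i < length (snd w)"
  shows "letter_arrow (snd w ! i) \<in> arcs Q"
  using assms is_walk_nth(1)[of "fst w" "snd w" i] by (simp add: is_string_iff)

text \<open>
  In general two letters can contribute to a coefficient of \<open>arrow_action\<close>, but in a string the arrow of
  a letter does not occur in the opposite direction in a neighbouring letter. This gives the four
  rules for the action of the arrow of a letter.
\<close>

lemma arrow_action_at_Dir:
  assumes "is_string Q I w" "i < length (snd w)" "snd w ! i = Dir a"
  shows "arrow_action w a x (Suc i) = x i"
  using assms string_adjacent[of w i] by (auto simp: arrow_action_Suc)

lemma arrow_action_at_Inv:
  assumes "is_string Q I w" "i < length (snd w)" "snd w ! i = Inv a"
  shows "arrow_action w a x i = x (Suc i)"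
  using assms string_adjacent[of w "i - 1"]
  by (cases i) (auto simp: arrow_action_0 arrow_action_Suc)

lemma arrow_action_unit_Dir:
  assumes w: "is_string Q I w" and i: "i < length (snd w)" "snd w ! i = Dir a"
  shows "arrow_action w a (unit_coeff i) = unit_coeff (Suc i)"
proof
  fix j
  have "snd w ! j \<noteq> Inv a" if "Suc j = i"
    using string_adjacent[OF w, of j] i that by auto
  then show "arrow_action w a (unit_coeff i) j = unit_coeff (Suc i) j"
    using i by (cases j) (auto simp: arrow_action_0 arrow_action_Suc unit_coeff_def)
qed

lemma arrow_action_unit_Inv:
  assumes w: "is_string Q I w" and i: "i < length (snd w)" "snd w ! i = Inv a"
  shows "arrow_action w a (unit_coeff (Suc i)) = unit_coeff i"
proof
  fix j
  have "snd w ! Suc i \<noteq> Dir a" if "Suc i < length (snd w)"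
    using string_adjacent[OF w that] i by auto
  then show "arrow_action w a (unit_coeff (Suc i)) j = unit_coeff i j"
    using i by (cases j; cases "j = i") (auto simp: arrow_action_0 arrow_action_Suc unit_coeff_def)
qed

text \<open>
  The arrow of each letter moves the basis element on one side of the letter to the one on the other
  side. Comparing the coefficients of the images under \<open>h\<close> gives the equality of consecutive diagonal
  coefficients.
\<close>

lemma endomorphism_diagonal_constant:
  assumes w: "is_string Q I w" and h: "h \<in> rmodule_hom J (string_module Q w) (string_module Q w)"
    and i: "i \<le> length (snd w)"
  shows "h (unit_coeff i) i = h (unit_coeff 0) 0"
  using i
proof (induction i)
  case (Suc i)
  then have i: "i < length (snd w)"
    by simp
  have c: "unit_coeff i \<in> carrier (string_module Q w)" "unit_coeff (Suc i) \<in> carrier (string_module Q w)"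
    using Suc.prems by (auto intro: unit_coeff_in_carrier)
  have "h (unit_coeff (Suc i)) (Suc i) = h (unit_coeff i) i"
  proof (cases "snd w ! i")
    case (Dir a)
    then have a: "a \<in> arcs Q"
      using string_letter_arrow[OF w i] by simp
    show ?thesis
      using string_hom_arrow[OF w w h c(1) a] arrow_action_at_Dir[OF w i Dir, of "h (unit_coeff i)"]
      by (simp add: arrow_action_unit_Dir[OF w i Dir])
  next
    case (Inv a)
    then have a: "a \<in> arcs Q"
      using string_letter_arrow[OF w i] by simp
    show ?thesis
      using string_hom_arrow[OF w w h c(2) a] arrow_action_at_Inv[OF w i Inv, of "h (unit_coeff (Suc i))"]
      by (simp add: arrow_action_unit_Inv[OF w i Inv])
  qed
  with Suc show ?case by simp
qed simp

text \<open>
  The arrow \<open>\<delta>\<close> annihilates the last basis element of the shorter module, but shifts the coefficient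
  at this position in the longer module to the next position. So no homomorphism, and in particular no
  section of the projection, keeps the last basis element.
\<close>

lemma hom_diagonal_zero_right:
  assumes w: "is_string Q I (v, ls)" and w': "is_string Q I (v', ls @ Dir \<delta> # ms)"
    and h: "h \<in> rmodule_hom J (string_module Q (v, ls)) (string_module Q (v', ls @ Dir \<delta> # ms))"
  shows "h (unit_coeff (length ls)) (length ls) = 0"
proof -
  let ?e = "unit_coeff (length ls) :: nat \<Rightarrow> 'k"
  have e: "?e \<in> carrier (string_module Q (v, ls))"
    by (rule unit_coeff_in_carrier) simp
  have "ls ! j \<noteq> Inv \<delta>" if "Suc j = length ls" for j
    using string_adjacent[OF w', of j] that by (auto simp: nth_append)
  then have "arrow_action (v, ls) \<delta> ?e = (\<lambda>_. 0)"
    by (auto simp: arrow_action_def unit_coeff_def fun_eq_iff)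
  moreover have \<delta>: "\<delta> \<in> arcs Q"
    using string_letter_arrow[OF w', of "length ls"] by simp
  moreover have "h (\<lambda>_. 0) = (\<lambda>_. 0)"
    using rmodule_hom_zero[OF right_module_string_module[OF w] right_module_string_module[OF w'] h]
    by (simp add: zero_string_module)
  ultimately have "arrow_action (v', ls @ Dir \<delta> # ms) \<delta> (h ?e) = (\<lambda>_. 0)"
    using string_hom_arrow[OF w w' h e \<delta>] by simp
  then show ?thesis
    using arrow_action_at_Dir[OF w', of "length ls" \<delta> "h ?e"] by simp
qed

text \<open>
  The mirror image: \<open>\<gamma>\<close> annihilates the first basis element of the shorter module, whose counterpart in
  the longer module stands at position \<open>length ms + 1\<close>, behind \<open>\<gamma>\<^sup>-\<^sup>1\<close>.
\<close>

lemma hom_diagonal_zero_left: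
  assumes w: "is_string Q I (v, ls)" and w': "is_string Q I (v', ms @ Inv \<gamma> # ls)"
    and h: "h \<in> rmodule_hom J (string_module Q (v, ls)) (string_module Q (v', ms @ Inv \<gamma> # ls))"
  shows "h (unit_coeff 0) (Suc (length ms)) = 0"
proof -
  let ?e = "unit_coeff 0 :: nat \<Rightarrow> 'k"
  have e: "?e \<in> carrier (string_module Q (v, ls))"
    by (rule unit_coeff_in_carrier) simp
  have "ls ! 0 \<noteq> Dir \<gamma>" if "ls \<noteq> []"
    using string_adjacent[OF w', of "length ms"] that by (auto simp: nth_append)
  then have "arrow_action (v, ls) \<gamma> ?e j = 0" for j
    by (cases j) (auto simp: arrow_action_0 arrow_action_Suc unit_coeff_def)
  then have "arrow_action (v, ls) \<gamma> ?e = (\<lambda>_. 0)"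
    by blast
  moreover have \<gamma>: "\<gamma> \<in> arcs Q"
    using string_letter_arrow[OF w', of "length ms"] by simp
  moreover have "h (\<lambda>_. 0) = (\<lambda>_. 0)"
    using rmodule_hom_zero[OF right_module_string_module[OF w] right_module_string_module[OF w'] h]
    by (simp add: zero_string_module)
  ultimately have "arrow_action (v', ms @ Inv \<gamma> # ls) \<gamma> (h ?e) = (\<lambda>_. 0)"
    using string_hom_arrow[OF w w' h e \<gamma>] by simp
  then show ?thesis
    using arrow_action_at_Inv[OF w', of "length ms" \<gamma> "h ?e"] by simp
qed

end
section \<open>The extensions given by crossings\<close>

lemma rmodule_hom_sumE:
  assumes "s \<in> rmodule_hom R N (rmodule_sum M M')"
  shows "fst \<circ> s \<in> rmodule_hom R N M" "snd \<circ> s \<in> rmodule_hom R N M'"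
  using assms by (auto simp: rmodule_hom_def rmodule_sum_def Pi_iff mem_Times_iff split: prod.splits)

lemma linear_op_diff:
  assumes "linear_op h"
  shows "h (\<lambda>j. x j - y j) = (\<lambda>j. h x j - h y j)"
proof -
  note add = assms[unfolded linear_op_def, THEN conjunct1, rule_format]
  note scale = assms[unfolded linear_op_def, THEN conjunct2, rule_format]
  have "h (\<lambda>j. x j + (- 1) * y j) = (\<lambda>j. h x j + h (\<lambda>j. (- 1) * y j) j)"
    by (rule add)
  also have "h (\<lambda>j. (- 1) * y j) = (\<lambda>j. (- 1) * h y j)"
    by (rule scale)
  finally show ?thesis
    by simp
qed

context quadratic_monomial_quiver
begin

lemma pair_hom:
  assumes "f \<in> rmodule_hom J L (string_module Q w)" "g \<in> rmodule_hom J L (string_module Q w')"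
  shows "(\<lambda>x. (f x, g x)) \<in> rmodule_hom J L (rmodule_sum (string_module Q w) (string_module Q w'))"
  using assms by (auto simp: rmodule_hom_def rmodule_sum_def)

lemma difference_hom:
  assumes w: "is_string Q I w"
    and g: "g \<in> rmodule_hom J (string_module Q w3) (string_module Q w)"
    and g': "g' \<in> rmodule_hom J (string_module Q w4) (string_module Q w)"
  shows "(\<lambda>(x, y) j. g x j - g' y j) \<in>
    rmodule_hom J (rmodule_sum (string_module Q w3) (string_module Q w4)) (string_module Q w)"
proof -
  have "F \<odot>\<^bsub>string_module Q w\<^esub> (\<lambda>j. x j - y j) =
      (\<lambda>j. (F \<odot>\<^bsub>string_module Q w\<^esub> x) j - (F \<odot>\<^bsub>string_module Q w\<^esub> y) j)"
    if F: "F \<in> carrier J" for F and x y :: "nat \<Rightarrow> 'k"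
  proof -
    obtain f where f: "f \<in> F"
      using carrier_J_E[OF F] by blast
    show ?thesis
      unfolding string_module_smult[OF w F f]
      by (rule linear_op_diff[OF linear_op_path_algebra_action])
  qed
  then show ?thesis
    using g g' by (auto simp: rmodule_hom_def rmodule_sum_def carrier_string_module
        add_string_module fun_eq_iff Pi_iff)
qed

text \<open>
  Since \<open>\<alpha>\<close> points from \<open>ls1\<close> to \<open>ls2\<close>, the word \<open>ls2\<close> spans a submodule and \<open>ls1\<close> the quotient. A
  section would keep the last basis element of the quotient.
\<close>

lemma arrow_crossing_extension:
  assumes w1: "is_string Q I (v1, ls1)" and w2: "is_string Q I (v2, ls2)"
    and w3: "is_string Q I (v1, ls1 @ Dir \<alpha> # ls2)" and head: "head Q \<alpha> = v2"
  shows "gives_nonsplit_extension J (string_module Q (v2, ls2))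
    (string_module Q (v1, ls1 @ Dir \<alpha> # ls2)) (string_module Q (v1, ls1))"
proof -
  let ?L = "string_module Q (v2, ls2) :: (_, nat \<Rightarrow> 'k) module"
  let ?E = "string_module Q (v1, ls1 @ Dir \<alpha> # ls2) :: (_, nat \<Rightarrow> 'k) module"
  let ?N = "string_module Q (v1, ls1) :: (_, nat \<Rightarrow> 'k) module"
  define n where "n = length ls1"
  define m where "m = length ls2"
  define f :: "(nat \<Rightarrow> 'k) \<Rightarrow> nat \<Rightarrow> 'k" where "f = segment_map m 0 (Suc n)"
  define g :: "(nat \<Rightarrow> 'k) \<Rightarrow> nat \<Rightarrow> 'k" where "g = segment_map n 0 0"
  have f: "f \<in> rmodule_hom J ?L ?E"
    using segment_map_hom[of v2 "[]" ls2 "[]" v1 "ls1 @ [Dir \<alpha>]" "[]" 0 "Suc n" m] w2 w3 head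
    by (simp add: f_def n_def m_def word_end_def)
  have g: "g \<in> rmodule_hom J ?E ?N"
    using segment_map_hom[of v1 "[]" ls1 "Dir \<alpha> # ls2" v1 "[]" "[]" 0 0 n] w1 w3
    by (simp add: g_def n_def)
  have "short_exact J ?L f ?E g ?N"
    unfolding short_exact_def
  proof (intro conjI fg_string_module w1 w2 w3 f g)
    show "inj_on f (carrier ?L)"
    proof (rule inj_onI)
      fix x y assume xy: "x \<in> carrier ?L" "y \<in> carrier ?L" "f x = f y"
      show "x = y"
      proof
        fix j
        show "x j = y j"
          using xy(1,2) fun_cong[OF xy(3), of "Suc n + j"]
          by (cases "j \<le> m") (auto simp: f_def segment_map_def carrier_string_module m_def)
      qed
    qed
    show "f ` carrier ?L = {x \<in> carrier ?E. g x = \<zero>\<^bsub>?N\<^esub>}"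
    proof (intro equalityI subsetI)
      fix y assume "y \<in> f ` carrier ?L"
      then obtain x where "y = f x" "x \<in> carrier ?L"
        by blast
      then show "y \<in> {x \<in> carrier ?E. g x = \<zero>\<^bsub>?N\<^esub>}"
        by (auto simp: carrier_string_module zero_string_module f_def g_def segment_map_def n_def m_def)
    next
      fix y assume y: "y \<in> {x \<in> carrier ?E. g x = \<zero>\<^bsub>?N\<^esub>}"
      have "g y j = 0" for j
        using y by (simp add: zero_string_module)
      then have y0: "y j = 0" if "j \<le> n" for j
        using that by (metis add.commute add_0 diff_zero g_def le0 segment_map_def)
      have "y = f (\<lambda>j. y (Suc n + j))"
        using y y0 by (auto simp: fun_eq_iff f_def segment_map_def carrier_string_module n_def m_def)
      moreover have "(\<lambda>j. y (Suc n + j)) \<in> carrier ?L"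
        using y by (auto simp: carrier_string_module n_def m_def)
      ultimately show "y \<in> f ` carrier ?L"
        by blast
    qed
    show "g ` carrier ?E = carrier ?N"
    proof (intro equalityI subsetI)
      fix y assume "y \<in> g ` carrier ?E"
      then show "y \<in> carrier ?N"
        using g by (auto simp: rmodule_hom_def)
    next
      fix y assume y: "y \<in> carrier ?N"
      then have "y = g y"
        by (auto simp: carrier_string_module g_def segment_map_def n_def fun_eq_iff)
      moreover have "y \<in> carrier ?E"
        using y by (auto simp: carrier_string_module)
      ultimately show "y \<in> g ` carrier ?E"
        by blast
    qed
  qed
  moreover have "\<not> (\<forall>x \<in> carrier ?N. g (s x) = x)" if s: "s \<in> rmodule_hom J ?N ?E" for s
  proof
    assume "\<forall>x \<in> carrier ?N. g (s x) = x"
    moreover have "unit_coeff n \<in> carrier ?N"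
      by (rule unit_coeff_in_carrier) (simp add: n_def)
    ultimately have "g (s (unit_coeff n)) n = unit_coeff n n"
      by simp
    then show False
      using hom_diagonal_zero_right[OF w1 w3 s]
      by (simp add: g_def segment_map_def unit_coeff_def n_def)
  qed
  ultimately show ?thesis
    unfolding gives_nonsplit_extension_def by blast
qed

text \<open>
  The kernel of the difference map consists of the pairs that agree on \<open>u\<close> and vanish on \<open>p1\<close> and
  \<open>q1\<close>; they are glued along \<open>u\<close> to an element of the module of \<open>p2 @ u @ q2\<close>. A section \<open>s\<close> would
  present the identity as a difference of two endomorphisms of the module of \<open>p1 @ u @ q1\<close>, which
  both have diagonal coefficient zero.
\<close>

lemma module_crossing_extension:
  assumes w1: "is_string Q I (v1, p1 @ u @ q1)" and w2: "is_string Q I (v2, p2 @ u @ q2)"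
    and w3: "is_string Q I (v1, p1 @ u @ q2)" and w4: "is_string Q I (v2, p2 @ u @ q1)"
    and start: "word_end Q (v1, p1) = word_end Q (v2, p2)"
    and p1: "p1 = [] \<or> (\<exists>\<alpha>. last p1 = Dir \<alpha>)" and q1: "q1 = [] \<or> (\<exists>\<beta>. hd q1 = Inv \<beta>)"
    and p2: "p2 = [] \<or> (\<exists>\<gamma>. last p2 = Inv \<gamma>)" and q2: "q2 = [] \<or> (\<exists>\<delta>. hd q2 = Dir \<delta>)"
    and p: "\<not> (p1 = [] \<and> p2 = [])" and q: "\<not> (q1 = [] \<and> q2 = [])"
  shows "gives_nonsplit_extension J (string_module Q (v2, p2 @ u @ q2))
    (rmodule_sum (string_module Q (v1, p1 @ u @ q2)) (string_module Q (v2, p2 @ u @ q1)))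
    (string_module Q (v1, p1 @ u @ q1))"
proof -
  let ?L = "string_module Q (v2, p2 @ u @ q2) :: (_, nat \<Rightarrow> 'k) module"
  let ?M3 = "string_module Q (v1, p1 @ u @ q2) :: (_, nat \<Rightarrow> 'k) module"
  let ?M4 = "string_module Q (v2, p2 @ u @ q1) :: (_, nat \<Rightarrow> 'k) module"
  let ?E = "rmodule_sum ?M3 ?M4"
  let ?N = "string_module Q (v1, p1 @ u @ q1) :: (_, nat \<Rightarrow> 'k) module"
  define a where "a = length p1"
  define b where "b = length p2"
  define m where "m = length u"
  define c where "c = length q1"
  define d where "d = length q2"
  note len = a_def b_def m_def c_def d_def
  define f3 :: "(nat \<Rightarrow> 'k) \<Rightarrow> nat \<Rightarrow> 'k" where "f3 = segment_map (m + d) b a"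
  define f4 :: "(nat \<Rightarrow> 'k) \<Rightarrow> nat \<Rightarrow> 'k" where "f4 = segment_map (b + m) 0 0"
  define g3 :: "(nat \<Rightarrow> 'k) \<Rightarrow> nat \<Rightarrow> 'k" where "g3 = segment_map (a + m) 0 0"
  define g4 :: "(nat \<Rightarrow> 'k) \<Rightarrow> nat \<Rightarrow> 'k" where "g4 = segment_map (m + c) b a"
  define f where "f = (\<lambda>x. (f3 x, f4 x))"
  define g where "g = (\<lambda>(x, y) j. g3 x j - g4 y j)"
  note maps = f3_def f4_def g3_def g4_def segment_map_def
  note carr = carrier_string_module
  have f3: "f3 \<in> rmodule_hom J ?L ?M3"
    using segment_map_hom[of v2 p2 "u @ q2" "[]" v1 p1 "[]" b a "m + d"] w2 w3 start p2 p1
    by (simp add: f3_def len)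
  have f4: "f4 \<in> rmodule_hom J ?L ?M4"
    using segment_map_hom[of v2 "[]" "p2 @ u" q2 v2 "[]" q1 0 0 "b + m"] w2 w4 q2 q1
    by (simp add: f4_def len)
  have g3: "g3 \<in> rmodule_hom J ?M3 ?N"
    using segment_map_hom[of v1 "[]" "p1 @ u" q2 v1 "[]" q1 0 0 "a + m"] w3 w1 q2 q1
    by (simp add: g3_def len)
  have g4: "g4 \<in> rmodule_hom J ?M4 ?N"
    using segment_map_hom[of v2 p2 "u @ q1" "[]" v1 p1 "[]" b a "m + c"] w4 w1 start p2 p1
    by (simp add: g4_def len)
  have f: "f \<in> rmodule_hom J ?L ?E"
    unfolding f_def by (rule pair_hom[OF f3 f4])
  have g: "g \<in> rmodule_hom J ?E ?N"
    unfolding g_def by (rule difference_hom[OF w1 g3 g4])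
  have carrE: "carrier ?E = carrier ?M3 \<times> carrier ?M4"
    by (simp add: rmodule_sum_def)
  have "short_exact J ?L f ?E g ?N"
    unfolding short_exact_def
  proof (intro conjI fg_right_module_sum fg_string_module w1 w2 w3 w4 f g)
    show "inj_on f (carrier ?L)"
    proof (rule inj_onI)
      fix x y assume xy: "x \<in> carrier ?L" "y \<in> carrier ?L" "f x = f y"
      show "x = y"
      proof
        fix j
        have f34: "f3 x = f3 y" "f4 x = f4 y"
          using xy(3) by (simp_all add: f_def)
        consider "j \<le> b + m" | "b \<le> j" "j \<le> b + m + d" | "b + m + d < j"
          by linarith
        then show "x j = y j"
        proof cases
          case 1
          then show ?thesis
            using fun_cong[OF f34(2), of j] by (simp add: maps)
        next
          case 2
          then obtain k where "j = b + k" "k \<le> m + d"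
            by (metis add.assoc le_Suc_ex nat_add_left_cancel_le)
          then show ?thesis
            using fun_cong[OF f34(1), of "a + k"] by (simp add: maps add.commute)
        next
          case 3
          then show ?thesis
            using xy(1,2) by (simp add: carr len)
        qed
      qed
    qed
    show "f ` carrier ?L = {z \<in> carrier ?E. g z = \<zero>\<^bsub>?N\<^esub>}"
    proof (intro equalityI subsetI)
      fix z assume "z \<in> f ` carrier ?L"
      then obtain x where x: "z = f x" "x \<in> carrier ?L"
        by blast
      have "f x \<in> carrier ?E"
        using f x by (auto simp: rmodule_hom_def)
      moreover have "g (f x) j = 0" for j
        by (auto simp: f_def g_def maps)
      ultimately show "z \<in> {z \<in> carrier ?E. g z = \<zero>\<^bsub>?N\<^esub>}"
        by (auto simp: x zero_string_module)
    next
      fix z assume z: "z \<in> {z \<in> carrier ?E. g z = \<zero>\<^bsub>?N\<^esub>}"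
      obtain x y where xy: "z = (x, y)" "x \<in> carrier ?M3" "y \<in> carrier ?M4"
        using z by (auto simp: carrE)
      have eq: "g3 x j = g4 y j" for j
      proof -
        have "g z j = 0"
          using z by (simp add: zero_string_module)
        then show ?thesis
          by (simp add: g_def xy(1))
      qed
      have x0: "x j = 0" if "j < a" for j
        using eq[of j] that by (simp add: maps)
      have y0: "y j = 0" if "b + m < j" for j
      proof (cases "j \<le> b + m + c")
        case True
        then show ?thesis
          using eq[of "j - b + a"] that by (simp add: maps split: if_splits)
      next
        case False
        then show ?thesis
          using xy(3) by (simp add: carr len)
      qed
      have xy_eq: "x (a + k) = y (b + k)" if "k \<le> m" for k
        using eq[of "a + k"] that by (simp add: maps add.commute)
      \<comment> \<open>gluing: \<open>p2\<close> and \<open>u\<close> are taken from \<open>y\<close>, the rest \<open>q2\<close> from \<open>x\<close>\<close>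
      define t where "t j = (if j \<le> b + m then y j else x (j - b + a))" for j
      have "t \<in> carrier ?L"
        using xy(2) by (auto simp: t_def carr len)
      moreover have "f3 t j = x j" for j
      proof -
        consider "j < a" | k where "j = a + k" "k \<le> m" | "a + m < j" "j \<le> a + m + d" | "a + m + d < j"
          by (metis le_Suc_ex nat_add_left_cancel_le not_le)
        then show ?thesis
        proof cases
          case 1
          then show ?thesis
            by (simp add: maps x0)
        next
          case (2 k)
          then show ?thesis
            using xy_eq[of k] by (simp add: maps t_def add.commute)
        next
          case 3
          then obtain k where "j = a + k" "m < k" "k \<le> m + d"
            by (metis add.assoc le_Suc_ex less_imp_le nat_add_left_cancel_le
                nat_add_left_cancel_less order_trans le_add1)
          then show ?thesis
            by (simp add: maps t_def add.commute)
        next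
          case 4
          then show ?thesis
            using xy(2) by (simp add: maps carr len)
        qed
      qed
      moreover have "f4 t j = y j" for j
        by (simp add: maps t_def y0)
      ultimately have "t \<in> carrier ?L" "z = f t"
        by (auto simp: f_def xy fun_eq_iff)
      then show "z \<in> f ` carrier ?L"
        by blast
    qed
    show "g ` carrier ?E = carrier ?N"
    proof (intro equalityI subsetI)
      fix y assume "y \<in> g ` carrier ?E"
      then show "y \<in> carrier ?N"
        using g by (auto simp: rmodule_hom_def)
    next
      fix t assume t: "t \<in> carrier ?N"
      \<comment> \<open>\<open>p1\<close> and \<open>u\<close> are covered by the first middle term, \<open>q1\<close> by the second one;
        the sign is the one of the difference map\<close>
      define x where "x j = (if j \<le> a + m then t j else 0)" for j
      define y where "y j = (if b + m < j then - t (j - b + a) else 0)" for j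
      have "(x, y) \<in> carrier ?E"
        using t by (auto simp: carrE carr x_def y_def len)
      moreover have "g (x, y) j = t j" for j
        using t by (auto simp: g_def maps x_def y_def carr len)
      ultimately show "t \<in> g ` carrier ?E"
        by (metis ext image_eqI)
    qed
  qed
  moreover have "\<not> (\<forall>x \<in> carrier ?N. g (s x) = x)" if s: "s \<in> rmodule_hom J ?N ?E" for s
  proof
    assume split: "\<forall>x \<in> carrier ?N. g (s x) = x"
    note s3 = rmodule_hom_sumE(1)[OF s] and s4 = rmodule_hom_sumE(2)[OF s]
    note h3 = rmodule_hom_comp[OF s3 g3] and h4 = rmodule_hom_comp[OF s4 g4]
    define e :: "nat \<Rightarrow> nat \<Rightarrow> 'k" where "e = unit_coeff"
    note diag3 = endomorphism_diagonal_constant[OF w1 h3, folded e_def]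
    note diag4 = endomorphism_diagonal_constant[OF w1 h4, folded e_def]
    \<comment> \<open>if \<open>q1\<close> is non-empty, the image of \<open>g3\<close> misses the last position;
      otherwise \<open>q2\<close> begins with an arrow that obstructs the last diagonal coefficient\<close>
    have "(g3 \<circ> (fst \<circ> s)) (e 0) 0 = 0"
    proof (cases "q1 = []")
      case False
      have "(g3 \<circ> (fst \<circ> s)) (e (a + m + c)) (a + m + c) = 0"
        using False by (simp add: maps len)
      then show ?thesis
        using diag3[of "a + m + c"] by (simp add: len)
    next
      case True
      then obtain \<delta> ms where "q2 = Dir \<delta> # ms"
        using q q2 by (cases q2) auto
      then have "(fst \<circ> s) (e (a + m)) (a + m) = 0"
        using hom_diagonal_zero_right[of v1 "p1 @ u" v1 \<delta> ms "fst \<circ> s"] w1 w3 s3 True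
        by (simp add: len e_def)
      then have "(g3 \<circ> (fst \<circ> s)) (e (a + m)) (a + m) = 0"
        by (simp add: maps)
      then show ?thesis
        using diag3[of "a + m"] by (simp add: len)
    qed
    \<comment> \<open>symmetrically at the first position, with \<open>p1\<close> and \<open>p2\<close>\<close>
    moreover have "(g4 \<circ> (snd \<circ> s)) (e 0) 0 = 0"
    proof (cases "p1 = []")
      case False
      then show ?thesis
        by (simp add: maps len)
    next
      case True
      then obtain \<gamma> ms where ms: "p2 = ms @ [Inv \<gamma>]"
        using p p2 by (cases p2 rule: rev_cases) auto
      have "(snd \<circ> s) (e 0) (Suc (length ms)) = 0"
        using hom_diagonal_zero_left[of v1 "u @ q1" v2 ms \<gamma> "snd \<circ> s"] w1 w4 s4 True ms
        by (simp add: e_def)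
      then show ?thesis
        by (simp add: maps True ms len)
    qed
    moreover have "e 0 \<in> carrier ?N"
      unfolding e_def by (rule unit_coeff_in_carrier) simp
    then have "g (s (e 0)) 0 = e 0 0"
      using split by simp
    then have "(g3 \<circ> (fst \<circ> s)) (e 0) 0 - (g4 \<circ> (snd \<circ> s)) (e 0) 0 = 1"
      by (simp add: g_def e_def unit_coeff_def case_prod_beta)
    ultimately show False
      by simp
  qed
  ultimately show ?thesis
    unfolding gives_nonsplit_extension_def by blast
qed

end
section \<open>Counting dimensions\<close>

text \<open>
  Elimination: equation \<open>n\<close> expresses a pivot unknown \<open>p\<close> by the others, which leaves \<open>n\<close> equations in
  one unknown less.
\<close>

lemma homogeneous_system_nontrivial_solution:
  fixes a :: "'i \<Rightarrow> nat \<Rightarrow> 'k::field"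
  assumes "finite S" "n < card S"
  shows "\<exists>c. (\<exists>i\<in>S. c i \<noteq> 0) \<and> (\<forall>j<n. (\<Sum>i\<in>S. c i * a i j) = 0)"
  using assms
proof (induction n arbitrary: S a)
  case 0
  then have "S \<noteq> {}"
    by auto
  then show ?case
    by (intro exI[of _ "\<lambda>_. 1"]) auto
next
  case (Suc n)
  show ?case
  proof (cases "\<forall>i\<in>S. a i n = 0")
    case True
    obtain c where "\<exists>i\<in>S. c i \<noteq> 0" "\<forall>j<n. (\<Sum>i\<in>S. c i * a i j) = 0"
      using Suc.IH[of S a] Suc.prems by auto
    with True show ?thesis
      by (intro exI[of _ c]) (auto simp: less_Suc_eq)
  next
    case False
    then obtain p where p: "p \<in> S" "a p n \<noteq> 0"
      by blast
    define b where "b i j = a i j - a i n / a p n * a p j" for i j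
    have "finite (S - {p})" "n < card (S - {p})"
      using Suc.prems p by simp_all
    then obtain c where c: "\<exists>i\<in>S - {p}. c i \<noteq> 0" "\<forall>j<n. (\<Sum>i\<in>S - {p}. c i * b i j) = 0"
      using Suc.IH[of "S - {p}" b] by blast
    define c' where "c' i = (if i = p then - (\<Sum>i\<in>S - {p}. c i * a i n / a p n) else c i)" for i
    have "(\<Sum>i\<in>S. c' i * a i j) = (\<Sum>i\<in>S - {p}. c i * b i j)" for j
    proof -
      have "(\<Sum>i\<in>S. c' i * a i j) = c' p * a p j + (\<Sum>i\<in>S - {p}. c' i * a i j)"
        using p Suc.prems(1) by (simp add: sum.remove)
      also have "(\<Sum>i\<in>S - {p}. c' i * a i j) = (\<Sum>i\<in>S - {p}. c i * a i j)"
        by (intro sum.cong) (auto simp: c'_def)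
      also have "c' p * a p j = - (\<Sum>i\<in>S - {p}. c i * (a i n / a p n * a p j))"
        by (simp add: c'_def sum_distrib_right mult.assoc)
      finally show ?thesis
        by (simp add: b_def right_diff_distrib sum_subtractf)
    qed
    moreover have "b i n = 0" for i
      using p by (simp add: b_def)
    ultimately have "\<forall>j<Suc n. (\<Sum>i\<in>S. c' i * a i j) = 0"
      using c(2) by (auto simp: less_Suc_eq)
    moreover have "\<exists>i\<in>S. c' i \<noteq> 0"
      using c(1) by (auto simp: c'_def)
    ultimately show ?thesis
      by blast
  qed
qed

lemma eq_double_imp_zero:
  fixes f :: "nat \<Rightarrow> 'k::field"
  assumes "f = (\<lambda>j. f j + f j)"
  shows "f = (\<lambda>_. 0)"
proof
  fix j
  show "f j = 0"
    using fun_cong[OF assms, of j] by (metis add_cancel_right_right)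
qed

context quadratic_monomial_quiver
begin

text \<open>
  The properties shared by string modules and the zero module that allow linear combinations to be
  computed coefficientwise.
\<close>

definition coefficient_module :: "((('v, 'e) qpath \<Rightarrow> 'k) set, nat \<Rightarrow> 'k) module \<Rightarrow> bool" where
  "coefficient_module M \<longleftrightarrow> (\<lambda>_. 0) \<in> carrier M \<and> \<zero>\<^bsub>M\<^esub> = (\<lambda>_. 0) \<and>
     (\<forall>x\<in>carrier M. \<forall>y\<in>carrier M. x \<oplus>\<^bsub>M\<^esub> y = (\<lambda>j. x j + y j) \<and> (\<lambda>j. x j + y j) \<in> carrier M) \<and>
     (\<forall>c. \<forall>x\<in>carrier M. scalar c \<odot>\<^bsub>M\<^esub> x = (\<lambda>j. c * x j) \<and> (\<lambda>j. c * x j) \<in> carrier M)"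

lemma coefficient_module_string: "is_string Q I w \<Longrightarrow> coefficient_module (string_module Q w)"
  by (simp add: coefficient_module_def scalar_smult zero_string_module add_string_module)
     (simp add: carrier_string_module)

lemma coefficient_module_zero: "coefficient_module zero_module"
  by (simp add: coefficient_module_def zero_module_def)

definition pair_combination ::
    "nat set \<Rightarrow> (nat \<Rightarrow> 'k) \<Rightarrow> (nat \<Rightarrow> (nat \<Rightarrow> 'k) \<times> (nat \<Rightarrow> 'k)) \<Rightarrow> (nat \<Rightarrow> 'k) \<times> (nat \<Rightarrow> 'k)" where
  "pair_combination S c v = (\<lambda>j. \<Sum>i\<in>S. c i * fst (v i) j, \<lambda>j. \<Sum>i\<in>S. c i * snd (v i) j)"

lemma hom_pair_combination:
  assumes M: "coefficient_module M" "coefficient_module M'" and N: "coefficient_module N"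
    and h: "h \<in> rmodule_hom J (rmodule_sum M M') N"
    and v: "finite S" "\<And>i. i \<in> S \<Longrightarrow> v i \<in> carrier (rmodule_sum M M')"
  shows "pair_combination S c v \<in> carrier (rmodule_sum M M') \<and>
    h (pair_combination S c v) = (\<lambda>j. \<Sum>i\<in>S. c i * h (v i) j)"
  using v
proof (induction S rule: finite_induct)
  case empty
  let ?z = "(\<lambda>_. 0, \<lambda>_. 0) :: (nat \<Rightarrow> 'k) \<times> (nat \<Rightarrow> 'k)"
  have z: "?z \<in> carrier (rmodule_sum M M')" "?z \<oplus>\<^bsub>rmodule_sum M M'\<^esub> ?z = ?z"
    using M by (auto simp: coefficient_module_def rmodule_sum_def)
  have "h ?z \<in> carrier N" "h (?z \<oplus>\<^bsub>rmodule_sum M M'\<^esub> ?z) = h ?z \<oplus>\<^bsub>N\<^esub> h ?z"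
    using h z(1) unfolding rmodule_hom_def by blast+
  then have "h ?z \<in> carrier N" "h ?z = h ?z \<oplus>\<^bsub>N\<^esub> h ?z"
    by (simp_all only: z(2))
  moreover from this have "h ?z \<oplus>\<^bsub>N\<^esub> h ?z = (\<lambda>j. h ?z j + h ?z j)"
    using N by (simp add: coefficient_module_def)
  ultimately have "h ?z = (\<lambda>_. 0)"
    by (intro eq_double_imp_zero) simp
  with z show ?case
    by (simp add: pair_combination_def)
next
  case (insert i S)
  let ?E = "rmodule_sum M M'"
  have vi: "v i \<in> carrier ?E" "fst (v i) \<in> carrier M" "snd (v i) \<in> carrier M'"
    using insert.prems[of i] by (auto simp: rmodule_sum_def)
  have IH: "pair_combination S c v \<in> carrier ?E"
    "h (pair_combination S c v) = (\<lambda>j. \<Sum>i\<in>S. c i * h (v i) j)"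
    using insert by auto
  have smult: "scalar (c i) \<odot>\<^bsub>?E\<^esub> v i = (\<lambda>j. c i * fst (v i) j, \<lambda>j. c i * snd (v i) j)"
    "scalar (c i) \<odot>\<^bsub>?E\<^esub> v i \<in> carrier ?E"
    using vi M by (auto simp: rmodule_sum_def coefficient_module_def case_prod_beta)
  have eq: "pair_combination (insert i S) c v =
      scalar (c i) \<odot>\<^bsub>?E\<^esub> v i \<oplus>\<^bsub>?E\<^esub> pair_combination S c v"
    and closed: "scalar (c i) \<odot>\<^bsub>?E\<^esub> v i \<oplus>\<^bsub>?E\<^esub> pair_combination S c v \<in> carrier ?E"
    using smult IH(1) insert.hyps M unfolding smult(1)
    by (auto simp: rmodule_sum_def coefficient_module_def pair_combination_def)
  have "h (v i) \<in> carrier N" "h (pair_combination S c v) \<in> carrier N"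
    using h vi IH(1) by (auto simp: rmodule_hom_def)
  moreover have "h (pair_combination (insert i S) c v) =
      scalar (c i) \<odot>\<^bsub>N\<^esub> h (v i) \<oplus>\<^bsub>N\<^esub> h (pair_combination S c v)"
    unfolding eq using h vi(1) IH(1) smult(2) scalar_mem(2)[of "c i"] by (simp add: rmodule_hom_def)
  ultimately have "h (pair_combination (insert i S) c v) =
      (\<lambda>j. c i * h (v i) j + h (pair_combination S c v) j)"
    using N by (simp add: coefficient_module_def)
  with eq closed IH(2) insert.hyps show ?case
    by simp
qed

lemma hom_into_pairs_combination:
  assumes L: "coefficient_module L" and M: "coefficient_module M" "coefficient_module M'"
    and h: "h \<in> rmodule_hom J L (rmodule_sum M M')"
    and x: "finite S" "\<And>i. i \<in> S \<Longrightarrow> x i \<in> carrier L"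
  shows "(\<lambda>j. \<Sum>i\<in>S. c i * x i j) \<in> carrier L \<and>
    h (\<lambda>j. \<Sum>i\<in>S. c i * x i j) = pair_combination S c (\<lambda>i. h (x i))"
  using x
proof (induction S rule: finite_induct)
  case empty
  let ?z = "(\<lambda>_. 0) :: nat \<Rightarrow> 'k"
  have z: "?z \<in> carrier L" "?z \<oplus>\<^bsub>L\<^esub> ?z = ?z"
    using L by (auto simp: coefficient_module_def)
  have "h ?z \<in> carrier (rmodule_sum M M')" "h (?z \<oplus>\<^bsub>L\<^esub> ?z) = h ?z \<oplus>\<^bsub>rmodule_sum M M'\<^esub> h ?z"
    using h z(1) unfolding rmodule_hom_def by blast+
  then have hz: "h ?z \<in> carrier (rmodule_sum M M')" "h ?z = h ?z \<oplus>\<^bsub>rmodule_sum M M'\<^esub> h ?z"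
    by (simp_all only: z(2))
  then have "h ?z = (\<lambda>j. fst (h ?z) j + fst (h ?z) j, \<lambda>j. snd (h ?z) j + snd (h ?z) j)"
    using M by (auto simp: coefficient_module_def rmodule_sum_def case_prod_beta)
  from arg_cong[OF this, of fst] arg_cong[OF this, of snd]
  have "fst (h ?z) = (\<lambda>j. fst (h ?z) j + fst (h ?z) j)" "snd (h ?z) = (\<lambda>j. snd (h ?z) j + snd (h ?z) j)"
    by (simp_all only: fst_conv snd_conv)
  then have "h ?z = (\<lambda>_. 0, \<lambda>_. 0)"
    by (intro prod_eqI) (simp_all only: eq_double_imp_zero fst_conv snd_conv)
  with z show ?case
    by (simp add: pair_combination_def)
next
  case (insert i S)
  let ?E = "rmodule_sum M M'"
  have xi: "x i \<in> carrier L"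
    using insert.prems by simp
  then have hxi: "fst (h (x i)) \<in> carrier M" "snd (h (x i)) \<in> carrier M'"
    using h by (auto simp: rmodule_hom_def rmodule_sum_def Pi_iff mem_Times_iff)
  have IH: "(\<lambda>j. \<Sum>i\<in>S. c i * x i j) \<in> carrier L"
    "h (\<lambda>j. \<Sum>i\<in>S. c i * x i j) = pair_combination S c (\<lambda>i. h (x i))"
    using insert by auto
  have IHE: "pair_combination S c (\<lambda>i. h (x i)) \<in> carrier ?E"
    using h IH by (metis (no_types, lifting) PiE mem_Collect_eq rmodule_hom_def)
  have smult: "scalar (c i) \<odot>\<^bsub>L\<^esub> x i = (\<lambda>j. c i * x i j)" "scalar (c i) \<odot>\<^bsub>L\<^esub> x i \<in> carrier L"
    using xi L by (auto simp: coefficient_module_def)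
  have eq: "(\<lambda>j. \<Sum>i\<in>insert i S. c i * x i j) = scalar (c i) \<odot>\<^bsub>L\<^esub> x i \<oplus>\<^bsub>L\<^esub> (\<lambda>j. \<Sum>i\<in>S. c i * x i j)"
    and closed: "scalar (c i) \<odot>\<^bsub>L\<^esub> x i \<oplus>\<^bsub>L\<^esub> (\<lambda>j. \<Sum>i\<in>S. c i * x i j) \<in> carrier L"
    using smult IH(1) insert.hyps L unfolding smult(1) by (auto simp: coefficient_module_def)
  have "h (\<lambda>j. \<Sum>i\<in>insert i S. c i * x i j) =
      scalar (c i) \<odot>\<^bsub>?E\<^esub> h (x i) \<oplus>\<^bsub>?E\<^esub> pair_combination S c (\<lambda>i. h (x i))"
    unfolding eq using h xi IH smult(2) scalar_mem(2)[of "c i"] by (simp add: rmodule_hom_def)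
  also have "\<dots> = pair_combination (insert i S) c (\<lambda>i. h (x i))"
    using hxi IHE insert.hyps M
    by (auto simp: rmodule_sum_def coefficient_module_def pair_combination_def case_prod_beta)
  finally show ?case
    using closed by (simp only: eq)
qed

text \<open>
  In an exact sequence, the images of a basis of the submodule together with lifts of a basis of the
  quotient are linearly independent in the middle term. Here they outnumber the coordinates of the middle
  term, of which the first summand has \<open>length (snd w3) + 1\<close> and the second at most \<open>d\<close>.
\<close>

lemma no_short_exact_by_dimension:
  assumes w1: "is_string Q I w1" and w2: "is_string Q I w2" and w3: "is_string Q I w3"
    and M: "coefficient_module M" "\<And>y j. y \<in> carrier M \<Longrightarrow> d \<le> j \<Longrightarrow> y j = 0"
    and dim: "length (snd w3) + d < Suc (length (snd w1) + length (snd w2))"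
  shows "\<not> short_exact J (string_module Q w2) f (rmodule_sum (string_module Q w3) M) g
    (string_module Q w1)"
proof
  let ?L = "string_module Q w2 :: (_, nat \<Rightarrow> 'k) module"
  let ?E = "rmodule_sum (string_module Q w3) M"
  let ?N = "string_module Q w1 :: (_, nat \<Rightarrow> 'k) module"
  define n1 where "n1 = length (snd w1)"
  define n2 where "n2 = length (snd w2)"
  define n3 where "n3 = length (snd w3)"
  assume ex: "short_exact J ?L f ?E g ?N"
  then have f: "f \<in> rmodule_hom J ?L ?E" "inj_on f (carrier ?L)"
    and g: "g \<in> rmodule_hom J ?E ?N" "g ` carrier ?E = carrier ?N"
    and im: "f ` carrier ?L = {x \<in> carrier ?E. g x = \<zero>\<^bsub>?N\<^esub>}"
    by (auto simp: short_exact_def)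
  note cm = coefficient_module_string[OF w1] coefficient_module_string[OF w2]
    coefficient_module_string[OF w3] M(1)
  have "\<exists>y \<in> carrier ?E. g y = unit_coeff i" if "i \<le> n1" for i
  proof -
    have "unit_coeff i \<in> g ` carrier ?E"
      unfolding g(2) using that unfolding n1_def by (rule unit_coeff_in_carrier)
    then show ?thesis
      by auto
  qed
  then obtain e where e: "e i \<in> carrier ?E" "g (e i) = unit_coeff i" if "i \<le> n1" for i
    by metis
  define x where "x i = (unit_coeff i :: nat \<Rightarrow> 'k)" for i
  have x: "x i \<in> carrier ?L" if "i \<le> n2" for i
    using that unfolding x_def n2_def by (rule unit_coeff_in_carrier)
  \<comment> \<open>the two families in one, the lifts following the images\<close>
  define v where "v i = (if i \<le> n2 then f (x i) else e (i - Suc n2))" for i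
  define S where "S = {..n1 + n2 + 1}"
  have v: "v i \<in> carrier ?E" if "i \<in> S" for i
    using that e f(1) x by (auto simp: v_def S_def rmodule_hom_def)
  have gf: "g (f (x i)) = (\<lambda>_. 0)" if "i \<le> n2" for i
    using im x[OF that] by (auto simp: zero_string_module)
  \<comment> \<open>coordinates of a pair: those of the first component, then those of the second\<close>
  define a where "a i j = (if j \<le> n3 then fst (v i) j else snd (v i) (j - Suc n3))" for i j
  have "Suc n3 + d < card S"
    using dim by (simp add: S_def n1_def n2_def n3_def)
  then obtain c where c: "\<exists>i\<in>S. c i \<noteq> 0" "\<forall>j<Suc n3 + d. (\<Sum>i\<in>S. c i * a i j) = 0"
    using homogeneous_system_nontrivial_solution[of S "Suc n3 + d" a] by (auto simp: S_def)
  have "(\<Sum>i\<in>S. c i * fst (v i) j) = 0" for j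
  proof (cases "j \<le> n3")
    case True
    then show ?thesis
      using c(2)[rule_format, of j] by (simp add: a_def)
  next
    case False
    then have "fst (v i) j = 0" if "i \<in> S" for i
      using v[OF that] by (auto simp: rmodule_sum_def carrier_string_module n3_def)
    then show ?thesis
      by simp
  qed
  moreover have "(\<Sum>i\<in>S. c i * snd (v i) j) = 0" for j
  proof (cases "j < d")
    case True
    then show ?thesis
      using c(2)[rule_format, of "Suc n3 + j"] by (simp add: a_def)
  next
    case False
    then have "snd (v i) j = 0" if "i \<in> S" for i
      using v[OF that] M(2) by (auto simp: rmodule_sum_def)
    then show ?thesis
      by simp
  qed
  ultimately have comb: "pair_combination S c v = (\<lambda>_. 0, \<lambda>_. 0)"
    by (simp add: pair_combination_def)
  have gv: "g (v i) = (if i \<le> n2 then \<lambda>_. 0 else unit_coeff (i - Suc n2))" if "i \<in> S" for i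
    using that gf e by (auto simp: v_def S_def)
  have "finite S"
    by (simp add: S_def)
  have "g (pair_combination S c v) = (\<lambda>j. \<Sum>i\<in>S. c i * g (v i) j)"
    using hom_pair_combination[OF cm(3,4,1) g(1) \<open>finite S\<close>, of v c] v by blast
  moreover have "g (\<lambda>_. 0, \<lambda>_. 0) = (\<lambda>_. 0)"
    using hom_pair_combination[OF cm(3,4,1) g(1) finite.emptyI, of v c]
    by (simp add: pair_combination_def)
  ultimately have gsum: "(\<Sum>i\<in>S. c i * g (v i) j) = 0" for j
    unfolding comb by (simp add: fun_eq_iff)
  \<comment> \<open>applying \<open>g\<close> to the dependence leaves the lifts only, and these become basis elements\<close>
  have c0: "c i = 0" if i: "i \<in> S" "n2 < i" for i
  proof -
    have "(\<Sum>i'\<in>S. c i' * g (v i') (i - Suc n2)) = (\<Sum>i'\<in>S. if i' = i then c i' else 0)"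
      using i by (intro sum.cong refl) (auto simp: gv unit_coeff_def)
    also have "\<dots> = c i"
      using i \<open>finite S\<close> by simp
    finally show ?thesis
      using gsum by simp
  qed
  have "pair_combination S c v = pair_combination {..n2} c v"
    unfolding pair_combination_def using c0
    by (intro arg_cong2[where f = Pair] ext sum.mono_neutral_right) (auto simp: S_def)
  also have "\<dots> = pair_combination {..n2} c (\<lambda>i. f (x i))"
    by (auto simp: pair_combination_def v_def intro!: sum.cong)
  also have "\<dots> = f (\<lambda>j. \<Sum>i\<le>n2. c i * x i j)"
    using hom_into_pairs_combination[OF cm(2,3,4) f(1), where S = "{..n2}" and x = x and c = c] x by simp
  finally have "f (\<lambda>j. \<Sum>i\<le>n2. c i * x i j) = (\<lambda>_. 0, \<lambda>_. 0)"
    using comb by simp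
  moreover have "f (\<lambda>_. 0) = (\<lambda>_. 0, \<lambda>_. 0)"
    using hom_into_pairs_combination[OF cm(2,3,4) f(1), where S = "{}" and x = x and c = c] by (simp add: pair_combination_def)
  moreover have "(\<lambda>j. \<Sum>i\<le>n2. c i * x i j) \<in> carrier ?L" "(\<lambda>_. 0) \<in> carrier ?L"
    using hom_into_pairs_combination[OF cm(2,3,4) f(1), where S = "{..n2}" and x = x and c = c] x
    by (auto simp: carrier_string_module)
  ultimately have "(\<lambda>j. \<Sum>i\<le>n2. c i * x i j) = (\<lambda>_. 0)"
    by (intro inj_onD[OF f(2)]) simp_all
  then have xsum: "(\<Sum>i\<le>n2. c i * x i j) = 0" for j
    by (rule fun_cong)
  have "c j = 0" if "j \<le> n2" for j
  proof -
    have "(\<Sum>i\<le>n2. c i * x i j) = (\<Sum>i\<le>n2. if i = j then c i else 0)"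
      by (intro sum.cong refl) (auto simp: x_def unit_coeff_def)
    then show ?thesis
      using that xsum[of j] by simp
  qed
  with c0 c(1) show False
    by (meson not_le)
qed

end
section \<open>Triangles of a triangulation\<close>

lemma corner_add_3: "corner (k + 3) = corner k"
proof -
  have "2 * pi * real (k + 3) / 3 = 2 * pi * real k / 3 + 2 * pi"
    by (simp add: field_simps)
  then show ?thesis
    unfolding corner_def by (simp only: cis_mult[symmetric] cis_2pi mult_1_right)
qed

lemma corner_mod_3: "corner (k mod 3) = corner k"
proof (induction k rule: less_induct)
  case (less k)
  show ?case
  proof (cases "k < 3")
    case False
    then have "corner k = corner (k - 3)" "k mod 3 = (k - 3) mod 3"
      using corner_add_3[of "k - 3"] by (simp_all add: le_mod_geq)
    then show ?thesis
      using less[of "k - 3"] False by simp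
  qed simp
qed

lemma range_corner: "range corner = {corner k, corner (k + 1), corner (k + 2)}"
proof (induction k)
  case 0
  have "corner n \<in> {corner 0, corner 1, corner 2}" for n
  proof -
    have "n mod 3 = 0 \<or> n mod 3 = 1 \<or> n mod 3 = 2"
      by linarith
    then show ?thesis
      by (metis corner_mod_3 insertCI)
  qed
  then show ?case
    by (auto simp: numeral_2_eq_2)
next
  case (Suc k)
  then show ?case
    using corner_add_3[of k] by (simp add: eval_nat_numeral insert_commute)
qed

lemma std_side_add_3: "std_side (k + 3) = std_side k"
  using corner_add_3[of k] corner_add_3[of "Suc k"] by (simp add: std_side_def)

lemma std_triangle_eq: "std_triangle = convex hull {corner k, corner (k + 1), corner (k + 2)}"
  unfolding std_triangle_def range_corner[of k] ..

lemma compact_std_triangle: "compact std_triangle"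
  unfolding std_triangle_eq[of 0] by (intro compact_convex_hull finite_imp_compact) simp

lemma frontier_std_triangle:
  "frontier std_triangle = std_side k \<union> std_side (k + 1) \<union> std_side (k + 2)"
  unfolding std_triangle_eq[of k]
  using corner_add_3[of k] by (subst frontier_of_triangle) (simp_all add: std_side_def eval_nat_numeral)

lemma std_triangle_decomp:
  "std_triangle = interior std_triangle \<union> (std_side k \<union> std_side (k + 1) \<union> std_side (k + 2))"
  using frontier_std_triangle[of k] compact_imp_closed[OF compact_std_triangle] interior_subset
  by (auto simp: frontier_def)

text \<open>
  A triangle with interior points has affinely independent corners.
\<close>

lemma consecutive_sides_meet:
  assumes "interior std_triangle \<noteq> {}"
  shows "std_side k \<inter> std_side (k + 1) = {corner (k + 1)}"
proof -
  let ?a = "corner k" and ?b = "corner (k + 1)" and ?c = "corner (k + 2)"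
  have int: "interior (convex hull {?a, ?b, ?c}) \<noteq> {}"
    using assms by (simp add: std_triangle_eq[of k])
  have "\<not> card {?a, ?b, ?c} \<le> DIM(complex)"
    using int empty_interior_convex_hull[of "{?a, ?b, ?c}"] by auto
  then have card: "card {?a, ?b, ?c} = Suc (DIM(complex))"
    using card_insert_le_m1[of 3 "{?b, ?c}" ?a] by (auto simp: card_insert_if split: if_splits)
  then have "\<not> affine_dependent {?a, ?b, ?c}"
    using int interior_convex_hull_eq_empty by blast
  moreover have "?a \<noteq> ?b" "?a \<noteq> ?c" "?b \<noteq> ?c"
    using card by (auto simp: card_insert_if split: if_splits)
  ultimately have "\<not> collinear {?a, ?b, ?c}"
    by (simp add: collinear_3_eq_affine_dependent)
  then show ?thesis
    using Int_closed_segment[of ?b ?a ?c] by (simp add: std_side_def)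
qed

lemma triangle_with_sides_rotate:
  "triangle_with_sides X A P T D a b c \<Longrightarrow> triangle_with_sides X A P T D b c a"
proof -
  assume "triangle_with_sides X A P T D a b c"
  then obtain \<tau> k where "triangle_param X A P T \<tau>" "D = \<tau> ` interior std_triangle"
    "a = \<tau> ` std_side k" "b = \<tau> ` std_side (k + 1)" "c = \<tau> ` std_side (k + 2)"
    unfolding triangle_with_sides_def by blast
  then have "triangle_param X A P T \<tau> \<and> D = \<tau> ` interior std_triangle \<and> b = \<tau> ` std_side (k + 1) \<and>
      c = \<tau> ` std_side (k + 1 + 1) \<and> a = \<tau> ` std_side (k + 1 + 2)"
    using std_side_add_3[of k] by (simp add: eval_nat_numeral)
  then show ?thesis
    unfolding triangle_with_sides_def by blast
qed

context
  fixes X :: "'a topology" and A P T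
  assumes surface: "marked_surface X A P" and triangulation: "surface_triangulation X A P T"
begin

text \<open>
  The image of the closed triangle is compact, hence it is the closure of \<open>D\<close>; and the sides, lying on
  arcs or on the boundary, are disjoint from \<open>D\<close>. So the union of the sides depends only on \<open>D\<close> and not
  on the parametrisation. Two sides meet at corners only, because the parametrisation is injective elsewhere.
\<close>

lemma triangle_sides_closure:
  assumes D: "triangle_with_sides X A P T D a b c"
  shows "X closure_of D - D = a \<union> b \<union> c" and "finite (a \<inter> b)"
proof -
  obtain \<tau> k where \<tau>: "triangle_param X A P T \<tau>" and D_eq: "D = \<tau> ` interior std_triangle"
    and abc: "a = \<tau> ` std_side k" "b = \<tau> ` std_side (k + 1)" "c = \<tau> ` std_side (k + 2)"
    using D by (auto simp: triangle_with_sides_def)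
  have cont: "continuous_map (top_of_set std_triangle) X \<tau>"
    and inj: "inj_on \<tau> (std_triangle - range corner)"
    and region: "D \<in> triangle_regions X A T"
    and sides: "\<And>k. \<tau> ` std_side k \<in> T \<union> boundary_segments X A P"
    using \<tau> by (auto simp: triangle_param_def D_eq)
  \<comment> \<open>a component is non-empty, so the standard triangle has interior points and is non-degenerate\<close>
  have "D \<noteq> {}"
    using region nonempty_connected_components_of by (auto simp: triangle_regions_def)
  then have nonempty: "interior std_triangle \<noteq> {}"
    by (auto simp: D_eq)
  have image: "\<tau> ` std_triangle = D \<union> (a \<union> b \<union> c)"
    by (subst std_triangle_decomp[of k]) (simp add: D_eq abc image_Un)
  have "X closure_of D = \<tau> ` std_triangle"
  proof
    have "compactin (top_of_set std_triangle) std_triangle"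
      using compact_std_triangle by (simp add: compactin_subtopology)
    then have "compactin X (\<tau> ` std_triangle)"
      using cont by (rule image_compactin)
    then have "closedin X (\<tau> ` std_triangle)"
      using surface compactin_imp_closedin
      by (auto simp: marked_surface_def riemann_surface_def)
    then show "X closure_of D \<subseteq> \<tau> ` std_triangle"
      using image by (intro closure_of_minimal) auto
    have "closure (interior std_triangle) = std_triangle"
      using convex_closure_interior[of std_triangle] nonempty compact_imp_closed[OF compact_std_triangle]
      by (simp add: std_triangle_def)
    then have "top_of_set std_triangle closure_of interior std_triangle = std_triangle"
      using interior_subset[of std_triangle] by (simp add: closure_of_subtopology Int_absorb1)
    then show "\<tau> ` std_triangle \<subseteq> X closure_of D"
      using continuous_map_image_closure_subset[OF cont, of "interior std_triangle"] by (simp add: D_eq)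
  qed
  moreover have "D \<inter> e = {}" if "e = a \<or> e = b \<or> e = c" for e
  proof -
    have "e \<in> T \<union> boundary_segments X A P"
      using that sides by (auto simp: abc)
    moreover have "f \<subseteq> surface_boundary A" if "f \<in> boundary_segments X A P" for f
    proof
      fix x assume "x \<in> f"
      then obtain g t where g: "boundary_segment_path X A P g" "t \<in> {0..1}" "x = g t"
        using \<open>f \<in> boundary_segments X A P\<close> by (auto simp: boundary_segments_def)
      then have "t = 0 \<or> t = 1 \<or> t \<in> {0<..<1}"
        by auto
      then show "x \<in> surface_boundary A"
        using g surface by (auto simp: boundary_segment_path_def marked_surface_def)
    qed
    moreover have "D \<subseteq> topspace X - (\<Union>T \<union> surface_boundary A)"
      using region connected_components_of_subset unfolding triangle_regions_def by fastforce
    ultimately show ?thesis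
      by blast
  qed
  ultimately show "X closure_of D - D = a \<union> b \<union> c"
    unfolding image by blast
  have "std_side k \<subseteq> std_triangle" "std_side (k + 1) \<subseteq> std_triangle"
    using std_triangle_decomp[of k] by auto
  have "a \<inter> b \<subseteq> \<tau> ` range corner"
  proof
    fix x assume "x \<in> a \<inter> b"
    then obtain z z' where z: "z \<in> std_side k" "z' \<in> std_side (k + 1)" "x = \<tau> z" "x = \<tau> z'"
      by (auto simp: abc)
    have "z = z'" if "z \<notin> range corner" "z' \<notin> range corner"
      using inj z that \<open>std_side k \<subseteq> _\<close> \<open>std_side (k + 1) \<subseteq> _\<close> by (auto simp: inj_on_def subset_iff)
    then show "x \<in> \<tau> ` range corner"
      using z consecutive_sides_meet[OF nonempty, of k] by blast
  qed
  moreover have "finite (range corner)"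
    by (simp add: range_corner[of 0])
  ultimately show "finite (a \<inter> b)"
    by (meson finite_imageI finite_subset)
qed

lemma arc_infinite:
  assumes "a \<in> T"
  shows "infinite a"
proof -
  have "a \<in> surface_arcs X A P"
    using assms triangulation by (auto simp: surface_triangulation_def noncrossing_arcs_def)
  then obtain g where g: "a = g ` {0..1::real}" "inj_on g {0<..<1}"
    by (auto simp: surface_arcs_def arc_path_def)
  have "infinite (g ` {0<..<1})"
    using g(2) infinite_Ioo[of 0 "1::real"] by (simp add: finite_image_iff)
  moreover have "g ` {0<..<1} \<subseteq> a"
    by (auto simp: g(1))
  ultimately show ?thesis
    using finite_subset by blast
qed

lemma arcs_eqI:
  assumes "a \<in> T" "b \<in> T" "infinite (a \<inter> b)"
  shows "a = b"
proof (rule ccontr)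
  assume "a \<noteq> b"
  then have "a \<inter> b \<subseteq> P"
    using assms triangulation by (auto simp: surface_triangulation_def noncrossing_arcs_def)
  moreover have "finite P"
    using surface by (simp add: marked_surface_def)
  ultimately show False
    using assms(3) finite_subset by blast
qed

text \<open>
  The side \<open>c\<close> is covered by \<open>a\<close>, \<open>b\<close> and \<open>c'\<close>. It meets \<open>a\<close> and \<open>b\<close> in finitely many points, so it shares
  infinitely many points with \<open>c'\<close>, whereas distinct arcs of \<open>T\<close> share only marked points.
\<close>

lemma triangle_third_side:
  assumes D: "triangle_with_sides X A P T D a b c" "triangle_with_sides X A P T D a b c'"
    and c: "c \<in> T" "c' \<in> T"
  shows "c = c'"
proof (rule arcs_eqI[OF c])
  have "finite (b \<inter> c)" "finite (c \<inter> a)"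
    using triangle_sides_closure(2)[OF triangle_with_sides_rotate[OF D(1)]]
      triangle_sides_closure(2)[OF triangle_with_sides_rotate[OF triangle_with_sides_rotate[OF D(1)]]]
    by simp_all
  moreover have "c \<subseteq> a \<union> b \<union> c'"
    using triangle_sides_closure(1)[OF D(1)] triangle_sides_closure(1)[OF D(2)] by blast
  then have "c = (c \<inter> a) \<union> (b \<inter> c) \<union> (c \<inter> c')"
    by blast
  ultimately show "infinite (c \<inter> c')"
    using arc_infinite[OF c(1)] by (metis finite_Un)
qed

end
section \<open>Strings obtained by crossings\<close>

context quadratic_monomial_quiver
begin

lemma is_string_suffix:
  assumes "is_string Q I (v, xs @ ys)"
  shows "is_string Q I (word_end Q (v, xs), ys)"
  using assms by (simp add: is_string_iff is_walk_append successively_append_iff)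

text \<open>
  If \<open>u\<close> is not empty, every pair of consecutive letters of the new word already occurs in one of the
  given strings. If \<open>u\<close> is a single vertex, one new pair arises.
\<close>

lemma is_string_splice:
  assumes w1: "is_string Q I (v1, p1 @ u @ q1)" and w2: "is_string Q I (v2, p2 @ u @ q2)"
    and start: "word_end Q (v1, p1) = word_end Q (v2, p2)"
    and meet: "\<lbrakk>u = []; p1 \<noteq> []; q2 \<noteq> []\<rbrakk> \<Longrightarrow> composable_letters (last p1) (hd q2)"
  shows "is_string Q I (v1, p1 @ u @ q2)"
  using assms
  by (cases "u = []") (auto simp: is_string_iff is_walk_append successively_append_iff)

text \<open>
  Only the two pairs of letters involving \<open>\<gamma>\<^sup>-\<^sup>1\<close> are new. A letter before it is not \<open>\<gamma>\<close>, since
  \<open>\<gamma>\<close> could not be followed by \<open>\<alpha>\<close>; if it is \<open>e\<^sup>-\<^sup>1\<close> with \<open>\<gamma> e\<close> a relation, then \<open>e = \<alpha>\<close>, and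
  \<open>\<alpha>\<^sup>-\<^sup>1\<close> could not be followed by \<open>\<alpha>\<close>. If the letter behind it is \<open>e\<^sup>-\<^sup>1\<close> with \<open>e \<gamma>\<close> a relation, then
  \<open>e = \<beta>\<close>, which is excluded, as is \<open>\<gamma>\<close> at this place.
\<close>

lemma three_cycle_string:
  assumes w1: "is_string Q I (v1, p @ Dir \<alpha> # q)" and w2: "is_string Q I w2"
    and \<gamma>: "\<gamma> \<in> arcs Q" "tail Q \<gamma> = fst w2" "head Q \<gamma> = tail Q \<alpha>"
    and rel: "(\<gamma>, \<alpha>) \<in> Rel" "(\<beta>, \<gamma>) \<in> Rel"
    and hd: "snd w2 \<noteq> [] \<Longrightarrow> hd (snd w2) \<notin> {Inv \<beta>, Dir \<gamma>}"
    and unique: "single_valued Rel" "single_valued (Rel\<inverse>)"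
  shows "is_string Q I (v1, p @ Inv \<gamma> # snd w2)"
proof -
  have "composable_letters (last p) (Inv \<gamma>)" if "p \<noteq> []"
  proof (cases "last p")
    case (Dir e)
    then have "(e, \<alpha>) \<notin> Rel"
      using w1 that by (auto simp: is_string_iff successively_append_iff)
    then show ?thesis
      using rel(1) Dir by auto
  next
    case (Inv e)
    then have "e \<noteq> \<alpha>"
      using w1 that by (auto simp: is_string_iff successively_append_iff)
    then have "(\<gamma>, e) \<notin> Rel"
      using single_valuedD[OF unique(1), of \<gamma> e \<alpha>] rel(1) by auto
    then show ?thesis
      using Inv by simp
  qed
  moreover have "composable_letters (Inv \<gamma>) (hd (snd w2))" if "snd w2 \<noteq> []"
  proof (cases "hd (snd w2)")
    case (Dir e)
    then show ?thesis
      using hd[OF that] by auto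
  next
    case (Inv e)
    then have "e \<noteq> \<beta>"
      using hd[OF that] by auto
    then have "(e, \<gamma>) \<notin> Rel"
      using single_valuedD[OF unique(2), of \<gamma> e \<beta>] rel(2) by auto
    then show ?thesis
      using Inv by simp
  qed
  ultimately show ?thesis
    using w1 w2 \<gamma>
    by (auto simp: is_string_iff is_walk_append successively_append_iff successively_Cons)
qed

text \<open>
  What remains is an end piece of the word. The deleted part contains at least \<open>\<alpha>\<close> and one inverse letter.
\<close>

lemma delete_cohook_start_SomeE:
  assumes w: "is_string Q I (v, Dir \<alpha> # q)"
    and del: "delete_cohook_start Q (v, Dir \<alpha> # q) = Some w'"
  shows "is_string Q I w'" "length (snd w') < length q"
proof -
  let ?P = "\<lambda>l. \<exists>a. l = Dir a"
  obtain l ls where ls: "dropWhile ?P q = l # ls" and w': "w' = (letter_tgt Q l, ls)"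
    using del by (auto simp: delete_cohook_start_def split: list.splits)
  have "Dir \<alpha> # q = (Dir \<alpha> # takeWhile ?P q @ [l]) @ ls"
    using takeWhile_dropWhile_id[of ?P q] ls by simp
  then show "is_string Q I w'"
    using is_string_suffix[of v "Dir \<alpha> # takeWhile ?P q @ [l]" ls] w
    by (simp add: w' word_end_def)
  show "length (snd w') < length q"
    using length_dropWhile_le[of ?P q] ls by (simp add: w')
qed

lemma module_crossing:
  assumes M: "fg_right_module J M1" "fg_right_module J M2"
    and cross: "crosses_in_module Q I M1 M2 p1 p2 w q1 q2"
    and w3: "w3 = (fst p1, snd p1 @ snd w @ q2)" and w4: "w4 = (fst p2, snd p2 @ snd w @ q1)"
  shows "is_string Q I w3 \<and> is_string Q I w4 \<and>
    gives_nonsplit_extension J M2 (rmodule_sum (string_module Q w3) (string_module Q w4)) M1"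
proof -
  note c = cross[unfolded crosses_in_module_def Let_def]
  have w12: "is_string Q I (fst p1, snd p1 @ snd w @ q1)" "is_string Q I (fst p2, snd p2 @ snd w @ q2)"
    using c by blast+
  have iso: "rmodule_iso J M1 (string_module Q (fst p1, snd p1 @ snd w @ q1))"
    "rmodule_iso J M2 (string_module Q (fst p2, snd p2 @ snd w @ q2))"
    using c by blast+
  have start: "word_end Q (fst p1, snd p1) = word_end Q (fst p2, snd p2)"
    using c by simp
  have p1: "snd p1 = [] \<or> (\<exists>\<alpha>. last (snd p1) = Dir \<alpha>)" and q1: "q1 = [] \<or> (\<exists>\<beta>. hd q1 = Inv \<beta>)"
    and p2: "snd p2 = [] \<or> (\<exists>\<gamma>. last (snd p2) = Inv \<gamma>)" and q2: "q2 = [] \<or> (\<exists>\<delta>. hd q2 = Dir \<delta>)"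
    and ne: "\<not> (snd p1 = [] \<and> snd p2 = [])" "\<not> (q1 = [] \<and> q2 = [])"
    using c by blast+
  have str3: "is_string Q I w3"
    unfolding w3
  proof (rule is_string_splice[OF w12 start])
    assume "snd w = []" "snd p1 \<noteq> []" "q2 \<noteq> []"
    moreover from this obtain \<alpha> \<delta> where "last (snd p1) = Dir \<alpha>" "hd q2 = Dir \<delta>"
      using p1 q2 by blast
    ultimately show "composable_letters (last (snd p1)) (hd q2)"
      using c by (simp add: pair_in_I_iff)
  qed
  have str4: "is_string Q I w4"
    unfolding w4
  proof (rule is_string_splice[OF w12(2,1) start[symmetric]])
    assume "snd w = []" "snd p2 \<noteq> []" "q1 \<noteq> []"
    moreover from this obtain \<gamma> \<beta> where "last (snd p2) = Inv \<gamma>" "hd q1 = Inv \<beta>"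
      using p2 q1 by blast
    ultimately show "composable_letters (last (snd p2)) (hd q1)"
      using c by (simp add: pair_in_I_iff)
  qed
  have "gives_nonsplit_extension J (string_module Q (fst p2, snd p2 @ snd w @ q2))
      (rmodule_sum (string_module Q w3) (string_module Q w4))
      (string_module Q (fst p1, snd p1 @ snd w @ q1))"
    unfolding w3 w4
    by (rule module_crossing_extension[OF w12 str3[unfolded w3] str4[unfolded w4] start p1 q1 p2 q2 ne])
  then show ?thesis
    using str3 str4 nonsplit_extension_iso M iso by blast
qed

lemma arrow_crossing:
  assumes M: "fg_right_module J M1" "fg_right_module J M2"
    and cross: "crosses_in_arrow Q I M1 M2 w1 \<alpha> w2"
    and w3: "w3 = (fst w1, snd w1 @ Dir \<alpha> # snd w2)"
  shows "is_string Q I w3 \<and> gives_nonsplit_extension J M2 (string_module Q w3) M1"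
proof -
  note c = cross[unfolded crosses_in_arrow_def]
  have "gives_nonsplit_extension J (string_module Q (fst w2, snd w2)) (string_module Q w3)
      (string_module Q (fst w1, snd w1))"
    unfolding w3 by (rule arrow_crossing_extension) (use c in \<open>auto simp: word_start_def\<close>)
  then show ?thesis
    using c M nonsplit_extension_iso by (auto simp: w3)
qed

text \<open>
  The outer modules have total dimension \<open>|p| + |q| + |w2| + 3\<close>, lengths being counted in letters. The first
  middle term has dimension \<open>|p| + |w2| + 2\<close> and the second at most \<open>|q|\<close>.
\<close>

lemma three_cycle_crossing:
  assumes M: "fg_right_module J M1" "fg_right_module J M2"
    and unique: "single_valued Rel" "single_valued (Rel\<inverse>)"
    and cross: "crosses_in_3cycle Q I M1 M2 \<gamma> \<alpha> \<beta> p q w2"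
    and w3: "w3 = (fst p, snd p @ Inv \<gamma> # snd w2)"
    and w4: "w4 = delete_cohook_start Q (tail Q \<alpha>, Dir \<alpha> # q)"
  shows "is_string Q I w3 \<and> (\<forall>v. w4 = Some v \<longrightarrow> is_string Q I v) \<and>
    \<not> gives_ext_element J M2 (rmodule_sum (string_module Q w3) (string_module_opt Q w4)) M1"
proof -
  note c = cross[unfolded crosses_in_3cycle_def Let_def]
  define w1 where "w1 = (fst p, snd p @ Dir \<alpha> # q)"
  have w12: "is_string Q I w1" "is_string Q I w2"
    and iso: "rmodule_iso J M1 (string_module Q w1)" "rmodule_iso J M2 (string_module Q w2)"
    using c by (simp_all add: w1_def)
  have rel: "(\<gamma>, \<alpha>) \<in> Rel" "(\<beta>, \<gamma>) \<in> Rel"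
    using c by (simp_all add: pair_in_I_iff)
  have str3: "is_string Q I w3"
    unfolding w3
  proof (rule three_cycle_string[OF w12(1)[unfolded w1_def] w12(2) _ _ _ rel _ unique])
    show "snd w2 \<noteq> [] \<Longrightarrow> hd (snd w2) \<notin> {Inv \<beta>, Dir \<gamma>}"
      using c by blast
  qed (use c in \<open>auto simp: word_start_def\<close>)
  have tail: "is_string Q I (tail Q \<alpha>, Dir \<alpha> # q)"
    using is_string_suffix[OF w12(1)[unfolded w1_def]] is_string_iff by force
  have str4: "is_string Q I v \<and> length (snd v) < length q" if "w4 = Some v" for v
    using delete_cohook_start_SomeE[OF tail, of v] that w4 by simp
  have "\<not> short_exact J (string_module Q w2) f
      (rmodule_sum (string_module Q w3) (string_module_opt Q w4)) g (string_module Q w1)" for f g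
  proof (cases w4)
    case None
    show ?thesis
      unfolding None
      by (rule no_short_exact_by_dimension[OF w12 str3, where d = 0])
        (simp_all add: string_module_opt_def coefficient_module_zero w1_def w3,
          simp add: zero_module_def)
  next
    case (Some v)
    show ?thesis
      unfolding Some
      by (rule no_short_exact_by_dimension[OF w12 str3, where d = "Suc (length (snd v))"])
        (use str4[OF Some] in \<open>auto simp: string_module_opt_def coefficient_module_string w1_def w3
          carrier_string_module\<close>)
  qed
  moreover have "\<exists>f g. short_exact J (string_module Q w2) f E g (string_module Q w1)"
    if "short_exact J M2 f E g M1" for f g and E :: "(_, (nat \<Rightarrow> 'k) \<times> (nat \<Rightarrow> 'k)) module"
  proof -
    obtain \<phi> where \<phi>: "\<phi> \<in> rmodule_hom J M1 (string_module Q w1)"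
      "bij_betw \<phi> (carrier M1) (carrier (string_module Q w1))"
      using iso by (auto simp: rmodule_iso_def)
    obtain \<psi> where \<psi>: "\<psi> \<in> rmodule_hom J M2 (string_module Q w2)"
      "bij_betw \<psi> (carrier M2) (carrier (string_module Q w2))"
      using iso by (auto simp: rmodule_iso_def)
    have "right_module J M2"
      using M by (simp add: fg_right_module_def)
    note inv = rmodule_iso_inverse[OF this \<psi>]
    show ?thesis
      using short_exact_iso[OF that fg_string_module[OF w12(2)] inv fg_string_module[OF w12(1)] \<phi>]
      by blast
  qed
  ultimately show ?thesis
    using str3 str4 unfolding gives_ext_element_def by blast
qed

end

section \<open>The quiver of a triangulation\<close>

definition potential_relations ::
    "'a topology \<Rightarrow> 'a atlas \<Rightarrow> 'a set \<Rightarrow> 'a set set \<Rightarrow> ('a tri_arrow \<times> 'a tri_arrow) set" where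
  "potential_relations X A P T = {(x, y). \<exists>z. [x, y, z] \<in> potential_cycles X A P T}"

lemma potential_relations_iff:
  "(x, y) \<in> potential_relations X A P T \<longleftrightarrow>
     (\<exists>D a b c. x = (D, a, b) \<and> y = (D, b, c) \<and> a \<in> T \<and> b \<in> T \<and> c \<in> T \<and>
        triangle_with_sides X A P T D a b c)"
  by (auto simp: potential_relations_def potential_cycles_def)

text \<open>
  A relation records a triangle and its three sides in cyclic order; one of its arrows fixes the triangle
  and two of the sides, hence also the third.
\<close>

lemma potential_relations_unique:
  assumes "marked_surface X A P" "surface_triangulation X A P T"
  shows "single_valued (potential_relations X A P T)"
    and "single_valued ((potential_relations X A P T)\<inverse>)"
  unfolding single_valued_def converse_iff potential_relations_iff
  using triangle_third_side[OF assms] triangle_with_sides_rotate[of X A P T] by blast+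

lemma triangulation_quiver_relations:
  assumes "surface_triangulation X A P T"
  shows "quadratic_monomial_quiver (triangulation_quiver X A P T) (potential_relations X A P T)
    (jacobian_ideal X A P T :: (_ \<Rightarrow> 'k::field) set)"
proof
  let ?Q = "triangulation_quiver X A P T"
  show "tail ?Q e \<in> verts ?Q" "head ?Q e \<in> verts ?Q" if "e \<in> arcs ?Q" for e
    using that by (auto simp: triangulation_quiver_def)
  show "finite (verts ?Q)"
    using assms by (simp add: triangulation_quiver_def surface_triangulation_def)
  show "x \<in> arcs ?Q \<and> y \<in> arcs ?Q \<and> head ?Q x = tail ?Q y"
    if "(x, y) \<in> potential_relations X A P T" for x y
    using that triangle_with_sides_rotate[of X A P T]
    by (fastforce simp: potential_relations_iff triangulation_quiver_def)
  have "{path_elem (tail ?Q x, [x, y]) :: _ \<Rightarrow> 'k | x y z. [x, y, z] \<in> potential_cycles X A P T} =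
      {path_elem (tail ?Q x, [x, y]) | x y. (x, y) \<in> potential_relations X A P T}"
    by (auto simp: potential_relations_def)
  then show "(jacobian_ideal X A P T :: (_ \<Rightarrow> 'k) set) = Idl\<^bsub>path_algebra ?Q\<^esub>
      {path_elem (tail ?Q x, [x, y]) | x y. (x, y) \<in> potential_relations X A P T}"
    by (simp only: jacobian_ideal_def Let_def)
qed

theorem theorem3p7:
  fixes X :: "'a topology" and A :: "'a atlas" and P :: "'a set" and T :: "'a set set"
    and Q :: "('a set, 'a tri_arrow) quiver"
    and I :: "(('a set, 'a tri_arrow) qpath \<Rightarrow> 'k::alg_closed_field) set"
    and J :: "(('a set, 'a tri_arrow) qpath \<Rightarrow> 'k) set ring"
    and M1 :: "((('a set, 'a tri_arrow) qpath \<Rightarrow> 'k) set, 'm) module"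
    and M2 :: "((('a set, 'a tri_arrow) qpath \<Rightarrow> 'k) set, 'n) module"
  assumes "marked_surface X A P"
    and "surface_triangulation X A P T"
    and "Q = triangulation_quiver X A P T"
    and "I = jacobian_ideal X A P T"
    and "J = path_algebra Q Quot I"
    and "is_string_module Q I M1"
    and "is_string_module Q I M2"
  shows
    "(\<forall>p1 p2 w q1 q2 w3 w4.
        crosses_in_module Q I M1 M2 p1 p2 w q1 q2 \<and>
        w3 = (fst p1, snd p1 @ snd w @ q2) \<and>
        w4 = (fst p2, snd p2 @ snd w @ q1) \<longrightarrow>
        is_string Q I w3 \<and> is_string Q I w4 \<and>
        gives_nonsplit_extension J M2 (rmodule_sum (string_module Q w3) (string_module Q w4)) M1)
     \<and>
     (\<forall>w1 \<alpha> w2 w3.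
        crosses_in_arrow Q I M1 M2 w1 \<alpha> w2 \<and>
        w3 = (fst w1, snd w1 @ Dir \<alpha> # snd w2) \<longrightarrow>
        is_string Q I w3 \<and>
        gives_nonsplit_extension J M2 (string_module Q w3) M1)
     \<and>
     (\<forall>\<gamma> \<alpha> \<beta> p q w2 w3 w4.
        crosses_in_3cycle Q I M1 M2 \<gamma> \<alpha> \<beta> p q w2 \<and>
        w3 = (fst p, snd p @ Inv \<gamma> # snd w2) \<and>
        w4 = delete_cohook_start Q (tail Q \<alpha>, Dir \<alpha> # q) \<longrightarrow>
        is_string Q I w3 \<and> (\<forall>v. w4 = Some v \<longrightarrow> is_string Q I v) \<and>
        \<not> gives_ext_element J M2
            (rmodule_sum (string_module Q w3) (string_module_opt Q w4)) M1)"
proof -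
  interpret quadratic_monomial_quiver Q "potential_relations X A P T" I
    unfolding assms(3,4) by (rule triangulation_quiver_relations[OF assms(2)])
  have M: "fg_right_module (path_algebra Q Quot I) M1" "fg_right_module (path_algebra Q Quot I) M2"
    using assms(6,7) by (simp_all add: is_string_module_def)
  note unique = potential_relations_unique[OF assms(1,2)]
  show ?thesis
    unfolding assms(5)
    using module_crossing[OF M] arrow_crossing[OF M] three_cycle_crossing[OF M unique] by blast
qed

end
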